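(* Let $n\geqslant 1$ be an integer and $s\in(0,1)$. Suppose that $k\in\mathbb{N}$ and that $f\in C^k(\overline{B_1})$ is $x_1$-antisymmetric, where $B_1\subset\mathbb{R}^n$ is the unit ball centered at the origin. Then for all $\varepsilon>0$ there exist a smooth $x_1$-antisymmetric function $u:\mathbb{R}^n\to\mathbb{R}$ and a real number $R>1$ such that $u$ is $s$-harmonic in $B_1$, $u=0$ in $\mathbb{R}^n\setminus B_R$, and $$\|u-f\|_{C^k(B_1)}<\varepsilon .$$
   Context: $B_r$ denotes the ball of radius $r$ centered at $0$ in $\mathbb{R}^n$. For $s\in(0,1)$ the fractional Laplacian is $$(-\Delta)^s u(x)=c_{n,s}\,\mathrm{P.V.}\int_{\mathbb{R}^n}\frac{u(x)-u(y)}{|x-y|^{n+2s}}\,dy,$$ where P.V. is the Cauchy principal value (limit as $\varepsilon\to0^+$ of the integral over $\mathbb{R}^n\setminus B_\varepsilon(x)$) and $c_{n,s}=\frac{s4^s\Gamma(\frac{n+2s}{2})}{\Gamma(1-s)}>0$ is a normalisation constant. A function $u$ is $s$-harmonic in an open set $U$ if $(-\Delta)^su=0$ in $U$. A function $u$ (on $\mathbb{R}^n$, or on a set symmetric under $x_1\mapsto -x_1$) is $x_1$-antisymmetric if $u(-x_1,x_2,\dots,x_n)=-u(x_1,x_2,\dots,x_n)$ for all $x$ in its domain. *)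

theory Defs
  imports "HOL-Analysis.Analysis"
begin

subsection \<open>Partial derivatives and \<open>C\<^sup>k\<close> spaces\<close>

definition has_partial :: "'n::finite \<Rightarrow> (real^'n \<Rightarrow> real) \<Rightarrow> real^'n \<Rightarrow> bool" where
  "has_partial i f x \<longleftrightarrow> (\<lambda>t::real. f (x + t *\<^sub>R axis i 1)) differentiable (at 0)"

definition partial :: "'n::finite \<Rightarrow> (real^'n \<Rightarrow> real) \<Rightarrow> real^'n \<Rightarrow> real" where
  "partial i f x = deriv (\<lambda>t::real. f (x + t *\<^sub>R axis i 1)) 0"

text \<open>Partial derivatives of order \<open>m\<close> are indexed by lists of \<open>m\<close> coordinates (in order of
  differentiation, last entry first) instead of multi-indices. For \<open>C\<^sup>k\<close> functions and \<open>m \<le> k\<close>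
  they do not depend on the order of the list, so both ways list the same derivatives.\<close>

fun iter_partial :: "'n::finite list \<Rightarrow> (real^'n \<Rightarrow> real) \<Rightarrow> real^'n \<Rightarrow> real" where
  "iter_partial [] f = f"
| "iter_partial (i # js) f = partial i (iter_partial js f)"

text \<open>\<open>C\<^sup>k(U)\<close> for an open set \<open>U\<close>.\<close>

definition Ck_on :: "nat \<Rightarrow> (real^'n::finite) set \<Rightarrow> (real^'n \<Rightarrow> real) \<Rightarrow> bool" where
  "Ck_on k U f \<longleftrightarrow>
     (\<forall>js. length js < k \<longrightarrow> (\<forall>i. \<forall>x\<in>U. has_partial i (iter_partial js f) x)) \<and>
     (\<forall>js. length js \<le> k \<longrightarrow> continuous_on U (iter_partial js f))"

text \<open>\<open>C\<^sup>k\<close> of the closure of an open set \<open>U\<close>: all partial derivatives up to order \<open>k\<close> exist in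
  \<open>U\<close> and extend continuously to the closure; the extension of \<open>f\<close> itself is \<open>f\<close>. Values of
  \<open>f\<close> outside the closure are irrelevant.\<close>

definition Ck_on_closure :: "nat \<Rightarrow> (real^'n::finite) set \<Rightarrow> (real^'n \<Rightarrow> real) \<Rightarrow> bool" where
  "Ck_on_closure k U f \<longleftrightarrow>
     Ck_on k U f \<and> continuous_on (closure U) f \<and>
     (\<forall>js. length js \<le> k \<longrightarrow>
        (\<exists>g. continuous_on (closure U) g \<and> (\<forall>x\<in>U. g x = iter_partial js f x)))"

definition smooth :: "(real^'n::finite \<Rightarrow> real) \<Rightarrow> bool" where
  "smooth f \<longleftrightarrow> (\<forall>k. Ck_on k UNIV f)"

text \<open>The norm takes extended real values, so that it is \<open>\<infinity>\<close>, and not an unspecified real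
  supremum, when some derivative is unbounded on \<open>U\<close>.\<close>

definition Ck_norm :: "nat \<Rightarrow> (real^'n::finite) set \<Rightarrow> (real^'n \<Rightarrow> real) \<Rightarrow> ereal" where
  "Ck_norm k U f = (SUP js\<in>{js. length js \<le> k}. SUP x\<in>U. ereal \<bar>iter_partial js f x\<bar>)"

subsection \<open>Antisymmetry\<close>

definition reflect :: "'n::finite \<Rightarrow> real^'n \<Rightarrow> real^'n" where
  "reflect i x = (\<chi> j. if j = i then - (x $ j) else x $ j)"

definition antisymmetric_on :: "'n::finite \<Rightarrow> (real^'n) set \<Rightarrow> (real^'n \<Rightarrow> real) \<Rightarrow> bool" where
  "antisymmetric_on i S f \<longleftrightarrow> (\<forall>x\<in>S. f (reflect i x) = - f x)"

subsection \<open>The fractional Laplacian\<close>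

definition frac_const :: "nat \<Rightarrow> real \<Rightarrow> real" where
  "frac_const n s = s * 4 powr s * Gamma ((real n + 2 * s) / 2) / Gamma (1 - s)"

lemma frac_const_pos: "0 < s \<Longrightarrow> s < 1 \<Longrightarrow> frac_const n s > 0"
  unfolding frac_const_def by (intro divide_pos_pos mult_pos_pos Gamma_real_pos) auto

definition frac_kernel :: "real \<Rightarrow> (real^'n::finite \<Rightarrow> real) \<Rightarrow> real^'n \<Rightarrow> real^'n \<Rightarrow> real" where
  "frac_kernel s u x y = (u x - u y) / norm (x - y) powr (real CARD('n) + 2 * s)"

text \<open>\<open>has_frac_laplacian s u x L\<close>: the principal value defining \<open>(-\<Delta>)\<^sup>s u(x)\<close> exists
  (every truncated integral converges absolutely and their limit exists), and
  \<open>(-\<Delta>)\<^sup>s u(x) = L\<close>.\<close>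

definition has_frac_laplacian ::
  "real \<Rightarrow> (real^'n::finite \<Rightarrow> real) \<Rightarrow> real^'n \<Rightarrow> real \<Rightarrow> bool" where
  "has_frac_laplacian s u x L \<longleftrightarrow>
     (\<forall>\<epsilon>>0. set_integrable lborel (- ball x \<epsilon>) (frac_kernel s u x)) \<and>
     ((\<lambda>\<epsilon>. frac_const CARD('n) s *
          set_lebesgue_integral lborel (- ball x \<epsilon>) (frac_kernel s u x)) \<longlongrightarrow> L) (at_right 0)"

definition s_harmonic_on :: "real \<Rightarrow> (real^'n::finite) set \<Rightarrow> (real^'n \<Rightarrow> real) \<Rightarrow> bool" where
  "s_harmonic_on s U u \<longleftrightarrow> (\<forall>x\<in>U. has_frac_laplacian s u x 0)"

end

theory Submission
  imports Defs
begin

text \<open>For \<open>\<rho> > 0\<close> the function \<open>(\<rho> - |x|\<^sup>2)\<^sub>+ powr (s - 1)\<close> is \<open>s\<close>-harmonic in the ball of radius \<open>\<surd>\<rho>\<close>: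
  on every line it is a power of a quadratic polynomial, for which the principal value can be
  evaluated after the substitution \<open>\<lambda> \<mapsto> 1/\<lambda>\<close>. Averaging over \<open>\<rho>\<close> against a smooth \<open>g\<close> with compact
  support in \<open>(Q, \<infinity>)\<close> gives smooth, compactly supported radial kernels \<open>\<Psi>\<^sub>g(|x|\<^sup>2)\<close> that are
  \<open>s\<close>-harmonic where \<open>|x|\<^sup>2 \<le> Q\<close>. Letting \<open>g\<close> escape to infinity shows that constants are limits of
  profiles \<open>\<Psi>\<^sub>g\<close> in \<open>C\<^sup>k([0, Q])\<close>; since \<open>\<Psi>\<^sub>g' = \<Psi>\<^bsub>g'\<^esub>\<close>, integrating gives all polynomials, and hence,
  by Weierstrass and further integration, all smooth profiles. In particular some \<open>\<Psi>\<^sub>g(|x|\<^sup>2)\<close> is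
  \<open>C\<^sup>k\<close>-close to a mollifier on the ball of radius 3. Convolving it with \<open>f(r x)\<close>, where \<open>r < 1\<close> is
  close to 1, yields \<open>u\<close>; it is antisymmetric because the kernel is radial.\<close>

subsection \<open>Smooth functions on the real line\<close>

text \<open>Up to the factor Gamma(s), the averaged profile is the Weyl fractional integral of g of
  order s, which commutes with d/dq; averaging also smooths out the blow-up of a single power on its
  sphere. Far away the weight (r - q)^(s-1) hardly depends on q, so moving g out to distance L and
  scaling by L^(1-s) leaves a constant. The obstacle to integrating profiles is that g has a
  compactly supported primitive only if its integral is 0; subtracting a far bump of equal integral
  repairs this at a cost of order L^(s-1). The fractional Laplacian commutes with translations, so
  the convolution superposes translates of one kernel: for |x| < 1 and |p| < 1/r < 2 only |x - p| <
  3 occurs, whence Q = 9. The dilation is there because f is known only on the closed unit ball: p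
  -> f(r p) lives on the ball of radius 1/r = 1 + \<delta>, and a mollifier of radius \<delta>
  centred in B_1 stays inside it. Principal values are handled as absolutely convergent integrals of
  second differences; since the value sought is 0, no normalising constant has to be
  computed.\<close>

lemma has_real_derivative_integral:
  fixes f :: "real \<Rightarrow> 'a \<Rightarrow> real"
  assumes r: "r > 0"
    and int: "\<And>t. \<bar>t - t0\<bar> < r \<Longrightarrow> integrable M (f t)"
    and der: "\<And>t z. \<bar>t - t0\<bar> < r \<Longrightarrow> z \<in> space M \<Longrightarrow> ((\<lambda>t. f t z) has_real_derivative f' t z) (at t)"
    and bd: "\<And>t z. \<bar>t - t0\<bar> < r \<Longrightarrow> z \<in> space M \<Longrightarrow> \<bar>f' t z\<bar> \<le> w z"
    and w: "integrable M w"
    and meas: "f' t0 \<in> borel_measurable M"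
  shows "((\<lambda>t. \<integral>z. f t z \<partial>M) has_real_derivative (\<integral>z. f' t0 z \<partial>M)) (at t0)"
proof -
  \<comment> \<open>Outside the radius r nothing is known about \<open>f y\<close>, not even
    measurability. Setting the quotient to 0 there lets dominated convergence run along an arbitrary
    sequence instead of an eventual part of it.\<close>
  let ?Q = "\<lambda>y z. if \<bar>y - t0\<bar> < r then (f y z - f t0 z) / (y - t0) else 0"
  have int0: "integrable M (f t0)" using int[of t0] r by simp
  have lim: "((\<lambda>y. \<integral>z. ?Q y z \<partial>M) \<longlongrightarrow> (\<integral>z. f' t0 z \<partial>M)) (at t0)"
  proof (subst tendsto_at_iff_sequentially, intro allI impI)
    fix X :: "nat \<Rightarrow> real" assume X: "\<forall>i. X i \<in> UNIV - {t0}" "X \<longlonglongrightarrow> t0"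
    have "(\<lambda>n. \<integral>z. ?Q (X n) z \<partial>M) \<longlonglongrightarrow> (\<integral>z. f' t0 z \<partial>M)"
    proof (rule integral_dominated_convergence[where w = w])
      show "f' t0 \<in> borel_measurable M" by fact
      show "?Q (X n) \<in> borel_measurable M" for n
        using int[of "X n"] int0 by (cases "\<bar>X n - t0\<bar> < r") auto
      show "integrable M w" by fact
      show "AE z in M. (\<lambda>n. ?Q (X n) z) \<longlonglongrightarrow> f' t0 z"
      proof (rule AE_I2)
        fix z assume z: "z \<in> space M"
        have "((\<lambda>t. f t z) has_real_derivative f' t0 z) (at t0)" using der[of t0 z] r z by simp
        then have "((\<lambda>y. (f y z - f t0 z) / (y - t0)) \<longlongrightarrow> f' t0 z) (at t0)"
          by (simp add: has_field_derivative_iff)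
        then have "(\<lambda>n. (f (X n) z - f t0 z) / (X n - t0)) \<longlonglongrightarrow> f' t0 z"
          using X unfolding tendsto_at_iff_sequentially comp_def by blast
        moreover have "\<forall>\<^sub>F n in sequentially. (f (X n) z - f t0 z) / (X n - t0) = ?Q (X n) z"
          using X(2) r unfolding lim_sequentially dist_real_def eventually_sequentially by fastforce
        ultimately show "(\<lambda>n. ?Q (X n) z) \<longlonglongrightarrow> f' t0 z"
          by (rule Lim_transform_eventually)
      qed
      show "AE z in M. norm (?Q (X n) z) \<le> w z" for n
      proof (rule AE_I2)
        fix z assume z: "z \<in> space M"
        have w0: "0 \<le> w z" using bd[of t0 z] r z by simp
        show "norm (?Q (X n) z) \<le> w z"
        proof (cases "\<bar>X n - t0\<bar> < r")
          case True
          have ne: "X n \<noteq> t0" using X by auto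
          have "norm (f (X n) z - f t0 z) \<le> w z * norm (X n - t0)"
          proof (rule field_differentiable_bound[where S = "ball t0 r" and f' = "\<lambda>t. f' t z"])
            fix t assume "t \<in> ball t0 r"
            then have t: "\<bar>t - t0\<bar> < r" by (simp add: dist_real_def abs_minus_commute)
            show "((\<lambda>t. f t z) has_field_derivative f' t z) (at t within ball t0 r)"
              using der[OF t z] by (rule has_field_derivative_at_within)
            show "norm (f' t z) \<le> w z" using bd[OF t z] by simp
          qed (use True r in \<open>auto simp: dist_real_def abs_minus_commute\<close>)
          then show ?thesis using ne True by (simp add: abs_divide divide_le_eq)
        qed (use w0 in auto)
      qed
    qed
    then show "((\<lambda>y. \<integral>z. ?Q y z \<partial>M) \<circ> X) \<longlonglongrightarrow> (\<integral>z. f' t0 z \<partial>M)" by (simp add: comp_def)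
  qed
  have "\<forall>\<^sub>F y in at t0. (\<integral>z. ?Q y z \<partial>M) = ((\<integral>z. f y z \<partial>M) - (\<integral>z. f t0 z \<partial>M)) / (y - t0)"
    unfolding eventually_at
  proof (intro exI[of _ r] conjI ballI impI)
    fix y assume y: "y \<noteq> t0 \<and> dist y t0 < r"
    then have "\<bar>y - t0\<bar> < r" by (simp add: dist_real_def)
    then show "(\<integral>z. ?Q y z \<partial>M) = ((\<integral>z. f y z \<partial>M) - (\<integral>z. f t0 z \<partial>M)) / (y - t0)"
      using int[of y] int0 by simp
  qed (use r in auto)
  with lim show ?thesis
    unfolding has_field_derivative_iff by (rule Lim_transform_eventually)
qed

text \<open>The recursion passes through an existentially quantified derivative, so a family closed
  under differentiation, such as all \<open>flat p\<close> or all \<open>psi s g\<close>, is smooth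
  by a short induction generalised over the family.\<close>

primrec deriv_upto :: "nat \<Rightarrow> (real \<Rightarrow> real) \<Rightarrow> bool" where
  "deriv_upto 0 h \<longleftrightarrow> True"
| "deriv_upto (Suc k) h \<longleftrightarrow> (\<exists>h'. (\<forall>x. (h has_real_derivative h' x) (at x)) \<and> deriv_upto k h')"

definition smooth_real :: "(real \<Rightarrow> real) \<Rightarrow> bool" where "smooth_real h \<longleftrightarrow> (\<forall>k. deriv_upto k h)"

lemma deriv_upto_Suc_imp: "deriv_upto (Suc k) h \<Longrightarrow> deriv_upto k h"
  by (induction k arbitrary: h) auto

lemma deriv_upto_add: "deriv_upto k h1 \<Longrightarrow> deriv_upto k h2 \<Longrightarrow> deriv_upto k (\<lambda>x. h1 x + h2 x)"
proof (induction k arbitrary: h1 h2)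
  case (Suc k)
  then obtain d1 d2 where d: "\<forall>x. (h1 has_real_derivative d1 x) (at x)" "deriv_upto k d1"
    "\<forall>x. (h2 has_real_derivative d2 x) (at x)" "deriv_upto k d2" by auto
  have "deriv_upto k (\<lambda>x. d1 x + d2 x)"
    using d by (intro Suc.IH)
  moreover have "\<forall>x. ((\<lambda>x. h1 x + h2 x) has_real_derivative d1 x + d2 x) (at x)"
    using d by (auto intro!: DERIV_add)
  ultimately show ?case unfolding deriv_upto.simps by (intro exI[of _ "\<lambda>x. d1 x + d2 x"]) simp
qed simp

lemma deriv_upto_mult: "deriv_upto k h1 \<Longrightarrow> deriv_upto k h2 \<Longrightarrow> deriv_upto k (\<lambda>x. h1 x * h2 x)"
proof (induction k arbitrary: h1 h2)
  case (Suc k)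
  then obtain d1 d2 where d: "\<forall>x. (h1 has_real_derivative d1 x) (at x)" "deriv_upto k d1"
    "\<forall>x. (h2 has_real_derivative d2 x) (at x)" "deriv_upto k d2" by auto
  have "deriv_upto k (\<lambda>x. d1 x * h2 x + d2 x * h1 x)"
    using d Suc.prems[THEN deriv_upto_Suc_imp] by (intro deriv_upto_add Suc.IH)
  moreover have "\<forall>x. ((\<lambda>x. h1 x * h2 x) has_real_derivative d1 x * h2 x + d2 x * h1 x) (at x)"
    using d by (auto intro!: DERIV_mult)
  ultimately show ?case unfolding deriv_upto.simps by (intro exI[of _ "\<lambda>x. d1 x * h2 x + d2 x * h1 x"]) simp
qed simp

lemma deriv_upto_const: "deriv_upto k (\<lambda>x. c)"
proof (induction k arbitrary: c)
  case (Suc k)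
  show ?case unfolding deriv_upto.simps by (rule exI[of _ "\<lambda>x. 0"]) (use Suc[of 0] in auto)
qed simp

lemma deriv_upto_affine: "deriv_upto k h \<Longrightarrow> deriv_upto k (\<lambda>x. h (m * x + c))"
proof (induction k arbitrary: h)
  case (Suc k)
  then obtain d where d: "\<forall>x. (h has_real_derivative d x) (at x)" "deriv_upto k d" by auto
  have "deriv_upto k (\<lambda>x. d (m * x + c) * m)" using Suc.IH d(2) by (intro deriv_upto_mult deriv_upto_const)
  moreover have "((\<lambda>x. h (m * x + c)) has_real_derivative d (m * x + c) * m) (at x)" for x
    by (rule DERIV_chain2[of h]) (use d in \<open>auto intro!: derivative_eq_intros\<close>)
  ultimately show ?case unfolding deriv_upto.simps by (intro exI[of _ "\<lambda>x. d (m * x + c) * m"]) simp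
qed simp

lemma smooth_real_add: "smooth_real f \<Longrightarrow> smooth_real g \<Longrightarrow> smooth_real (\<lambda>x. f x + g x)"
  and smooth_real_mult: "smooth_real f \<Longrightarrow> smooth_real g \<Longrightarrow> smooth_real (\<lambda>x. f x * g x)"
  and smooth_real_const: "smooth_real (\<lambda>x. c)"
  and smooth_real_affine: "smooth_real f \<Longrightarrow> smooth_real (\<lambda>x. f (m * x + c))"
  by (simp_all add: smooth_real_def deriv_upto_add deriv_upto_mult deriv_upto_const deriv_upto_affine)

lemma smooth_real_DERIV: "smooth_real h \<Longrightarrow> (h has_real_derivative deriv h x) (at x)"
  unfolding smooth_real_def using deriv_upto.simps(2)[of 0 h] DERIV_imp_deriv by metis

lemma smooth_real_deriv: assumes "smooth_real h" shows "smooth_real (deriv h)"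
  unfolding smooth_real_def
proof
  fix k
  have "deriv_upto (Suc k) h" using assms smooth_real_def by blast
  then obtain h' where "\<forall>x. (h has_real_derivative h' x) (at x)" "deriv_upto k h'" by auto
  moreover from this have "h' = deriv h" using DERIV_imp_deriv by (metis ext)
  ultimately show "deriv_upto k (deriv h)" by simp
qed

lemma smooth_real_primitive: "(\<And>x. (H has_real_derivative h x) (at x)) \<Longrightarrow> smooth_real h \<Longrightarrow> smooth_real H"
  unfolding smooth_real_def by (metis deriv_upto.simps(2) deriv_upto_Suc_imp)

lemma smooth_real_funpow_deriv: "smooth_real h \<Longrightarrow> smooth_real ((deriv ^^ j) h)"
  by (induction j) (auto intro: smooth_real_deriv)

lemma smooth_real_isCont: "smooth_real h \<Longrightarrow> isCont h x"
  using smooth_real_DERIV DERIV_isCont by blast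

lemma smooth_real_continuous_on: "smooth_real h \<Longrightarrow> continuous_on S h"
  by (simp add: continuous_at_imp_continuous_on smooth_real_isCont)

lemma smooth_real_borel: "smooth_real h \<Longrightarrow> h \<in> borel_measurable borel"
  by (simp add: borel_measurable_continuous_onI smooth_real_continuous_on)

text \<open>The factor p(1/x) makes the family closed under differentiation; \<open>flat 1\<close>
  is the classical smooth function exp(-1/x) that vanishes on the negative half line.\<close>

definition flat :: "real poly \<Rightarrow> real \<Rightarrow> real" where
  "flat p x = (if x > 0 then poly p (1/x) * exp (- 1/x) else 0)"

lemma flat_tendsto_0: "(flat p \<longlongrightarrow> 0) (at_right 0)"
proof -
  have mono: "((\<lambda>x::real. poly p (inverse x) * exp (- inverse x)) \<longlongrightarrow> 0) (at_right 0)"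
  proof (rule filterlim_compose[of "\<lambda>v. poly p v * exp (- v)", OF _ filterlim_inverse_at_top_right])
    have "((\<lambda>v. \<Sum>i\<le>degree p. coeff p i * (v ^ i / exp v)) \<longlongrightarrow> (\<Sum>i\<le>degree p. coeff p i * 0)) at_top"
      by (intro tendsto_intros tendsto_power_div_exp_0)
    then show "((\<lambda>v. poly p v * exp (- v)) \<longlongrightarrow> 0) at_top"
      by (simp add: poly_altdef sum_distrib_right exp_minus divide_inverse mult.assoc)
  qed
  have "\<forall>\<^sub>F x in at_right (0::real). poly p (inverse x) * exp (- inverse x) = flat p x"
    unfolding flat_def using eventually_at_right_less by (rule eventually_mono) (simp add: divide_inverse)
  with mono show ?thesis by (rule Lim_transform_eventually)
qed

text \<open>With v = 1/x the derivative of p(v) exp(-v) is v^2 (p(v) - p'(v)) exp(-v), hence the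
  factor \<open>[:0,0,1:]\<close>. At 0 the difference quotient is itself a \<open>flat\<close>,
  with polynomial v p(v), so \<open>flat_tendsto_0\<close> settles that case.\<close>

lemma flat_DERIV: "(flat p has_real_derivative flat ([:0,0,1:] * (p - pderiv p)) x) (at x)"
proof -
  consider "x > 0" | "x < 0" | "x = 0" by linarith
  then show ?thesis
  proof cases
    case 1
    have "((\<lambda>x. poly p (1/x) * exp (-1/x)) has_real_derivative flat ([:0,0,1:] * (p - pderiv p)) x) (at x)"
      using 1 by (auto simp: flat_def intro!: derivative_eq_intros) (simp add: field_simps power2_eq_square)
    then show ?thesis
      by (rule DERIV_cong_ev[THEN iffD1, rotated -1])
        (use 1 eventually_nhds_in_open[of "{0<..}" x] in \<open>auto simp: flat_def elim!: eventually_mono\<close>)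
  next
    case 2
    have "((\<lambda>x. 0) has_real_derivative flat ([:0,0,1:] * (p - pderiv p)) x) (at x)"
      using 2 by (auto simp: flat_def)
    then show ?thesis
      by (rule DERIV_cong_ev[THEN iffD1, rotated -1])
        (use 2 eventually_nhds_in_open[of "{..<0}" x] in \<open>auto simp: flat_def elim!: eventually_mono\<close>)
  next
    case 3
    have eq: "(\<lambda>y. (flat p y - flat p 0) / (y - 0)) = flat ([:0,1:] * p)"
      by (auto simp: flat_def fun_eq_iff)
    have "(flat ([:0,1:] * p) \<longlongrightarrow> 0) (at_left 0)"
      by (rule Lim_transform_eventually[OF tendsto_const])
        (auto simp: flat_def eventually_at_left_field intro!: exI[of _ "-1"])
    then have "(flat ([:0,1:] * p) \<longlongrightarrow> 0) (at 0)"
      using flat_tendsto_0[of "[:0,1:] * p"] by (auto intro: filterlim_split_at)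
    then show ?thesis unfolding 3 has_field_derivative_iff eq by (simp add: flat_def)
  qed
qed

lemma smooth_real_flat: "smooth_real (flat p)"
proof -
  have "deriv_upto k (flat p)" for k
  proof (induction k arbitrary: p)
    case (Suc k)
    show ?case unfolding deriv_upto.simps
      using flat_DERIV[of p] Suc[of "[:0,0,1:] * (p - pderiv p)"]
      by (intro exI[of _ "flat ([:0,0,1:] * (p - pderiv p))"]) simp
  qed simp
  then show ?thesis by (simp add: smooth_real_def)
qed

definition bump :: "real \<Rightarrow> real" where "bump x = flat 1 x * flat 1 (1 - x)"

lemma smooth_real_bump: "smooth_real bump"
  unfolding bump_def using smooth_real_mult[OF smooth_real_flat smooth_real_affine[OF smooth_real_flat, of 1 "-1" 1]] by (simp add: bump_def)

lemma bump_nonneg: "bump x \<ge> 0" and bump_pos: "0 < x \<Longrightarrow> x < 1 \<Longrightarrow> bump x > 0"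
  and bump_outside: "x \<notin> {0..1} \<Longrightarrow> bump x = 0"
  by (auto simp: bump_def flat_def)

subsection \<open>Averages of powers\<close>

lemma powr_set_integrable:
  fixes s T :: real assumes "0 < s" "0 \<le> T"
  shows "set_integrable lborel {0..T} (\<lambda>t. t powr (s - 1))"
    and "(LINT t:{0..T}|lborel. t powr (s - 1)) = T powr s / s"
proof -
  have "set_integrable lborel {0..T} (\<lambda>t. t powr (s - 1)) \<and>
    (LINT t:{0..T}|lborel. t powr (s - 1)) = T powr s / s"
  proof (cases "T = 0")
    case True
    have "(\<lambda>x. indicat_real {0} x *\<^sub>R x powr (s - 1)) = (\<lambda>x. 0)" by (auto simp: indicator_def)
    with True show ?thesis using assms by (simp add: set_integrable_def set_lebesgue_integral_def)
  next
    case False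
    with assms have T: "T > 0" by simp
    have lim0: "((\<lambda>x. x powr s / s) \<longlongrightarrow> 0) (at_right 0)"
    proof -
      have "((\<lambda>x::real. x powr s) \<longlongrightarrow> 0 powr s) (at_right 0)"
        by (intro tendsto_powr') (use assms in \<open>auto simp: eventually_at_right_field intro!: exI[of _ 1]\<close>)
      from tendsto_divide[OF this tendsto_const, of s] show ?thesis using assms by simp
    qed
    have limT: "((\<lambda>x. x powr s / s) \<longlongrightarrow> T powr s / s) (at_left T)"
      using T assms by (auto intro!: tendsto_intros)
    have der: "((\<lambda>x. x powr s / s) has_real_derivative x powr (s - 1)) (at x)" if "x > 0" for x
      using that assms by (auto intro!: derivative_eq_intros)
    have 1: "set_integrable lborel (einterval (ereal 0) (ereal T)) (\<lambda>t. t powr (s - 1))"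
      and 2: "(LBINT t=ereal 0..ereal T. t powr (s - 1)) = T powr s / s - 0"
      by (rule interval_integral_FTC_nonneg[where F = "\<lambda>x. x powr s / s"];
          use T assms der lim0 limT in \<open>auto simp: ereal_tendsto_simps intro!: continuous_intros\<close>)+
    have "set_integrable lborel {0<..<T} (\<lambda>t. t powr (s - 1))"
      using 1 by simp
    then have 3: "set_integrable lborel {0..T} (\<lambda>t. t powr (s - 1))"
      unfolding set_integrable_def
      by (rule integrable_cong_AE_imp)
        (auto intro!: AE_I[where N = "{0, T}"] simp: indicator_def emeasure_lborel_countable split: if_splits)
    with 2 T show ?thesis by (simp add: interval_integral_Icc zero_ereal_def)
  qed
  then show "set_integrable lborel {0..T} (\<lambda>t. t powr (s - 1))"
    and "(LINT t:{0..T}|lborel. t powr (s - 1)) = T powr s / s" by auto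
qed

section \<open>Smooth functions with compact support on the line, and their averages\<close>

definition smooth_supp :: "real \<Rightarrow> real \<Rightarrow> (real \<Rightarrow> real) \<Rightarrow> bool" where
  "smooth_supp a b g \<longleftrightarrow> smooth_real g \<and> (\<forall>x. x \<notin> {a..b} \<longrightarrow> g x = 0)"

lemma smooth_supp_bounded: assumes "smooth_supp a b g" obtains M where "M \<ge> 0" "\<And>x. \<bar>g x\<bar> \<le> M"
proof -
  have "bounded (g ` {a..b})"
    using assms by (intro compact_imp_bounded compact_continuous_image smooth_real_continuous_on) (auto simp: smooth_supp_def)
  then obtain M where "M > 0" "\<forall>x\<in>{a..b}. \<bar>g x\<bar> \<le> M" unfolding bounded_pos by auto
  then show ?thesis using assms that[of M] unfolding smooth_supp_def by (metis abs_zero less_eq_real_def)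
qed

lemma smooth_supp_deriv: assumes "smooth_supp a b g" shows "smooth_supp a b (deriv g)"
proof -
  have "deriv g x = 0" if "x \<notin> {a..b}" for x
  proof -
    have "(g has_real_derivative deriv g x) (at x)" using assms by (simp add: smooth_supp_def smooth_real_DERIV)
    then have "((\<lambda>x. 0) has_real_derivative deriv g x) (at x)"
      by (rule has_field_derivative_transform_within_open[where S = "- {a..b}"])
        (use that assms in \<open>auto simp: smooth_supp_def\<close>)
    then show ?thesis using DERIV_unique DERIV_const by blast
  qed
  then show ?thesis using assms by (auto simp: smooth_supp_def smooth_real_deriv)
qed

lemma smooth_supp_funpow_deriv: "smooth_supp a b g \<Longrightarrow> smooth_supp a b ((deriv ^^ j) g)"
  by (induction j) (auto intro: smooth_supp_deriv)

lemma smooth_supp_mono: "smooth_supp a b g \<Longrightarrow> a' \<le> a \<Longrightarrow> b \<le> b' \<Longrightarrow> smooth_supp a' b' g"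
  by (auto simp: smooth_supp_def)

lemma smooth_supp_lin: "smooth_supp a b f \<Longrightarrow> smooth_supp a b g \<Longrightarrow> smooth_supp a b (\<lambda>x. f x + c * g x)"
  by (auto simp: smooth_supp_def intro!: smooth_real_add smooth_real_mult smooth_real_const)

lemma smooth_supp_shift: "smooth_supp a b g \<Longrightarrow> smooth_supp (a + L) (b + L) (\<lambda>x. g (x - L))"
  using smooth_real_affine[of g 1 "- L"] by (auto simp: smooth_supp_def)

lemma smooth_supp_borel: "smooth_supp a b g \<Longrightarrow> g \<in> borel_measurable borel"
  by (simp add: smooth_supp_def smooth_real_borel)

lemma smooth_supp_bump: "smooth_supp 0 1 bump"
  using smooth_real_bump bump_outside by (auto simp: smooth_supp_def)

lemma smooth_supp_integrable: assumes "smooth_supp a b g" shows "integrable lborel g"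
proof -
  obtain M where M: "\<And>x. \<bar>g x\<bar> \<le> M" using smooth_supp_bounded[OF assms] by blast
  show ?thesis
  proof (rule Bochner_Integration.integrable_bound[of _ "\<lambda>x. M * indicator {a..b} x"])
    show "AE x in lborel. norm (g x) \<le> norm (M * indicator {a..b} x)"
      using M assms by (auto simp: smooth_supp_def indicator_def intro: order_trans[OF _ abs_ge_self])
    show "integrable lborel (\<lambda>x. M * indicat_real {a..b} x)"
      by (intro integrable_mult_right integrable_real_indicator) (auto simp: emeasure_lborel_Icc_eq)
  qed (use assms in \<open>auto simp: smooth_supp_borel\<close>)
qed

lemma funpow_deriv_lin:
  "smooth_real f \<Longrightarrow> smooth_real g \<Longrightarrow> (deriv ^^ j) (\<lambda>x. f x + c * g x) = (\<lambda>x. (deriv ^^ j) f x + c * (deriv ^^ j) g x)"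
proof (induction j)
  case (Suc j)
  have "deriv (\<lambda>x. (deriv ^^ j) f x + c * (deriv ^^ j) g x) x
      = deriv ((deriv ^^ j) f) x + c * deriv ((deriv ^^ j) g) x" for x
    using smooth_real_DERIV[OF smooth_real_funpow_deriv[OF Suc.prems(1)]] smooth_real_DERIV[OF smooth_real_funpow_deriv[OF Suc.prems(2)]]
    by (intro DERIV_imp_deriv DERIV_add DERIV_cmult)
  then show ?case using Suc by auto
qed simp

lemma funpow_deriv_shift: "smooth_real g \<Longrightarrow> (deriv ^^ j) (\<lambda>x. g (x - L)) = (\<lambda>x. (deriv ^^ j) g (x - L))"
proof (induction j)
  case (Suc j)
  have "deriv (\<lambda>x. (deriv ^^ j) g (x - L)) x = deriv ((deriv ^^ j) g) (x - L)" for x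
    by (rule DERIV_imp_deriv, rule DERIV_chain2[where g = "\<lambda>x. x - L", THEN DERIV_cong])
      (use smooth_real_DERIV[OF smooth_real_funpow_deriv[OF Suc.prems(1)]] in \<open>auto intro!: derivative_eq_intros\<close>)
  then show ?case using Suc by auto
qed simp

text \<open>The truncation \<open>max 0 (r - q)\<close> relies on \<open>0 powr (s - 1) = 0\<close>, so that only \<open>r > q\<close> contributes.\<close>

definition psi :: "real \<Rightarrow> (real \<Rightarrow> real) \<Rightarrow> real \<Rightarrow> real" where
  "psi s g q = (\<integral>r. g r * max 0 (r - q) powr (s - 1) \<partial>lborel)"

text \<open>Moves q from the singular factor into g. Derivatives in q then fall on g alone, which is
  why \<open>psi\<close> commutes with differentiation.\<close>

lemma psi_shift: "psi s g q = (\<integral>t. g (q + t) * max 0 t powr (s - 1) \<partial>lborel)"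
  unfolding psi_def by (subst lborel_integral_real_affine[where c = 1 and t = q]) auto

lemma wt_integrable:
  assumes "0 < s"
  shows "integrable lborel (\<lambda>t. indicator {0..T} t * t powr (s - 1) :: real)"
proof (cases "T \<ge> 0")
  case True
  then show ?thesis using powr_set_integrable(1)[OF assms True] by (simp add: set_integrable_def)
qed simp

text \<open>Stated for bounded measurable g rather than for \<open>smooth_supp\<close>, because the
  Fubini argument later applies it to the absolute value of g, which is not smooth.\<close>

lemma psi_integrable:
  fixes g :: "real \<Rightarrow> real"
  assumes s: "0 < s" and b: "\<And>r. \<bar>g r\<bar> \<le> M" and z: "\<And>r. r > B \<Longrightarrow> g r = 0"
    and [measurable]: "g \<in> borel_measurable borel"
  shows "integrable lborel (\<lambda>t. g (q + t) * max 0 t powr (s - 1))"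
    and "integrable lborel (\<lambda>r. g r * max 0 (r - q) powr (s - 1))"
proof -
  show 1: "integrable lborel (\<lambda>t. g (q + t) * max 0 t powr (s - 1))"
  proof (rule Bochner_Integration.integrable_bound[where f = "\<lambda>t. M * (indicator {0..B - q} t * t powr (s - 1))"])
    show "AE t in lborel. norm (g (q + t) * max 0 t powr (s - 1))
        \<le> norm (M * (indicator {0..B - q} t * t powr (s - 1)))"
    proof (rule AE_I2)
      fix t
      have "M \<ge> 0" using order_trans[OF abs_ge_zero b] .
      show "norm (g (q + t) * max 0 t powr (s - 1)) \<le> norm (M * (indicator {0..B - q} t * t powr (s - 1)))"
        using b[of "q + t"] z[of "q + t"] \<open>M \<ge> 0\<close>
        by (auto simp: indicator_def abs_mult max_def intro!: mult_right_mono)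
    qed
    show "integrable lborel (\<lambda>t. M * (indicator {0..B - q} t * t powr (s - 1)))"
      by (intro integrable_mult_right wt_integrable s)
  qed auto
  then show "integrable lborel (\<lambda>r. g r * max 0 (r - q) powr (s - 1))"
    by (subst lborel_integrable_real_affine_iff[where c = 1 and t = q, symmetric]) auto
qed

lemma smooth_supp_psi_integrable:
  assumes "0 < s" "smooth_supp a b g"
  shows "integrable lborel (\<lambda>t. g (q + t) * max 0 t powr (s - 1))"
    and "integrable lborel (\<lambda>r. g r * max 0 (r - q) powr (s - 1))"
proof -
  obtain M where M: "\<And>x. \<bar>g x\<bar> \<le> M" using smooth_supp_bounded[OF assms(2)] by blast
  have z: "\<And>r. r > b \<Longrightarrow> g r = 0" using assms by (auto simp: smooth_supp_def)
  show "integrable lborel (\<lambda>t. g (q + t) * max 0 t powr (s - 1))"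
    and "integrable lborel (\<lambda>r. g r * max 0 (r - q) powr (s - 1))"
    by (rule psi_integrable[where M = M and B = b, OF assms(1) M z smooth_supp_borel[OF assms(2)]], simp)+
qed

lemma psi_lin:
  assumes "0 < s" "smooth_supp a b f" "smooth_supp a' b' g"
  shows "psi s (\<lambda>x. f x + c * g x) q = psi s f q + c * psi s g q"
  unfolding psi_def
  using smooth_supp_psi_integrable(2)[OF assms(1,2), of q] smooth_supp_psi_integrable(2)[OF assms(1,3), of q]
  by (simp add: ring_distribs mult.assoc)

lemma psi_DERIV:
  assumes s: "0 < s" and g: "smooth_supp a b g"
  shows "(psi s g has_real_derivative psi s (deriv g) q) (at q)"
proof -
  obtain M where M: "M \<ge> 0" "\<And>x. \<bar>deriv g x\<bar> \<le> M" using smooth_supp_bounded[OF smooth_supp_deriv[OF g]] by blast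
  have "((\<lambda>q. \<integral>t. g (q + t) * max 0 t powr (s - 1) \<partial>lborel) has_real_derivative
     (\<integral>t. deriv g (q + t) * max 0 t powr (s - 1) \<partial>lborel)) (at q)"
  proof (rule has_real_derivative_integral[where r = 1 and f' = "\<lambda>q t. deriv g (q + t) * max 0 t powr (s - 1)"])
    \<comment> \<open>For |u - q| < 1 the integrand vanishes once t > b - q + 1, so one majorant
      serves all these u.\<close>
    show "integrable lborel (\<lambda>t. M * (indicator {0..b - q + 1} t * t powr (s - 1)))"
      by (intro integrable_mult_right wt_integrable s)
    show "\<bar>deriv g (u + t) * max 0 t powr (s - 1)\<bar> \<le> M * (indicator {0..b - q + 1} t * t powr (s - 1))"
      if "\<bar>u - q\<bar> < 1" for u t
    proof -
      have "deriv g (u + t) = 0" if "t > b - q + 1"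
      proof -
        have "u + t \<notin> {a..b}" using that \<open>\<bar>u - q\<bar> < 1\<close> by (auto simp: abs_less_iff)
        then show ?thesis using smooth_supp_deriv[OF g] by (auto simp: smooth_supp_def)
      qed
      then show ?thesis
        using M(2)[of "u + t"] M(1) by (auto simp: indicator_def abs_mult max_def intro!: mult_right_mono)
    qed
    show "((\<lambda>u. g (u + t) * max 0 t powr (s - 1)) has_real_derivative deriv g (u + t) * max 0 t powr (s - 1)) (at u)" for u t
    proof -
      have "(g has_real_derivative deriv g (u + t)) (at (u + t))" using g by (simp add: smooth_supp_def smooth_real_DERIV)
      then have "((\<lambda>u. g (u + t)) has_real_derivative deriv g (u + t)) (at u)"
        by (simp add: DERIV_shift)
      then show ?thesis by (rule DERIV_cmult_right)
    qed
    show "integrable lborel (\<lambda>t. g (u + t) * max 0 t powr (s - 1))" for u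
      by (rule smooth_supp_psi_integrable[OF s g])
    show "(\<lambda>t. deriv g (q + t) * max 0 t powr (s - 1)) \<in> borel_measurable lborel"
      using smooth_supp_psi_integrable(1)[OF s smooth_supp_deriv[OF g], of q] by (rule borel_measurable_integrable)
  qed simp
  then show ?thesis by (simp add: psi_shift[abs_def])
qed

lemma smooth_real_psi: assumes s: "0 < s" and g: "smooth_supp a b g" shows "smooth_real (psi s g)"
proof -
  have "deriv_upto k (psi s g)" for k
    using g
  proof (induction k arbitrary: g)
    case (Suc k)
    show ?case unfolding deriv_upto.simps
      using psi_DERIV[OF s Suc.prems] Suc.IH[OF smooth_supp_deriv[OF Suc.prems]] by blast
  qed simp
  then show ?thesis by (simp add: smooth_real_def)
qed

lemma funpow_deriv_psi:
  assumes "0 < s" "smooth_supp a b g" shows "(deriv ^^ j) (psi s g) = psi s ((deriv ^^ j) g)"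
proof (induction j)
  case (Suc j)
  then show ?case using psi_DERIV[OF assms(1) smooth_supp_funpow_deriv[OF assms(2), of j]]
    by (auto intro!: DERIV_imp_deriv)
qed simp

lemma psi_eq_0: assumes "smooth_supp a b g" "q \<ge> b" shows "psi s g q = 0"
proof -
  have "(\<lambda>r. g r * max 0 (r - q) powr (s - 1)) = (\<lambda>r. 0)"
    using assms by (fastforce simp: smooth_supp_def max_def)
  then show ?thesis by (simp add: psi_def)
qed

section \<open>Integrals and primitives of compactly supported functions\<close>

lemma smooth_supp_FTC:
  assumes g: "smooth_supp a b (deriv g)" and m: "smooth_real g" and ab: "a \<le> b"
  shows "integral\<^sup>L lborel (deriv g) = g b - g a"
proof -
  have "integral\<^sup>L lborel (\<lambda>x. indicator {a..b} x *\<^sub>R deriv g x) = g b - g a"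
    using ab g m
    by (intro integral_FTC_atLeastAtMost)
      (auto simp: smooth_supp_def has_real_derivative_iff_has_vector_derivative[symmetric]
        intro!: has_field_derivative_at_within smooth_real_DERIV smooth_real_continuous_on)
  moreover have "(\<lambda>x. indicator {a..b} x *\<^sub>R deriv g x) = deriv g"
    using g by (auto simp: smooth_supp_def indicator_def fun_eq_iff)
  ultimately show ?thesis by simp
qed

lemma smooth_supp_integral_deriv: assumes g: "smooth_supp a b g" shows "integral\<^sup>L lborel (deriv g) = 0"
proof -
  \<comment> \<open>The widened interval is nonempty even if \<open>a > b\<close>, and its end
    points lie outside \<open>{a..b}\<close>, where \<open>g\<close> is 0 by definition.\<close>
  have "smooth_supp (a - 1) (max a b + 1) (deriv g)" by (rule smooth_supp_mono[OF smooth_supp_deriv[OF g]]) auto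
  then have "integral\<^sup>L lborel (deriv g) = g (max a b + 1) - g (a - 1)"
    by (rule smooth_supp_FTC) (use g in \<open>auto simp: smooth_supp_def\<close>)
  moreover have "g (max a b + 1) = 0" "g (a - 1) = 0"
  proof -
    have "max a b + 1 \<notin> {a..b}" "a - 1 \<notin> {a..b}" by auto
    then show "g (max a b + 1) = 0" "g (a - 1) = 0" using g by (auto simp only: smooth_supp_def)
  qed
  ultimately show ?thesis by simp
qed

text \<open>A primitive is constant on either side of the support. Normalised to 0 on the left, it
  equals the integral of g on the right, so the condition on the integral is exactly what makes the
  support compact.\<close>

lemma smooth_supp_primitive:
  assumes g: "smooth_supp a b g" and ab: "a \<le> b" and int: "integral\<^sup>L lborel g = 0"
  obtains G where "smooth_supp a b G" "deriv G = g"
proof -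
  have "\<exists>F. \<forall>x::real. -\<infinity> < ereal x \<longrightarrow> ereal x < \<infinity> \<longrightarrow> (F has_vector_derivative g x) (at x)"
    by (rule einterval_antiderivative) (use g in \<open>auto simp: smooth_supp_def smooth_real_isCont\<close>)
  then obtain F where F: "\<And>x. (F has_real_derivative g x) (at x)"
    by (auto simp: has_real_derivative_iff_has_vector_derivative)
  define G where "G = (\<lambda>x. F x - F a)"
  have G: "(G has_real_derivative g x) (at x)" for x
    unfolding G_def by (rule derivative_eq_intros F refl | simp)+
  have dG: "deriv G = g" using G DERIV_imp_deriv by blast
  have smG: "smooth_real G" using G g by (auto simp: smooth_supp_def intro: smooth_real_primitive)
  have "G b = G a" using smooth_supp_FTC[of a b G] g smG ab int by (simp add: dG)
  then have b0: "G b = 0" "G a = 0" by (auto simp: G_def)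
  have const: "G x = G y" if "\<And>z. z \<in> {x<..<y} \<Longrightarrow> g z = 0" "x < y" for x y
  proof -
    have "\<exists>z. x < z \<and> z < y \<and> G y - G x = (y - x) * g z"
      by (rule MVT2[OF that(2)]) (rule G)
    then show ?thesis using that(1) by force
  qed
  have "G x = 0" if "x \<notin> {a..b}" for x
  proof (cases "x < a")
    case True
    then have "G x = G a" by (rule const[rotated]) (use g in \<open>auto simp: smooth_supp_def\<close>)
    then show ?thesis using b0 by simp
  next
    case False
    then have "b < x" using that by auto
    then have "G b = G x" by (rule const[rotated]) (use g in \<open>auto simp: smooth_supp_def\<close>)
    then show ?thesis using b0 by simp
  qed
  then show ?thesis using that[of G] smG dG by (auto simp: smooth_supp_def)
qed

lemma integral_bump_pos: "integral\<^sup>L lborel bump > 0"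
proof -
  have "integral\<^sup>L lborel bump \<ge> 0" by (intro integral_nonneg_AE) (auto simp: bump_nonneg)
  moreover have "integral\<^sup>L lborel bump \<noteq> 0"
  proof
    assume "integral\<^sup>L lborel bump = 0"
    then have "AE x in lborel. bump x = 0"
      by (subst (asm) integral_nonneg_eq_0_iff_AE) (auto simp: bump_nonneg smooth_supp_integrable[OF smooth_supp_bump])
    then have "AE x in lborel. x \<notin> {0<..<1::real}"
      by (rule eventually_mono) (use bump_pos in force)
    then have "emeasure lborel {0<..<1::real} = 0"
      by (subst (asm) AE_iff_measurable[where N = "{0<..<1}"]) auto
    then show False by simp
  qed
  ultimately show ?thesis by simp
qed

text \<open>Seen from [0, Q], the weight (r - q)^(s-1) on a support near L is almost the constant
  L^(s-1). Scaling by L^(1-s) therefore leaves the integral of g, uniformly in q.\<close>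

lemma psi_far:
  assumes s: "0 < s" "s < 1" and g: "smooth_supp 0 1 g" and Q: "Q > 0" and e: "e > 0"
  shows "\<forall>\<^sub>F L in at_top. \<forall>q\<in>{0..Q}.
    \<bar>L powr (1 - s) * psi s (\<lambda>x. g (x - L)) q - integral\<^sup>L lborel g\<bar> < e"
proof -
  define I where "I = (\<integral>x. \<bar>g x\<bar> \<partial>lborel)"
  \<comment> \<open>The relative weight is x^(s-1) with x in [1 - Q/L, 1 + 1/L]. It decreases in x,
    so its distance to 1 is at most the sum of the distances at the two end points.\<close>
  define E where "E = (\<lambda>L. \<bar>(1 - Q / L) powr (s - 1) - 1\<bar> + \<bar>(1 + 1 / L) powr (s - 1) - 1\<bar>)"
  have inv: "((\<lambda>L. c / L) \<longlongrightarrow> 0) at_top" for c :: real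
    by (rule tendsto_divide_0[OF tendsto_const filterlim_at_top_imp_at_infinity[OF filterlim_ident]])
  have "(E \<longlongrightarrow> \<bar>(1 - 0) powr (s - 1) - 1\<bar> + \<bar>(1 + 0) powr (s - 1) - 1\<bar>) at_top"
    unfolding E_def by (intro tendsto_intros inv) auto
  then have "((\<lambda>L. E L * I) \<longlongrightarrow> 0 * I) at_top" by (intro tendsto_mult tendsto_const) simp
  then have "\<forall>\<^sub>F L in at_top. E L * I < e" using e by (simp add: order_tendstoD)
  with eventually_gt_at_top[of Q] show ?thesis
  proof eventually_elim
    case (elim L)
    show ?case
    proof
      fix q assume q: "q \<in> {0..Q}"
      have L: "L > 0" using elim Q by simp
      have int: "integrable lborel (\<lambda>t. g t * max 0 (t + L - q) powr (s - 1))"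
        using smooth_supp_psi_integrable(2)[OF s(1) g, of "q - L"] by (simp add: algebra_simps)
      have "psi s (\<lambda>x. g (x - L)) q = (\<integral>t. g t * max 0 (t + L - q) powr (s - 1) \<partial>lborel)"
        unfolding psi_def by (subst lborel_integral_real_affine[where c = 1 and t = L]) (auto simp: algebra_simps)
      then have "L powr (1 - s) * psi s (\<lambda>x. g (x - L)) q - integral\<^sup>L lborel g
         = (\<integral>t. L powr (1 - s) * (g t * max 0 (t + L - q) powr (s - 1)) - g t \<partial>lborel)"
        using int smooth_supp_integrable[OF g] by simp
      also have "\<bar>\<dots>\<bar> \<le> (\<integral>t. E L * \<bar>g t\<bar> \<partial>lborel)"
        unfolding real_norm_def[symmetric]
      proof (rule Bochner_Integration.integral_norm_bound_integral)
        show "integrable lborel (\<lambda>t. L powr (1 - s) * (g t * max 0 (t + L - q) powr (s - 1)) - g t)"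
          using int smooth_supp_integrable[OF g] by simp
        show "integrable lborel (\<lambda>t. E L * norm (g t))" using smooth_supp_integrable[OF g] by simp
        fix t
        show "norm (L powr (1 - s) * (g t * max 0 (t + L - q) powr (s - 1)) - g t) \<le> E L * norm (g t)"
        proof (cases "t \<in> {0..1}")
          case True
          define x where "x = 1 + (t - q) / L"
          have x: "1 - Q / L \<le> x" "x \<le> 1 + 1 / L"
          proof -
            have "- Q / L \<le> (t - q) / L" "(t - q) / L \<le> 1 / L"
              using True q L by (intro divide_right_mono; simp)+
            then show "1 - Q / L \<le> x" "x \<le> 1 + 1 / L" by (auto simp: x_def)
          qed
          have Q0: "0 < 1 - Q / L" using elim L by (simp add: field_simps)
          have mx: "max 0 (t + L - q) = L * x" using elim True q L Q0 x by (auto simp: x_def field_simps)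
          have "L powr (1 - s) * L powr (s - 1) = 1"
            using L by (simp flip: powr_add)
          then have "L powr (1 - s) * (g t * max 0 (t + L - q) powr (s - 1)) - g t = (x powr (s - 1) - 1) * g t"
            using mx Q0 x L by (simp add: powr_mult algebra_simps)
          moreover have "x powr (s - 1) \<le> (1 - Q / L) powr (s - 1)"
            using Q0 x s by (intro powr_mono2') auto
          moreover have "(1 + 1 / L) powr (s - 1) \<le> x powr (s - 1)"
            using Q0 x s by (intro powr_mono2') auto
          ultimately show ?thesis
            by (auto simp: abs_mult E_def intro!: mult_right_mono)
        qed (use g in \<open>auto simp: smooth_supp_def\<close>)
      qed
      also have "\<dots> = E L * I" by (simp add: I_def)
      finally show "\<bar>L powr (1 - s) * psi s (\<lambda>x. g (x - L)) q - integral\<^sup>L lborel g\<bar> < e"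
        using elim by simp
    qed
  qed
qed

subsection \<open>Density of the radial profiles\<close>

text \<open>\<open>H j\<close> stands for the j-th derivative of a target. As derivatives of
  \<open>psi s g\<close> are the averages of derivatives of g, this is approximability in
  C^k([0, Q]). Keeping the whole family \<open>H\<close> as parameter allows the index shift in
  \<open>psi_approx_step\<close> and the use of \<open>pderiv\<close> for polynomials. The condition
  \<open>Q < a\<close> is what later makes the kernels harmonic where |x|^2 <= Q.\<close>

definition psi_approx :: "real \<Rightarrow> real \<Rightarrow> nat \<Rightarrow> (nat \<Rightarrow> real \<Rightarrow> real) \<Rightarrow> bool" where
  "psi_approx s Q k H \<longleftrightarrow> (\<forall>e>0. \<exists>g a b. Q < a \<and> a \<le> b \<and> smooth_supp a b g \<and>
     (\<forall>j\<le>k. \<forall>q\<in>{0..Q}. \<bar>psi s ((deriv ^^ j) g) q - H j q\<bar> < e))"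

text \<open>Derivatives of \<open>bump\<close> have integral 0, so only j = 0 survives in the limit:
  the scaled far profiles tend to a constant in C^k and not merely uniformly.\<close>

lemma psi_far_derivs:
  assumes s: "0 < s" "s < 1" and Q: "Q > 0" and e: "e > 0"
  shows "\<forall>\<^sub>F L in at_top. \<forall>j\<le>k. \<forall>q\<in>{0..Q}.
    \<bar>L powr (1 - s) * psi s ((deriv ^^ j) (\<lambda>x. bump (x - L))) q
      - (if j = 0 then integral\<^sup>L lborel bump else 0)\<bar> < e"
proof -
  have "\<forall>\<^sub>F L in at_top. \<forall>j\<in>{..k}. \<forall>q\<in>{0..Q}.
    \<bar>L powr (1 - s) * psi s ((deriv ^^ j) (\<lambda>x. bump (x - L))) q
      - (if j = 0 then integral\<^sup>L lborel bump else 0)\<bar> < e"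
  proof (rule eventually_ball_finite, simp, rule ballI)
    fix j assume "j \<in> {..k}"
    have "(if j = 0 then integral\<^sup>L lborel bump else 0) = integral\<^sup>L lborel ((deriv ^^ j) bump)"
      using smooth_supp_integral_deriv[OF smooth_supp_funpow_deriv[OF smooth_supp_bump]] by (cases j) auto
    then show "\<forall>\<^sub>F L in at_top. \<forall>q\<in>{0..Q}.
      \<bar>L powr (1 - s) * psi s ((deriv ^^ j) (\<lambda>x. bump (x - L))) q
      - (if j = 0 then integral\<^sup>L lborel bump else 0)\<bar> < e"
      using psi_far[OF s smooth_supp_funpow_deriv[OF smooth_supp_bump, of j] Q e]
      by (simp add: funpow_deriv_shift[OF smooth_real_bump])
  qed
  then show ?thesis by (simp only: Ball_def atMost_iff)
qed

lemma psi_approx_const: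
  assumes s: "0 < s" "s < 1" and Q: "Q > 0"
  shows "psi_approx s Q k (\<lambda>j q. if j = 0 then c else 0)"
  unfolding psi_approx_def
proof (intro allI impI)
  fix e :: real assume e: "e > 0"
  define I where "I = integral\<^sup>L lborel bump"
  have I: "I > 0" using integral_bump_pos by (simp add: I_def)
  \<comment> \<open>Turns the limit \<open>I\<close> into \<open>c\<close>. The summand 1 in the
    tolerance e / (|d| + 1) below covers the case d = 0.\<close>
  define d where "d = c / I"
  have "\<forall>\<^sub>F L in at_top. (\<forall>j\<le>k. \<forall>q\<in>{0..Q}.
      \<bar>L powr (1 - s) * psi s ((deriv ^^ j) (\<lambda>x. bump (x - L))) q - (if j = 0 then I else 0)\<bar>
        < e / (\<bar>d\<bar> + 1)) \<and> L > Q"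
    using psi_far_derivs[OF s Q, of "e / (\<bar>d\<bar> + 1)" k] e unfolding I_def
    by (intro eventually_conj eventually_gt_at_top) (auto simp: divide_pos_pos)
  then obtain L where L: "L > Q" "\<And>j q. j \<le> k \<Longrightarrow> q \<in> {0..Q} \<Longrightarrow>
    \<bar>L powr (1 - s) * psi s ((deriv ^^ j) (\<lambda>x. bump (x - L))) q - (if j = 0 then I else 0)\<bar> < e / (\<bar>d\<bar> + 1)"
    using eventually_happens'[OF trivial_limit_at_top_linorder] by blast
  \<comment> \<open>The summand 0 gives \<open>g\<close> the shape f + c g on which the linearity
    lemmas operate.\<close>
  define g where "g = (\<lambda>x. 0 + (d * L powr (1 - s)) * bump (x - L))"
  have cb: "smooth_supp (0 + L) (1 + L) (\<lambda>x. bump (x - L))" by (rule smooth_supp_shift[OF smooth_supp_bump])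
  have c0: "smooth_supp (0 + L) (1 + L) (\<lambda>x. 0)" by (auto simp: smooth_supp_def smooth_real_const)
  have z: "(deriv ^^ j) (\<lambda>x. 0::real) = (\<lambda>x. 0)" for j by (induction j) auto
  have dg: "(deriv ^^ j) g = (\<lambda>x. 0 + (d * L powr (1 - s)) * (deriv ^^ j) (\<lambda>x. bump (x - L)) x)" for j
    unfolding g_def using cb c0 by (subst funpow_deriv_lin) (auto simp: smooth_supp_def z)
  have p0: "psi s (\<lambda>x. 0) q = 0" for q by (simp add: psi_def)
  have pg: "psi s ((deriv ^^ j) g) q = d * (L powr (1 - s) * psi s ((deriv ^^ j) (\<lambda>x. bump (x - L))) q)" for j q
    unfolding dg by (subst psi_lin[OF s(1) c0 smooth_supp_funpow_deriv[OF cb]]) (simp add: p0)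
  have "\<bar>psi s ((deriv ^^ j) g) q - (if j = 0 then c else 0)\<bar> < e" if "j \<le> k" "q \<in> {0..Q}" for j q
  proof -
    have "psi s ((deriv ^^ j) g) q - (if j = 0 then c else 0) =
      d * (L powr (1 - s) * psi s ((deriv ^^ j) (\<lambda>x. bump (x - L))) q - (if j = 0 then I else 0))"
      using I by (simp add: pg d_def algebra_simps)
    also have "\<bar>\<dots>\<bar> \<le> \<bar>d\<bar> * (e / (\<bar>d\<bar> + 1))"
      unfolding abs_mult using L(2)[OF that] by (intro mult_left_mono) auto
    also have "\<dots> < e" using e by (simp add: field_simps)
    finally show ?thesis .
  qed
  moreover have "smooth_supp (0 + L) (1 + L) g" unfolding g_def by (rule smooth_supp_lin[OF c0 cb])
  ultimately show "\<exists>g a b. Q < a \<and> a \<le> b \<and> smooth_supp a b g \<and>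
     (\<forall>j\<le>k. \<forall>q\<in>{0..Q}. \<bar>psi s ((deriv ^^ j) g) q - (if j = 0 then c else 0)\<bar> < e)"
    using L(1) by (intro exI[of _ g] exI[of _ "0 + L"] exI[of _ "1 + L"]) simp
qed

text \<open>Integration of an approximation. If g approximates the derivative, subtract c times a
  far bump so that the integral becomes 0; this changes the profiles by only |c| O(L^(s-1)), and the
  result has a compactly supported primitive G. On [0, Q] the profile of G then differs from
  \<open>H 0\<close> by almost a constant, its error at 0, which \<open>psi_approx_const\<close>
  removes.\<close>

lemma psi_approx_step:
  assumes s: "0 < s" "s < 1" and Q: "Q > 0"
    and A: "psi_approx s Q k (\<lambda>j. H (Suc j))"
    and H: "\<And>q. (H 0 has_real_derivative H (Suc 0) q) (at q)"
  shows "psi_approx s Q (Suc k) H"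
  unfolding psi_approx_def
proof (intro allI impI)
  fix e :: real assume e: "e > 0"
  \<comment> \<open>The derivatives of the profile of G are off by 2 e1: e1 from g and e1 from the
    bump. Integrating over [0, Q] gives 2 e1 Q, and the constant correction adds e1 at every order.
    All this fits into 4 e1 Q + 4 e1 = e.\<close>
  define e1 where "e1 = e / (4 * (Q + 1))"
  have e1: "e1 > 0" using e Q by (simp add: e1_def)
  have e1Q: "4 * e1 * Q + 4 * e1 = e"
  proof -
    have "e1 * (4 * (Q + 1)) = e" using Q by (simp add: e1_def)
    then show ?thesis by (simp add: algebra_simps)
  qed
  obtain g a b where g: "Q < a" "a \<le> b" "smooth_supp a b g"
    "\<And>j q. j \<le> k \<Longrightarrow> q \<in> {0..Q} \<Longrightarrow> \<bar>psi s ((deriv ^^ j) g) q - H (Suc j) q\<bar> < e1"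
    using A e1 unfolding psi_approx_def by meson
  define I where "I = integral\<^sup>L lborel bump"
  have I: "I > 0" using integral_bump_pos by (simp add: I_def)
  define c where "c = integral\<^sup>L lborel g / I"
  have "((\<lambda>L. \<bar>c\<bar> * ((I + 1) * L powr (s - 1))) \<longlongrightarrow> \<bar>c\<bar> * ((I + 1) * 0)) at_top"
    using s by (intro tendsto_intros tendsto_neg_powr filterlim_ident) auto
  then have "\<forall>\<^sub>F L in at_top. \<bar>c\<bar> * ((I + 1) * L powr (s - 1)) < e1"
    using e1 by (simp add: order_tendstoD)
  \<comment> \<open>Tolerance 1 is enough: it bounds the scaled profiles by I + 1, and smallness
    comes from the factor L^(s-1) in the last conjunct.\<close>
  then have "\<forall>\<^sub>F L in at_top. L > Q \<and> (\<forall>j\<le>k. \<forall>q\<in>{0..Q}.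
      \<bar>L powr (1 - s) * psi s ((deriv ^^ j) (\<lambda>x. bump (x - L))) q - (if j = 0 then I else 0)\<bar> < 1)
      \<and> \<bar>c\<bar> * ((I + 1) * L powr (s - 1)) < e1"
    unfolding I_def by (intro eventually_conj eventually_gt_at_top psi_far_derivs s Q) simp_all
  then obtain L where L: "L > Q" "\<bar>c\<bar> * ((I + 1) * L powr (s - 1)) < e1"
    "\<And>j q. j \<le> k \<Longrightarrow> q \<in> {0..Q} \<Longrightarrow>
      \<bar>L powr (1 - s) * psi s ((deriv ^^ j) (\<lambda>x. bump (x - L))) q - (if j = 0 then I else 0)\<bar> < 1"
    using eventually_happens'[OF trivial_limit_at_top_linorder] by blast
  have cb: "smooth_supp L (1 + L) (\<lambda>x. bump (x - L))" using smooth_supp_shift[OF smooth_supp_bump, of L] by simp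
  define a' b' where "a' = min a L" and "b' = max b (1 + L)"
  have g': "smooth_supp a' b' g" and cb': "smooth_supp a' b' (\<lambda>x. bump (x - L))"
    by (rule smooth_supp_mono[OF g(3)] smooth_supp_mono[OF cb]; simp add: a'_def b'_def)+
  define h where "h = (\<lambda>x. g x + (- c) * bump (x - L))"
  have h: "smooth_supp a' b' h" unfolding h_def by (rule smooth_supp_lin[OF g' cb'])
  have "integral\<^sup>L lborel (\<lambda>x. bump (x - L)) = I"
    unfolding I_def using lborel_integral_real_affine[of 1 bump "- L"] by simp
  then have "integral\<^sup>L lborel h = 0"
    unfolding h_def using smooth_supp_integrable[OF g'] smooth_supp_integrable[OF cb'] I by (simp add: c_def)
  moreover have "a' \<le> b'" using g(2) by (simp add: a'_def b'_def)
  ultimately obtain G where G: "smooth_supp a' b' G" "deriv G = h" using smooth_supp_primitive[OF h] by blast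
  have far: "\<bar>c * psi s ((deriv ^^ j) (\<lambda>x. bump (x - L))) q\<bar> < e1" if "j \<le> k" "q \<in> {0..Q}" for j q
  proof -
    let ?p = "psi s ((deriv ^^ j) (\<lambda>x. bump (x - L))) q"
    have L0: "L > 0" using L(1) Q by simp
    have "\<bar>L powr (1 - s) * ?p\<bar> \<le> I + 1" using L(3)[OF that] I by (auto split: if_splits)
    then have "L powr (s - 1) * \<bar>L powr (1 - s) * ?p\<bar> \<le> (I + 1) * L powr (s - 1)"
      by (subst mult.commute) (rule mult_right_mono, simp_all)
    moreover have "L powr (s - 1) * \<bar>L powr (1 - s) * ?p\<bar> = \<bar>?p\<bar>"
      using L0 by (simp add: abs_mult mult.assoc[symmetric] flip: powr_add)
    ultimately have "\<bar>?p\<bar> \<le> (I + 1) * L powr (s - 1)" by simp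
    then have "\<bar>c\<bar> * \<bar>?p\<bar> \<le> \<bar>c\<bar> * ((I + 1) * L powr (s - 1))"
      by (rule mult_left_mono) simp
    then show ?thesis using L(2) by (simp add: abs_mult)
  qed
  have dG: "(deriv ^^ Suc j) G = (\<lambda>x. (deriv ^^ j) g x + (- c) * (deriv ^^ j) (\<lambda>x. bump (x - L)) x)" for j
    unfolding funpow_Suc_right comp_def G(2) h_def
    using g(3) cb by (subst funpow_deriv_lin) (auto simp: smooth_supp_def)
  have pG: "psi s ((deriv ^^ Suc j) G) q = psi s ((deriv ^^ j) g) q
     - c * psi s ((deriv ^^ j) (\<lambda>x. bump (x - L))) q" for j q
    unfolding dG by (subst psi_lin[OF s(1) smooth_supp_funpow_deriv[OF g(3)] smooth_supp_funpow_deriv[OF cb]]) simp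
  have bd: "\<bar>psi s ((deriv ^^ Suc j) G) q - H (Suc j) q\<bar> < 2 * e1" if "j \<le> k" "q \<in> {0..Q}" for j q
  proof -
    have tri: "\<bar>x\<bar> < e1 \<Longrightarrow> \<bar>y - z\<bar> < e1 \<Longrightarrow> \<bar>y - x - z\<bar> < 2 * e1" for x y z :: real by linarith
    show ?thesis by (subst pG, rule tri) (rule far[OF that], rule g(4)[OF that])
  qed
  define d where "d = psi s G 0 - H 0 0"
  have D: "\<bar>psi s G q - H 0 q - d\<bar> \<le> 2 * e1 * Q" if q: "q \<in> {0..Q}" for q
  proof -
    have "norm ((psi s G q - H 0 q) - (psi s G 0 - H 0 0)) \<le> 2 * e1 * norm (q - 0)"
    proof (rule field_differentiable_bound[where S = "{0..Q}" and f = "\<lambda>q. psi s G q - H 0 q" and f' = "\<lambda>q. psi s (deriv G) q - H (Suc 0) q"])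
      show "((\<lambda>q. psi s G q - H 0 q) has_field_derivative psi s (deriv G) z - H (Suc 0) z) (at z within {0..Q})" for z
        by (rule has_field_derivative_at_within) (intro DERIV_diff psi_DERIV[OF s(1) G(1)] H)
      show "norm (psi s (deriv G) z - H (Suc 0) z) \<le> 2 * e1" if "z \<in> {0..Q}" for z
        using bd[of 0 z] that by simp
    qed (use q in auto)
    also have "\<dots> \<le> 2 * e1 * Q" using q e1 by (intro mult_left_mono) auto
    finally show ?thesis by (simp add: d_def)
  qed
  obtain f a2 b2 where f: "Q < a2" "a2 \<le> b2" "smooth_supp a2 b2 f"
    "\<And>j q. j \<le> Suc k \<Longrightarrow> q \<in> {0..Q} \<Longrightarrow> \<bar>psi s ((deriv ^^ j) f) q - (if j = 0 then - d else 0)\<bar> < e1"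
    using psi_approx_const[OF s Q, of "Suc k" "- d"] e1 unfolding psi_approx_def by meson
  define F where "F = (\<lambda>x. G x + 1 * f x)"
  have dF: "(deriv ^^ j) F = (\<lambda>x. (deriv ^^ j) G x + 1 * (deriv ^^ j) f x)" for j
    unfolding F_def using G(1) f(3) by (subst funpow_deriv_lin) (auto simp: smooth_supp_def)
  have pF: "psi s ((deriv ^^ j) F) q = psi s ((deriv ^^ j) G) q + psi s ((deriv ^^ j) f) q" for j q
    unfolding dF by (subst psi_lin[OF s(1) smooth_supp_funpow_deriv[OF G(1)] smooth_supp_funpow_deriv[OF f(3)]]) simp
  have "\<bar>psi s ((deriv ^^ j) F) q - H j q\<bar> < e" if "j \<le> Suc k" "q \<in> {0..Q}" for j q
  proof (cases j)
    case 0
    have "\<bar>psi s ((deriv ^^ j) F) q - H j q\<bar> < 2 * e1 * Q + e1"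
      using D[OF that(2)] f(4)[OF that] unfolding pF 0 by simp
    also have "\<dots> \<le> 4 * e1 * Q + 4 * e1" using e1 Q by (intro add_mono mult_right_mono) auto
    finally show ?thesis using e1Q by simp
  next
    case (Suc i)
    have "\<bar>psi s ((deriv ^^ j) F) q - H j q\<bar> < 2 * e1 + e1"
      using bd[of i q] f(4)[OF that] that unfolding pF Suc by (simp del: funpow.simps)
    also have "\<dots> \<le> 4 * e1 * Q + 4 * e1" using e1 Q by simp
    finally show ?thesis using e1Q by simp
  qed
  moreover have "smooth_supp (min a' a2) (max b' b2) F"
    unfolding F_def by (rule smooth_supp_lin; rule smooth_supp_mono[OF G(1)] smooth_supp_mono[OF f(3)]; simp)
  moreover have "Q < min a' a2" "min a' a2 \<le> max b' b2"
    using g(1) L(1) f(1,2) by (auto simp: a'_def)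
  ultimately show "\<exists>g a b. Q < a \<and> a \<le> b \<and> smooth_supp a b g \<and>
     (\<forall>j\<le>Suc k. \<forall>q\<in>{0..Q}. \<bar>psi s ((deriv ^^ j) g) q - H j q\<bar> < e)"
    by blast
qed

text \<open>Induction on the degree: \<open>pderiv\<close> lowers it and one integration step
  restores p. The order k varies in the induction because the step raises it by one.\<close>

lemma psi_approx_poly:
  assumes s: "0 < s" "s < 1" and Q: "Q > 0"
  shows "psi_approx s Q k (\<lambda>j. poly ((pderiv ^^ j) p))"
proof (induction "degree p" arbitrary: p k)
  case 0
  then obtain c where c: "p = [:c:]" by (metis degree_eq_zeroE)
  have "(pderiv ^^ j) [:c:] = (if j = 0 then [:c:] else 0)" for j
    by (induction j) (auto simp: pderiv_pCons)
  then have "(\<lambda>j. poly ((pderiv ^^ j) p)) = (\<lambda>j q. if j = 0 then c else 0)"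
    by (auto simp: c fun_eq_iff)
  then show ?case using psi_approx_const[OF s Q, of k c] by simp
next
  case (Suc n)
  have "degree (pderiv p) = n" using Suc(2) by (simp add: degree_pderiv)
  then have "psi_approx s Q k (\<lambda>j. poly ((pderiv ^^ j) (pderiv p)))" using Suc(1) by simp
  then have "psi_approx s Q k (\<lambda>j. poly ((pderiv ^^ Suc j) p))" by (simp only: funpow_Suc_right comp_def)
  then have "psi_approx s Q (Suc k) (\<lambda>j. poly ((pderiv ^^ j) p))"
    by (rule psi_approx_step[OF s Q]) (auto intro: poly_DERIV)
  then show ?case unfolding psi_approx_def by (meson le_SucI)
qed

text \<open>Weierstrass controls no derivatives, so it is applied to the k-th derivative of h alone;
  k integration steps then recover h together with its lower derivatives.\<close>

lemma psi_approx_smooth: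
  assumes s: "0 < s" "s < 1" and Q: "Q > 0" and h: "smooth_real h"
  shows "psi_approx s Q k (\<lambda>j. (deriv ^^ j) h)"
  using h
proof (induction k arbitrary: h)
  case 0
  show ?case unfolding psi_approx_def
  proof (intro allI impI)
    fix e :: real assume e: "e > 0"
    obtain P where P: "real_polynomial_function P" "\<And>x. x \<in> {0..Q} \<Longrightarrow> \<bar>h x - P x\<bar> < e / 2"
      using Stone_Weierstrass_real_polynomial_function[of "{0..Q}" h "e / 2"] e smooth_real_continuous_on[OF 0]
      by auto
    obtain c n where cn: "P = (\<lambda>x. \<Sum>i\<le>n. c i * x ^ i)"
      using P(1) real_polynomial_function_iff_sum by auto
    define p where "p = (\<Sum>i\<le>n. monom (c i) i)"
    have p: "poly p x = P x" for x by (simp add: p_def cn poly_sum poly_monom)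
    obtain g a b where g: "Q < a" "a \<le> b" "smooth_supp a b g"
      "\<And>j q. j \<le> 0 \<Longrightarrow> q \<in> {0..Q} \<Longrightarrow> \<bar>psi s ((deriv ^^ j) g) q - poly ((pderiv ^^ j) p) q\<bar> < e / 2"
      using psi_approx_poly[OF s Q, of 0 p] half_gt_zero[OF e] unfolding psi_approx_def by meson
    have "\<bar>psi s g q - h q\<bar> < e" if "q \<in> {0..Q}" for q
    proof -
      have "\<bar>psi s g q - P q\<bar> < e / 2" using g(4)[of 0 q] that by (simp add: p)
      then show ?thesis using P(2)[OF that] by linarith
    qed
    then show "\<exists>g a b. Q < a \<and> a \<le> b \<and> smooth_supp a b g \<and>
       (\<forall>j\<le>0. \<forall>q\<in>{0..Q}. \<bar>psi s ((deriv ^^ j) g) q - (deriv ^^ j) h q\<bar> < e)"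
      using g(1-3) by (intro exI[of _ g] exI[of _ a] exI[of _ b]) auto
  qed
next
  case (Suc k)
  have "psi_approx s Q k (\<lambda>j. (deriv ^^ Suc j) h)"
    unfolding funpow_Suc_right comp_def by (rule Suc.IH[OF smooth_real_deriv[OF Suc.prems]])
  then show ?case
    by (rule psi_approx_step[OF s Q]) (auto intro: smooth_real_DERIV Suc.prems)
qed

subsection \<open>The principal value on a line\<close>

text \<open>Mean value inequality twice: for f' between m - t and m + t, then for f(m + t) + f(m -
  t) as a function of t. This loses a harmless factor 2 against the Taylor bound C h^2.\<close>

lemma second_difference_bound:
  fixes f :: "real \<Rightarrow> real"
  assumes d1: "\<And>x. \<bar>x - m\<bar> \<le> \<bar>h\<bar> \<Longrightarrow> (f has_real_derivative f' x) (at x)"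
    and d2: "\<And>x. \<bar>x - m\<bar> \<le> \<bar>h\<bar> \<Longrightarrow> (f' has_real_derivative f'' x) (at x)"
    and C: "\<And>x. \<bar>x - m\<bar> \<le> \<bar>h\<bar> \<Longrightarrow> \<bar>f'' x\<bar> \<le> C"
  shows "\<bar>2 * f m - f (m + h) - f (m - h)\<bar> \<le> 2 * C * h\<^sup>2"
proof -
  have C0: "C \<ge> 0" using C[of m] by simp
  have f': "\<bar>f' (m + t) - f' (m - t)\<bar> \<le> 2 * C * \<bar>h\<bar>" if t: "\<bar>t\<bar> \<le> \<bar>h\<bar>" for t
  proof -
    have "norm (f' (m + t) - f' (m - t)) \<le> C * norm ((m + t) - (m - t))"
    proof (rule field_differentiable_bound[where S = "{m - \<bar>h\<bar>..m + \<bar>h\<bar>}" and f = f' and f' = f''])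
      fix x assume "x \<in> {m - \<bar>h\<bar>..m + \<bar>h\<bar>}"
      then have x: "\<bar>x - m\<bar> \<le> \<bar>h\<bar>" by auto
      show "(f' has_field_derivative f'' x) (at x within {m - \<bar>h\<bar>..m + \<bar>h\<bar>})"
        using d2[OF x] by (rule has_field_derivative_at_within)
      show "norm (f'' x) \<le> C" using C[OF x] by simp
    qed (use t in auto)
    also have "\<dots> \<le> C * (2 * \<bar>h\<bar>)" using t C0 by (intro mult_left_mono) auto
    finally show ?thesis by simp
  qed
  let ?G = "\<lambda>t. f (m + t) + f (m - t)"
  have "norm (?G h - ?G 0) \<le> 2 * C * \<bar>h\<bar> * norm (h - 0)"
  proof (rule field_differentiable_bound[where S = "{- \<bar>h\<bar>..\<bar>h\<bar>}" and f = ?G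
        and f' = "\<lambda>t. f' (m + t) - f' (m - t)"])
    fix t assume "t \<in> {- \<bar>h\<bar>..\<bar>h\<bar>}"
    then have t: "\<bar>t\<bar> \<le> \<bar>h\<bar>" by auto
    show "norm (f' (m + t) - f' (m - t)) \<le> 2 * C * \<bar>h\<bar>" using f'[OF t] by simp
    have 1: "((\<lambda>t. f (m + t)) has_real_derivative f' (m + t) * 1) (at t)"
      by (rule DERIV_chain2[of f]) (use d1[of "m + t"] t in \<open>auto intro!: derivative_eq_intros\<close>)
    have 2: "((\<lambda>t. f (m - t)) has_real_derivative f' (m - t) * (- 1)) (at t)"
      by (rule DERIV_chain2[of f]) (use d1[of "m - t"] t in \<open>auto intro!: derivative_eq_intros\<close>)
    have "(?G has_real_derivative f' (m + t) * 1 + f' (m - t) * (- 1)) (at t)"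
      by (rule DERIV_add[OF 1 2])
    then show "(?G has_field_derivative f' (m + t) - f' (m - t)) (at t within {- \<bar>h\<bar>..\<bar>h\<bar>})"
      by (simp add: has_field_derivative_at_within)
  qed auto
  then show ?thesis by (simp add: power2_eq_square abs_mult_self_eq algebra_simps)
qed

text \<open>The integrand may blow up at w0 = sqrt (c / \<alpha>). For w > w0 it is at most w / w0
  times itself, and with the extra factor w it has the explicit primitive \<open>?Phi\<close>. Hence
  B - Phi / w0 decreases, which bounds B from below near w0, and the increasing function B has a
  limit there.\<close>

lemma antiderivative_with_limit:
  fixes s \<alpha> c :: real
  assumes s: "0 < s" and \<alpha>: "0 < \<alpha>" and c: "0 < c"
  obtains B B0 where
    "\<And>w. sqrt (c / \<alpha>) < w \<Longrightarrow> (B has_real_derivative (\<alpha> * w\<^sup>2 - c) powr (s - 1)) (at w)"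
    "(B \<longlongrightarrow> B0) (at_right (sqrt (c / \<alpha>)))"
proof -
  let ?w0 = "sqrt (c / \<alpha>)"
  let ?phi = "\<lambda>w. (\<alpha> * w\<^sup>2 - c) powr (s - 1)"
  let ?Phi = "\<lambda>w. (\<alpha> * w\<^sup>2 - c) powr s / (2 * s * \<alpha>)"
  have w0: "?w0 > 0" using \<alpha> c by simp
  have pos: "\<alpha> * w\<^sup>2 - c > 0" if "?w0 < w" for w
  proof -
    have "?w0\<^sup>2 < w\<^sup>2" using that w0 by (intro power_strict_mono) auto
    then have "c / \<alpha> < w\<^sup>2" using \<alpha> c by simp
    then show ?thesis using \<alpha> by (simp add: field_simps)
  qed
  have "\<exists>F. \<forall>x::real. ereal ?w0 < ereal x \<longrightarrow> ereal x < \<infinity> \<longrightarrow> (F has_vector_derivative ?phi x) (at x)"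
  proof (rule einterval_antiderivative)
    fix x assume "ereal ?w0 < ereal x"
    then have "\<alpha> * x\<^sup>2 - c \<noteq> 0" using pos[of x] by force
    then show "isCont ?phi x" by (intro continuous_intros) auto
  qed simp
  then obtain B where B: "\<And>w. ?w0 < w \<Longrightarrow> (B has_real_derivative ?phi w) (at w)"
    by (auto simp: has_real_derivative_iff_has_vector_derivative)
  have Phi: "(?Phi has_real_derivative ?phi w * w) (at w)" if "?w0 < w" for w
    using pos[OF that] s \<alpha> by (auto intro!: derivative_eq_intros simp: field_simps)
  have mono: "B x \<le> B y" if "?w0 < x" "x \<le> y" for x y
  proof (rule DERIV_nonneg_imp_nondecreasing[OF that(2)])
    fix z assume "x \<le> z"
    then have "(B has_real_derivative ?phi z) (at z)" using that by (intro B) simp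
    then show "\<exists>d. (B has_real_derivative d) (at z) \<and> 0 \<le> d" by (intro exI[of _ "?phi z"]) simp
  qed
  have low: "- (?Phi (?w0 + 1) / ?w0) + B (?w0 + 1) \<le> B x" if x: "?w0 < x" for x
  proof (cases "x \<le> ?w0 + 1")
    case True
    have "B (?w0 + 1) - ?Phi (?w0 + 1) / ?w0 \<le> B x - ?Phi x / ?w0"
    proof (rule DERIV_nonpos_imp_nonincreasing[OF True])
      fix y assume "x \<le> y"
      then have y: "?w0 < y" using x by simp
      have "((\<lambda>w. B w - ?Phi w / ?w0) has_real_derivative ?phi y - ?phi y * y / ?w0) (at y)"
        by (intro DERIV_diff DERIV_cdivide B Phi y)
      moreover have "?phi y - ?phi y * y / ?w0 = ?phi y * (1 - y / ?w0)" by (simp add: algebra_simps)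
      moreover have "\<dots> \<le> 0" using y w0 by (intro mult_nonneg_nonpos) auto
      ultimately show "\<exists>z. ((\<lambda>w. B w - ?Phi w / ?w0) has_real_derivative z) (at y) \<and> z \<le> 0"
        by (intro exI[of _ "?phi y - ?phi y * y / ?w0"]) (simp only: simp_thms)
    qed
    moreover have "?Phi x / ?w0 \<ge> 0" using w0 s \<alpha> by simp
    ultimately show ?thesis by linarith
  next
    case False
    then have "B (?w0 + 1) \<le> B x" by (intro mono) auto
    moreover have "?Phi (?w0 + 1) / ?w0 \<ge> 0" using w0 s \<alpha> by simp
    ultimately show ?thesis by linarith
  qed
  have "(B \<longlongrightarrow> Inf (B ` ({?w0<..} \<inter> UNIV))) (at ?w0 within ({?w0<..} \<inter> UNIV))"
    by (rule Lim_right_bound[where K = "- (?Phi (?w0 + 1) / ?w0) + B (?w0 + 1)"]) (use mono low in auto)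
  then have "(B \<longlongrightarrow> Inf (B ` {?w0<..})) (at_right ?w0)" by simp
  with B show ?thesis by (rule that)
qed

text \<open>The substitution \<open>w = 1/x - b\<close> turns the integrand into \<open>(\<alpha> w\<^sup>2 - c) powr (s - 1) (w + b)\<close>. Only the
  summand with \<open>b\<close> has no elementary antiderivative; it is odd in \<open>\<beta>\<close> and cancels to leading order
  when the contributions of \<open>\<beta>\<close> and \<open>- \<beta>\<close> are added.\<close>

lemma half_line_integral:
  fixes s \<alpha> \<beta> \<gamma> N :: real
  defines "c \<equiv> \<gamma> + \<beta>\<^sup>2 / \<alpha>" and "b \<equiv> \<beta> / \<alpha>"
  assumes s: "0 < s" and \<alpha>: "0 < \<alpha>" and \<gamma>: "0 < \<gamma>" and N: "N > 0" "sqrt (c / \<alpha>) < N - b"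
    and B: "\<And>w. sqrt (c / \<alpha>) < w \<Longrightarrow> (B has_real_derivative (\<alpha> * w\<^sup>2 - c) powr (s - 1)) (at w)"
    and B0: "(B \<longlongrightarrow> B0) (at_right (sqrt (c / \<alpha>)))"
  shows "set_integrable lborel {1/N<..} (\<lambda>x. max 0 (\<alpha> - 2 * \<beta> * x - \<gamma> * x\<^sup>2) powr (s - 1) * x powr (- 1 - 2 * s))"
      (is "set_integrable _ _ ?f")
    and "(LINT x:{1/N<..}|lborel. max 0 (\<alpha> - 2 * \<beta> * x - \<gamma> * x\<^sup>2) powr (s - 1) * x powr (- 1 - 2 * s))
      = (\<alpha> * (N - b)\<^sup>2 - c) powr s / (2 * s * \<alpha>) + b * (B (N - b) - B0)"
proof -
  let ?w0 = "sqrt (c / \<alpha>)"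
  \<comment> \<open>The positive root of \<alpha> - 2 \<beta> x - \<gamma> x^2, that is, the point
    where w = 1/x - b reaches \<open>?w0\<close>.\<close>
  define l1 where "l1 = 1 / (?w0 + b)"
  let ?Phi = "\<lambda>w. (\<alpha> * w\<^sup>2 - c) powr s / (2 * s * \<alpha>)"
  \<comment> \<open>The primitive after the substitution; the sign comes from dw = - dx /
    x^2.\<close>
  define A where "A = (\<lambda>x. - (?Phi (1/x - b) + b * B (1/x - b)))"
  have c: "c > 0" using \<alpha> \<gamma> by (simp add: c_def add_pos_nonneg)
  have w0: "?w0 > 0" using \<alpha> c by simp
  have "b\<^sup>2 < c / \<alpha>" using \<alpha> \<gamma> by (simp add: b_def c_def field_simps power2_eq_square)
  then have "sqrt (b\<^sup>2) < ?w0" by (rule real_sqrt_less_mono)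
  then have wb: "\<bar>b\<bar> < ?w0" by simp
  have l1: "l1 > 0" using wb by (simp add: l1_def)
  have "?w0 + b < N" using N by simp
  then have Nl: "1 / N < l1" using N wb by (simp add: l1_def frac_less2)
  have quad: "\<alpha> * (1/x - b)\<^sup>2 - c = (\<alpha> - 2 * \<beta> * x - \<gamma> * x\<^sup>2) / x\<^sup>2" if "x > 0" for x
    using that \<alpha> by (simp add: c_def b_def field_simps power2_eq_square)
  have posw: "\<alpha> * w\<^sup>2 - c > 0" if "?w0 < w" for w
  proof -
    have "?w0\<^sup>2 < w\<^sup>2" using that w0 by (intro power_strict_mono) auto
    then have "c / \<alpha> < w\<^sup>2" using \<alpha> c by simp
    then show ?thesis using \<alpha> by (simp add: field_simps)
  qed
  have inv: "?w0 < 1/x - b" if "0 < x" "x < l1" for x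
  proof -
    have "1 / l1 < 1 / x" using that l1 by (simp add: frac_less2)
    then show ?thesis by (simp add: l1_def)
  qed
  have posx: "\<alpha> - 2 * \<beta> * x - \<gamma> * x\<^sup>2 > 0" if "0 < x" "x < l1" for x
    using posw[OF inv[OF that]] that by (simp add: quad zero_less_divide_iff)
  have outx: "\<alpha> - 2 * \<beta> * x - \<gamma> * x\<^sup>2 \<le> 0" if "x \<ge> l1" for x
  proof -
    have x: "x > 0" using that l1 by simp
    have "1 / x \<le> 1 / l1" using that l1 by (simp add: frac_le)
    then have "1/x - b \<le> ?w0" by (simp add: l1_def)
    moreover have "- ?w0 \<le> 1/x - b" using wb x by (smt (verit) divide_pos_pos)
    ultimately have "\<bar>1/x - b\<bar> \<le> ?w0" by simp
    then have "\<bar>1/x - b\<bar>\<^sup>2 \<le> ?w0\<^sup>2" by (rule power_mono) simp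
    then have "(1/x - b)\<^sup>2 \<le> ?w0\<^sup>2" by simp
    then have "(1/x - b)\<^sup>2 \<le> c / \<alpha>" using \<alpha> c by simp
    then have "\<alpha> * (1/x - b)\<^sup>2 - c \<le> 0" using \<alpha> by (simp add: field_simps)
    then show ?thesis using x by (simp add: quad divide_le_0_iff)
  qed
  have dA: "(A has_real_derivative ?f x) (at x)" if x: "0 < x" "x < l1" for x
  proof -
    let ?w = "1/x - b"
    have Phi: "(?Phi has_real_derivative (\<alpha> * ?w\<^sup>2 - c) powr (s - 1) * ?w) (at ?w)"
      using posw[OF inv[OF x]] s \<alpha> by (auto intro!: derivative_eq_intros simp: field_simps)
    have in': "((\<lambda>x. 1/x - b) has_real_derivative - 1 / x\<^sup>2) (at x)"
      using x by (auto intro!: derivative_eq_intros simp: power2_eq_square)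
    have "(A has_real_derivative
       - ((\<alpha> * ?w\<^sup>2 - c) powr (s - 1) * ?w * (- 1 / x\<^sup>2) + b * ((\<alpha> * ?w\<^sup>2 - c) powr (s - 1) * (- 1 / x\<^sup>2)))) (at x)"
      unfolding A_def
      by (intro DERIV_minus DERIV_add DERIV_cmult DERIV_chain2[OF Phi in'] DERIV_chain2[OF B[OF inv[OF x]] in'])
    also have "- ((\<alpha> * ?w\<^sup>2 - c) powr (s - 1) * ?w * (- 1 / x\<^sup>2) + b * ((\<alpha> * ?w\<^sup>2 - c) powr (s - 1) * (- 1 / x\<^sup>2)))
       = (\<alpha> * ?w\<^sup>2 - c) powr (s - 1) * (?w + b) / x\<^sup>2"
      by (simp add: algebra_simps add_divide_distrib)
    also have "\<dots> = (\<alpha> - 2 * \<beta> * x - \<gamma> * x\<^sup>2) powr (s - 1) / (x\<^sup>2) powr (s - 1) * (1/x) / x\<^sup>2"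
      using x posx[OF x] by (simp add: quad powr_divide)
    also have "\<dots> = (\<alpha> - 2 * \<beta> * x - \<gamma> * x\<^sup>2) powr (s - 1) * x powr (- 1 - 2 * s)"
    proof -
      \<comment> \<open>x^(2s-2) x x^2 = x^(1+2s): the exponent of the kernel is just the one for
        which the substitution leaves no power of x beyond the factor w + b.\<close>
      have "x powr (- 1 - 2 * s) * ((x\<^sup>2) powr (s - 1) * x * x\<^sup>2) = 1"
      proof -
        have "(x\<^sup>2) powr (s - 1) = x powr (2 * s - 2)"
          using x by (simp flip: powr_numeral add: powr_powr algebra_simps)
        then have "x powr (- 1 - 2 * s) * ((x\<^sup>2) powr (s - 1) * x * x\<^sup>2)
          = x powr (- 1 - 2 * s) * (x powr (2 * s - 2) * x powr 1 * x powr 2)" using x by simp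
        also have "\<dots> = x powr ((- 1 - 2 * s) + ((2 * s - 2) + 1 + 2))" by (simp only: powr_add)
        finally show ?thesis using x by simp
      qed
      then have "x powr (- 1 - 2 * s) = 1 / ((x\<^sup>2) powr (s - 1) * x * x\<^sup>2)"
        using x by (simp add: field_simps)
      then show ?thesis by (simp add: field_simps)
    qed
    finally show ?thesis using posx[OF x] by simp
  qed
  have cont: "isCont ?f x" if x: "0 < x" "x < l1" for x
    using posx[OF x] x by (intro continuous_intros) auto
  have limN: "(A \<longlongrightarrow> A (1/N)) (at_right (1/N))"
    using dA[of "1/N"] Nl N DERIV_isCont by (fastforce simp: isCont_def intro: tendsto_within_subset)
  have fl: "filterlim (\<lambda>x. 1/x - b) (at_right ?w0) (at_left l1)"
    unfolding filterlim_at
  proof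
    have "((\<lambda>x. 1/x - b) \<longlongrightarrow> 1 / l1 - b) (at_left l1)" using l1 by (intro tendsto_intros) auto
    then show "((\<lambda>x. 1/x - b) \<longlongrightarrow> ?w0) (at_left l1)" by (simp add: l1_def)
    show "\<forall>\<^sub>F x in at_left l1. 1/x - b \<in> {?w0<..} \<and> 1/x - b \<noteq> ?w0"
    proof -
      have "\<forall>\<^sub>F x in at_left l1. x \<in> {0<..<l1}" by (rule eventually_at_leftI[OF _ l1])
      then show ?thesis by (rule eventually_mono) (use inv in force)
    qed
  qed
  have liml: "(A \<longlongrightarrow> - (0 + b * B0)) (at_left l1)"
    unfolding A_def
  proof (intro tendsto_minus tendsto_add tendsto_mult tendsto_const)
    show "((\<lambda>x. B (1/x - b)) \<longlongrightarrow> B0) (at_left l1)" by (rule filterlim_compose[OF B0 fl])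
    have "((\<lambda>x. ?Phi (1/x - b)) \<longlongrightarrow> ?Phi ?w0) (at_left l1)"
    proof (rule filterlim_compose[OF _ fl])
      have "((\<lambda>w. (\<alpha> * w\<^sup>2 - c) powr s) \<longlongrightarrow> (\<alpha> * ?w0\<^sup>2 - c) powr s) (at_right ?w0)"
      proof (rule tendsto_powr')
        show "((\<lambda>w. \<alpha> * w\<^sup>2 - c) \<longlongrightarrow> \<alpha> * ?w0\<^sup>2 - c) (at_right ?w0)" by (intro tendsto_intros)
        have "\<forall>\<^sub>F w in at_right ?w0. w \<in> {?w0<..<?w0 + 1}" by (rule eventually_at_rightI[OF _ less_add_one])
        then have "\<forall>\<^sub>F w in at_right ?w0. 0 \<le> \<alpha> * w\<^sup>2 - c"
          by (rule eventually_mono) (use posw in force)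
        then show "\<alpha> * ?w0\<^sup>2 - c \<noteq> 0 \<or> 0 < s \<and> (\<forall>\<^sub>F w in at_right ?w0. 0 \<le> \<alpha> * w\<^sup>2 - c)" using s by simp
      qed (rule tendsto_const)
      then show "(?Phi \<longlongrightarrow> ?Phi ?w0) (at_right ?w0)"
        by (rule tendsto_divide[OF _ tendsto_const]) (use s \<alpha> in simp)
    qed
    then show "((\<lambda>x. ?Phi (1/x - b)) \<longlongrightarrow> 0) (at_left l1)" using c \<alpha> by simp
  qed
  have posN: "0 < x" if "1/N < x" for x
    using that N by (meson divide_pos_pos less_trans zero_less_one)
  have FTC: "set_integrable lborel (einterval (ereal (1/N)) (ereal l1)) ?f"
    "(LBINT x=ereal (1/N)..ereal l1. ?f x) = - (0 + b * B0) - A (1/N)"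
    by (rule interval_integral_FTC_nonneg[where F = A];
        use Nl dA cont limN liml posN in \<open>auto simp: ereal_tendsto_simps\<close>)+
  \<comment> \<open>From \<open>l1\<close> on the base is truncated to 0, and
    \<open>0 powr (s - 1) = 0\<close>, so the half line and the finite interval carry the same
    integrand.\<close>
  have ind: "indicator (einterval (ereal (1/N)) (ereal l1)) x *\<^sub>R ?f x = indicator {1/N<..} x *\<^sub>R ?f x" for x
    using outx[of x] by (cases "x < l1") (auto simp: indicator_def)
  show "set_integrable lborel {1/N<..} ?f"
    using FTC(1) unfolding set_integrable_def ind .
  have "(LINT x:{1/N<..}|lborel. ?f x) = (LBINT x=ereal (1/N)..ereal l1. ?f x)"
    using Nl unfolding interval_lebesgue_integral_def set_lebesgue_integral_def ind by simp
  also have "\<dots> = ?Phi (N - b) + b * (B (N - b) - B0)"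
    unfolding FTC(2) using N by (simp add: A_def algebra_simps)
  finally show "(LINT x:{1/N<..}|lborel. ?f x) = ?Phi (N - b) + b * (B (N - b) - B0)" .
qed


lemma powr_tail_integral:
  fixes s N :: real assumes s: "0 < s" and N: "0 < N"
  shows "set_integrable lborel {1/N<..} (\<lambda>x. x powr (- 1 - 2 * s))"
    and "(LINT x:{1/N<..}|lborel. x powr (- 1 - 2 * s)) = N powr (2 * s) / (2 * s)"
proof -
  let ?A = "\<lambda>x. - (x powr (- 2 * s) / (2 * s))"
  have d: "(?A has_real_derivative x powr (- 1 - 2 * s)) (at x)" if "x > 0" for x
    using that s by (auto intro!: derivative_eq_intros simp: powr_diff powr_add powr_minus field_simps)
  have l0: "(?A \<longlongrightarrow> ?A (1/N)) (at_right (1/N))"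
    using N s by (intro tendsto_intros) auto
  have "(?A \<longlongrightarrow> - (0 / (2 * s))) at_top"
    using s by (intro tendsto_intros tendsto_neg_powr filterlim_ident) auto
  then have l1: "(?A \<longlongrightarrow> 0) at_top" by simp
  have cont: "isCont (\<lambda>x. x powr (- 1 - 2 * s)) x" if "x > 0" for x
    using that by (intro continuous_intros) auto
  have pos: "x > 0" if "1/N < x" for x using that N by (meson divide_pos_pos less_trans zero_less_one)
  have FTC: "set_integrable lborel (einterval (ereal (1/N)) \<infinity>) (\<lambda>x. x powr (- 1 - 2 * s))"
    "(LBINT x=ereal (1/N)..\<infinity>. x powr (- 1 - 2 * s)) = 0 - ?A (1/N)"
    by (rule interval_integral_FTC_nonneg[where F = ?A];
        use d cont l0 l1 pos in \<open>auto simp: ereal_tendsto_simps\<close>)+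
  show "set_integrable lborel {1/N<..} (\<lambda>x. x powr (- 1 - 2 * s))" using FTC(1) by simp
  show "(LINT x:{1/N<..}|lborel. x powr (- 1 - 2 * s)) = N powr (2 * s) / (2 * s)"
    using FTC(2) N s by (simp add: interval_lebesgue_integral_def powr_divide powr_minus_divide)
qed

text \<open>With \<alpha> = r - |p|^2, \<beta> = p . z and \<gamma> = |z|^2 the base is r - |p + x
  z|^2: this is the kernel integral of one truncated power along the ray from p in direction z. The
  cut-off is 1/N, so the principal value is the limit N -> \<infinity>.\<close>

definition line_tail :: "real \<Rightarrow> real \<Rightarrow> real \<Rightarrow> real \<Rightarrow> real \<Rightarrow> real" where
  "line_tail s N \<alpha> \<beta> \<gamma> = (LINT x:{1/N<..}|lborel.
     max 0 (\<alpha> - 2 * \<beta> * x - \<gamma> * x\<^sup>2) powr (s - 1) * x powr (- 1 - 2 * s))"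

text \<open>The first term is twice the tail integral of the value \<alpha>^(s-1) at x = 0, so the
  estimate says that the truncated integral of the second difference of one power is O(N^(2s-2)).
  With X = \<alpha> N^2, the elementary parts combine to a second difference of t^s near X with step
  2 \<beta> N, and the other parts to b (B(N + b) - B(N - b)). The bound is explicit in \<alpha> so
  that it can be integrated over r.\<close>

lemma line_tail_pair:
  fixes s \<alpha> \<beta> \<gamma> N :: real
  assumes s: "0 < s" "s < 1" and \<alpha>: "0 < \<alpha>" and \<gamma>: "0 < \<gamma>" and N: "N > 0"
    and large: "2 * \<bar>\<beta>\<bar> * N + \<gamma> \<le> \<alpha> * N\<^sup>2 / 2"
  shows "set_integrable lborel {1/N<..} (\<lambda>x. max 0 (\<alpha> - 2 * \<beta> * x - \<gamma> * x\<^sup>2) powr (s - 1) * x powr (- 1 - 2 * s))"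
    and "\<bar>\<alpha> powr (s - 1) * N powr (2 * s) / s - line_tail s N \<alpha> \<beta> \<gamma> - line_tail s N \<alpha> (- \<beta>) \<gamma>\<bar>
      \<le> (\<alpha> / 2) powr (s - 1) * N powr (2 * s - 2) *
         ((16 * \<beta>\<^sup>2 / \<alpha> + 2 * \<gamma>) / (2 * s * \<alpha>) + 2 * \<beta>\<^sup>2 / \<alpha>\<^sup>2)"
proof -
  define c where "c = \<gamma> + \<beta>\<^sup>2 / \<alpha>"
  define b where "b = \<beta> / \<alpha>"
  \<comment> \<open>By \<open>large\<close>, every base met below is at least X / 2.
    \<open>Y\<close> is the resulting bound for its power with exponent s - 1, of size
    N^(2s-2).\<close>
  define X where "X = \<alpha> * N\<^sup>2"
  define Y where "Y = (X / 2) powr (s - 1)"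
  have c: "c > 0" using \<alpha> \<gamma> by (simp add: c_def add_pos_nonneg)
  have X: "X > 0" using \<alpha> N by (simp add: X_def)
  obtain B B0 where
    B: "\<And>w. sqrt (c / \<alpha>) < w \<Longrightarrow> (B has_real_derivative (\<alpha> * w\<^sup>2 - c) powr (s - 1)) (at w)"
    and B0: "(B \<longlongrightarrow> B0) (at_right (sqrt (c / \<alpha>)))"
    using antiderivative_with_limit[OF s(1) \<alpha> c] by blast
  have quad: "\<alpha> * (N - t * b)\<^sup>2 - c = X - 2 * t * \<beta> * N - \<gamma> + (t\<^sup>2 - 1) * \<beta>\<^sup>2 / \<alpha>" for t
    using \<alpha> by (simp add: c_def b_def X_def field_simps power2_eq_square)
  have bN: "4 * \<bar>b\<bar> \<le> N"
  proof -
    have "4 * \<bar>\<beta>\<bar> * N \<le> \<alpha> * N * N" using large \<gamma> by (simp add: power2_eq_square)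
    then have "4 * \<bar>\<beta>\<bar> \<le> \<alpha> * N" using N by simp
    then show ?thesis using \<alpha> by (simp add: b_def abs_divide field_simps)
  qed
  have low0: "X / 2 \<le> \<alpha> * (N - \<bar>b\<bar>)\<^sup>2 - c"
  proof -
    have 1: "\<alpha> * \<bar>b\<bar> = \<bar>\<beta>\<bar>" using \<alpha> by (simp add: b_def)
    have 2: "\<alpha> * b\<^sup>2 = \<beta>\<^sup>2 / \<alpha>" using \<alpha> by (simp add: b_def power2_eq_square)
    have "\<alpha> * (N - \<bar>b\<bar>)\<^sup>2 - c = X - 2 * (\<alpha> * \<bar>b\<bar>) * N + \<alpha> * b\<^sup>2 - c"
      by (simp add: X_def power2_diff algebra_simps)
    then have "\<alpha> * (N - \<bar>b\<bar>)\<^sup>2 - c = X - 2 * \<bar>\<beta>\<bar> * N - \<gamma>"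
      unfolding 1 2 by (simp add: c_def)
    then show ?thesis using large by (simp add: X_def)
  qed
  have low: "X / 2 \<le> \<alpha> * w\<^sup>2 - c" "sqrt (c / \<alpha>) < w" if "N - \<bar>b\<bar> \<le> w" for w
  proof -
    have "0 \<le> N - \<bar>b\<bar>" using bN by linarith
    then have "(N - \<bar>b\<bar>)\<^sup>2 \<le> w\<^sup>2" using that by (intro power_mono) auto
    then show *: "X / 2 \<le> \<alpha> * w\<^sup>2 - c" using low0 mult_left_mono[of "(N - \<bar>b\<bar>)\<^sup>2" "w\<^sup>2" \<alpha>] \<alpha> by linarith
    have "c / \<alpha> < w\<^sup>2" using * X \<alpha> by (simp add: field_simps)
    moreover have "w > 0" using that bN N by linarith
    ultimately show "sqrt (c / \<alpha>) < w" by (intro real_less_lsqrt) auto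
  qed
  have w1: "sqrt (c / \<alpha>) < N - b" and w2: "sqrt (c / \<alpha>) < N + b" by (rule low(2); linarith)+
  have half1: "set_integrable lborel {1/N<..} (\<lambda>x. max 0 (\<alpha> - 2 * \<beta> * x - \<gamma> * x\<^sup>2) powr (s - 1) * x powr (- 1 - 2 * s))"
    "line_tail s N \<alpha> \<beta> \<gamma> = (\<alpha> * (N - b)\<^sup>2 - c) powr s / (2 * s * \<alpha>) + b * (B (N - b) - B0)"
    unfolding line_tail_def
    using half_line_integral[OF s(1) \<alpha> \<gamma> N, of \<beta> B B0] w1 B B0 unfolding c_def b_def by blast+
  \<comment> \<open>\<open>c\<close> depends on \<beta> only through its square, so the same
    \<open>B\<close> and \<open>B0\<close> serve for - \<beta>, while b changes sign. In the sum of
    both tails \<open>B0\<close> cancels.\<close>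
  have half2: "line_tail s N \<alpha> (- \<beta>) \<gamma> = (\<alpha> * (N + b)\<^sup>2 - c) powr s / (2 * s * \<alpha>) - b * (B (N + b) - B0)"
    unfolding line_tail_def
    using half_line_integral(2)[OF s(1) \<alpha> \<gamma> N, of "- \<beta>" B B0] w2 B B0 unfolding c_def b_def by simp
  show "set_integrable lborel {1/N<..} (\<lambda>x. max 0 (\<alpha> - 2 * \<beta> * x - \<gamma> * x\<^sup>2) powr (s - 1) * x powr (- 1 - 2 * s))"
    by (rule half1)
  have Y: "Y \<ge> 0" by (simp add: Y_def)
  have Bdiff: "\<bar>B (N + b) - B (N - b)\<bar> \<le> Y * (2 * \<bar>b\<bar>)"
  proof -
    have "norm (B (N + b) - B (N - b)) \<le> Y * norm ((N + b) - (N - b))"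
    proof (rule field_differentiable_bound[where S = "{N - \<bar>b\<bar>..N + \<bar>b\<bar>}" and f = B
          and f' = "\<lambda>w. (\<alpha> * w\<^sup>2 - c) powr (s - 1)"])
      fix w assume "w \<in> {N - \<bar>b\<bar>..N + \<bar>b\<bar>}"
      then have w: "N - \<bar>b\<bar> \<le> w" by simp
      show "(B has_field_derivative (\<alpha> * w\<^sup>2 - c) powr (s - 1)) (at w within {N - \<bar>b\<bar>..N + \<bar>b\<bar>})"
        by (rule has_field_derivative_at_within) (rule B[OF low(2)[OF w]])
      show "norm ((\<alpha> * w\<^sup>2 - c) powr (s - 1)) \<le> Y"
        using low(1)[OF w] X s unfolding Y_def by (simp add: powr_mono2')
    qed auto
    then show ?thesis by simp
  qed
  \<comment> \<open>Second difference of t^s at X - \<gamma>, where |s (s - 1)| <= 1 bounds the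
    coefficient of the second derivative. Moving the centre back to X is done in
    \<open>psm\<close>.\<close>
  have psd: "\<bar>2 * (X - \<gamma>) powr s - (X - \<gamma> + 2 * \<beta> * N) powr s - (X - \<gamma> - 2 * \<beta> * N) powr s\<bar>
     \<le> 2 * (X / 2) powr (s - 2) * (2 * \<beta> * N)\<^sup>2"
  proof (rule second_difference_bound[where f = "\<lambda>x. x powr s" and f' = "\<lambda>x. s * x powr (s - 1)"
        and f'' = "\<lambda>x. s * ((s - 1) * x powr (s - 2))"])
    fix x assume x: "\<bar>x - (X - \<gamma>)\<bar> \<le> \<bar>2 * \<beta> * N\<bar>"
    have "\<bar>2 * \<beta> * N\<bar> = 2 * \<bar>\<beta>\<bar> * N" using N by (simp add: abs_mult)
    then have x2: "X / 2 \<le> x" using x large by (simp add: X_def)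
    then have x0: "x > 0" using X by simp
    show "((\<lambda>x. x powr s) has_real_derivative s * x powr (s - 1)) (at x)"
      using x0 by (auto intro!: derivative_eq_intros)
    show "((\<lambda>x. s * x powr (s - 1)) has_real_derivative s * ((s - 1) * x powr (s - 2))) (at x)"
      using x0 by (auto intro!: derivative_eq_intros)
    have "\<bar>s * ((s - 1) * x powr (s - 2))\<bar> = (s * (1 - s)) * x powr (s - 2)"
      using s by (simp add: abs_mult)
    also have "\<dots> \<le> 1 * (X / 2) powr (s - 2)"
      using s x2 X by (intro mult_mono powr_mono2') (auto simp: mult_le_one)
    finally show "\<bar>s * ((s - 1) * x powr (s - 2))\<bar> \<le> (X / 2) powr (s - 2)" by simp
  qed
  have psm: "\<bar>X powr s - (X - \<gamma>) powr s\<bar> \<le> Y * \<gamma>"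
  proof -
    have g: "\<gamma> \<le> X / 2"
    proof -
      have "0 \<le> 2 * \<bar>\<beta>\<bar> * N" using N by simp
      then show ?thesis using large unfolding X_def by linarith
    qed
    have "norm (X powr s - (X - \<gamma>) powr s) \<le> Y * norm (X - (X - \<gamma>))"
    proof (rule field_differentiable_bound[where S = "{X - \<gamma>..X}" and f = "\<lambda>x. x powr s"
          and f' = "\<lambda>x. s * x powr (s - 1)"])
      fix x assume "x \<in> {X - \<gamma>..X}"
      then have x2: "X / 2 \<le> x" using g by auto
      then have x0: "x > 0" using X by simp
      show "((\<lambda>x. x powr s) has_field_derivative s * x powr (s - 1)) (at x within {X - \<gamma>..X})"
        using x0 by (auto intro!: derivative_eq_intros)
      have "s * x powr (s - 1) \<le> 1 * (X / 2) powr (s - 1)"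
        using s x2 X by (intro mult_mono powr_mono2') auto
      then show "norm (s * x powr (s - 1)) \<le> Y" using s by (simp add: Y_def abs_mult)
    qed (use \<gamma> in auto)
    then show ?thesis using \<gamma> by simp
  qed
  have X2: "(X / 2) powr (s - 2) * N\<^sup>2 = Y * 2 / \<alpha>"
  proof -
    have "(X / 2) powr (s - 2) = Y / (X / 2) powr 1" unfolding Y_def powr_diff[symmetric] by simp
    then show ?thesis using X \<alpha> N by (simp add: X_def field_simps)
  qed
  have Xs: "\<alpha> powr (s - 1) * N powr (2 * s) / s = 2 * X powr s / (2 * s * \<alpha>)"
  proof -
    have "X powr s = \<alpha> powr s * N powr (2 * s)"
      using \<alpha> N by (simp add: X_def powr_mult powr_powr flip: powr_numeral)
    then show ?thesis using \<alpha> s by (simp add: powr_diff)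
  qed
  have q1: "\<alpha> * (N - b)\<^sup>2 - c = X - \<gamma> - 2 * \<beta> * N" using quad[of 1] by simp
  have q2: "\<alpha> * (N + b)\<^sup>2 - c = X - \<gamma> + 2 * \<beta> * N" using quad[of "- 1"] by simp
  define P where "P = 2 * X powr s - (X - \<gamma> + 2 * \<beta> * N) powr s - (X - \<gamma> - 2 * \<beta> * N) powr s"
  have "\<bar>P\<bar> \<le> 2 * (X / 2) powr (s - 2) * (2 * \<beta> * N)\<^sup>2 + 2 * (Y * \<gamma>)"
    using psd psm unfolding P_def by linarith
  also have "2 * (X / 2) powr (s - 2) * (2 * \<beta> * N)\<^sup>2 = 8 * \<beta>\<^sup>2 * ((X / 2) powr (s - 2) * N\<^sup>2)"
    by (simp add: power_mult_distrib)
  finally have P: "\<bar>P\<bar> \<le> Y * (16 * \<beta>\<^sup>2 / \<alpha> + 2 * \<gamma>)" unfolding X2 by (simp add: algebra_simps)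
  have "\<alpha> powr (s - 1) * N powr (2 * s) / s - line_tail s N \<alpha> \<beta> \<gamma> - line_tail s N \<alpha> (- \<beta>) \<gamma>
    = P / (2 * s * \<alpha>) + b * (B (N + b) - B (N - b))"
    unfolding Xs half1(2) half2 q1 q2 P_def by (simp add: algebra_simps diff_divide_distrib add_divide_distrib)
  also have "\<bar>\<dots>\<bar> \<le> \<bar>P\<bar> / (2 * s * \<alpha>) + \<bar>b\<bar> * \<bar>B (N + b) - B (N - b)\<bar>"
    using s \<alpha> by (intro order_trans[OF abs_triangle_ineq]) (simp add: abs_mult)
  also have "\<dots> \<le> Y * (16 * \<beta>\<^sup>2 / \<alpha> + 2 * \<gamma>) / (2 * s * \<alpha>) + \<bar>b\<bar> * (Y * (2 * \<bar>b\<bar>))"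
    using s \<alpha> by (intro add_mono divide_right_mono mult_left_mono P Bdiff) auto
  also have "\<bar>b\<bar> * (Y * (2 * \<bar>b\<bar>)) = Y * (2 * b\<^sup>2)" by (simp add: power2_eq_square abs_mult_self_eq)
  also have "b\<^sup>2 = \<beta>\<^sup>2 / \<alpha>\<^sup>2" by (simp add: b_def power_divide)
  finally have fin: "\<bar>\<alpha> powr (s - 1) * N powr (2 * s) / s - line_tail s N \<alpha> \<beta> \<gamma> - line_tail s N \<alpha> (- \<beta>) \<gamma>\<bar>
      \<le> Y * ((16 * \<beta>\<^sup>2 / \<alpha> + 2 * \<gamma>) / (2 * s * \<alpha>) + 2 * \<beta>\<^sup>2 / \<alpha>\<^sup>2)"
    by (simp add: algebra_simps)
  have "Y = ((\<alpha> / 2) * N\<^sup>2) powr (s - 1)" by (simp add: Y_def X_def)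
  also have "\<dots> = (\<alpha> / 2) powr (s - 1) * N powr (2 * s - 2)"
  proof -
    have "(N\<^sup>2) powr (s - 1) = N powr (2 * s - 2)"
      using N by (simp flip: powr_numeral add: powr_powr algebra_simps)
    moreover have "((\<alpha> / 2) * N\<^sup>2) powr (s - 1) = (\<alpha> / 2) powr (s - 1) * (N\<^sup>2) powr (s - 1)"
      by (rule powr_mult)
    ultimately show ?thesis by simp
  qed
  finally show "\<bar>\<alpha> powr (s - 1) * N powr (2 * s) / s - line_tail s N \<alpha> \<beta> \<gamma> - line_tail s N \<alpha> (- \<beta>) \<gamma>\<bar>
      \<le> (\<alpha> / 2) powr (s - 1) * N powr (2 * s - 2) *
         ((16 * \<beta>\<^sup>2 / \<alpha> + 2 * \<gamma>) / (2 * s * \<alpha>) + 2 * \<beta>\<^sup>2 / \<alpha>\<^sup>2)"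
    using fin by simp
qed

text \<open>The weight of a bounded second difference along a ray: integrability near 0 uses s < 1,
  integrability at infinity uses s > 0.\<close>

lemma min_weight_integrable:
  fixes s :: real assumes s: "0 < s" "s < 1"
  shows "integrable lborel (\<lambda>x. indicator {0<..} x * (min 1 (x\<^sup>2) * x powr (- 1 - 2 * s)))"
proof (rule Bochner_Integration.integrable_bound)
  show "integrable lborel (\<lambda>x. indicator {0..1} x *\<^sub>R x powr ((2 - 2 * s) - 1)
      + indicator {1/1<..} x *\<^sub>R x powr (- 1 - 2 * s))"
    using powr_set_integrable(1)[of "2 - 2 * s" 1] powr_tail_integral(1)[of s 1] s
    unfolding set_integrable_def by (intro Bochner_Integration.integrable_add) auto
  show "AE x in lborel. norm (indicator {0<..} x * (min 1 (x\<^sup>2) * x powr (- 1 - 2 * s)))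
     \<le> norm (indicator {0..1} x *\<^sub>R x powr ((2 - 2 * s) - 1) + indicator {1/1<..} x *\<^sub>R x powr (- 1 - 2 * s))"
  proof (rule AE_I2)
    fix x :: real
    have "min 1 (x\<^sup>2) * x powr (- 1 - 2 * s) \<le> x powr (1 - 2 * s)" if "0 < x" "x \<le> 1"
    proof -
      have "min 1 (x\<^sup>2) * x powr (- 1 - 2 * s) \<le> x\<^sup>2 * x powr (- 1 - 2 * s)"
        by (intro mult_right_mono) auto
      also have "\<dots> = x powr (1 - 2 * s)" using that by (simp flip: powr_numeral powr_add)
      finally show ?thesis .
    qed
    moreover have "min 1 (x\<^sup>2) * x powr (- 1 - 2 * s) \<le> x powr (- 1 - 2 * s)"
      using mult_right_mono[of "min 1 (x\<^sup>2)" 1 "x powr (- 1 - 2 * s)"] by simp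
    ultimately show "norm (indicator {0<..} x * (min 1 (x\<^sup>2) * x powr (- 1 - 2 * s)))
     \<le> norm (indicator {0..1} x *\<^sub>R x powr ((2 - 2 * s) - 1) + indicator {1/1<..} x *\<^sub>R x powr (- 1 - 2 * s))"
      by (auto simp: indicator_def abs_mult)
  qed
qed auto

section \<open>The line integral of an averaged profile\<close>

lemma psi_abs_bound:
  assumes s: "0 < s" and M: "\<And>r. \<bar>g r\<bar> \<le> M" and z: "\<And>r. r > B \<Longrightarrow> g r = 0"
    and [measurable]: "g \<in> borel_measurable borel" and q: "0 \<le> q" and B: "0 \<le> B"
  shows "psi s (\<lambda>r. \<bar>g r\<bar>) q \<le> M * (B powr s / s)"
proof -
  have M0: "0 \<le> M" by (rule order_trans[OF abs_ge_zero M])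
  have "psi s (\<lambda>r. \<bar>g r\<bar>) q \<le> (\<integral>t. M * (indicator {0..B} t * t powr (s - 1)) \<partial>lborel)"
    unfolding psi_shift
  proof (rule integral_mono)
    show "integrable lborel (\<lambda>t. \<bar>g (q + t)\<bar> * max 0 t powr (s - 1))"
      by (rule psi_integrable(1)[OF s, where M = M and B = B]) (use M z in auto)
    show "integrable lborel (\<lambda>t. M * (indicator {0..B} t * t powr (s - 1)))"
      by (intro integrable_mult_right wt_integrable s)
    fix t
    show "\<bar>g (q + t)\<bar> * max 0 t powr (s - 1) \<le> M * (indicator {0..B} t * t powr (s - 1))"
      using M[of "q + t"] z[of "q + t"] q M0 by (auto simp: indicator_def max_def intro!: mult_right_mono)
  qed
  also have "\<dots> = M * (B powr s / s)"
    using powr_set_integrable(2)[OF s B] by (simp add: set_lebesgue_integral_def)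
  finally show ?thesis .
qed

text \<open>Exchanges the average over r with the integral along the ray, so that the evaluation for
  a single r applies. The cut-off keeps the weight integrable, and nonnegativity of the quadratic
  makes the bound of \<open>psi_abs_bound\<close> uniform along the ray.\<close>

lemma psi_line_Fubini:
  fixes a \<beta> \<gamma> :: real
  assumes s: "0 < s" and g: "smooth_supp q1 q2 g" and N: "0 < N"
    and nonneg: "\<And>x. 0 \<le> a + 2 * \<beta> * x + \<gamma> * x\<^sup>2" and q2: "0 \<le> q2"
  shows "set_integrable lborel {1/N<..} (\<lambda>x. psi s g (a + 2 * \<beta> * x + \<gamma> * x\<^sup>2) * x powr (- 1 - 2 * s))"
    and "integrable lborel (\<lambda>r. g r * line_tail s N (r - a) \<beta> \<gamma>)"
    and "(LINT x:{1/N<..}|lborel. psi s g (a + 2 * \<beta> * x + \<gamma> * x\<^sup>2) * x powr (- 1 - 2 * s))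
      = (\<integral>r. g r * line_tail s N (r - a) \<beta> \<gamma> \<partial>lborel)"
proof -
  define K where "K = (\<lambda>(x, r). (indicator {1/N<..} x * x powr (- 1 - 2 * s)) *
      (g r * max 0 (r - (a + 2 * \<beta> * x + \<gamma> * x\<^sup>2)) powr (s - 1)))"
  obtain M where M: "\<And>x. \<bar>g x\<bar> \<le> M" using smooth_supp_bounded[OF g] by blast
  have z: "r > q2 \<Longrightarrow> g r = 0" for r using g by (auto simp: smooth_supp_def)
  have [measurable]: "g \<in> borel_measurable borel" using g by (rule smooth_supp_borel)
  have Km: "K \<in> borel_measurable (lborel \<Otimes>\<^sub>M lborel)" unfolding K_def by measurable
  have in_r: "(\<integral>r. K (x, r) \<partial>lborel) = indicator {1/N<..} x *\<^sub>R (psi s g (a + 2 * \<beta> * x + \<gamma> * x\<^sup>2) * x powr (- 1 - 2 * s))" for x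
    unfolding K_def psi_def by (simp add: mult.commute)
  have in_rn: "(\<integral>r. norm (K (x, r)) \<partial>lborel)
     = (indicator {1/N<..} x * x powr (- 1 - 2 * s)) * psi s (\<lambda>r. \<bar>g r\<bar>) (a + 2 * \<beta> * x + \<gamma> * x\<^sup>2)" for x
    unfolding K_def psi_def by (simp add: abs_mult indicator_def)
  have in_x: "(\<integral>x. K (x, r) \<partial>lborel) = g r * line_tail s N (r - a) \<beta> \<gamma>" for r
  proof -
    have "K (x, r) = g r * (indicator {1/N<..} x *\<^sub>R (max 0 (r - a - 2 * \<beta> * x - \<gamma> * x\<^sup>2) powr (s - 1) * x powr (- 1 - 2 * s)))" for x
      by (simp add: K_def algebra_simps)
    then show ?thesis by (simp add: line_tail_def set_lebesgue_integral_def)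
  qed
  have psi_nn: "0 \<le> psi s (\<lambda>r. \<bar>g r\<bar>) q" for q
    unfolding psi_def by (intro integral_nonneg_AE) auto
  have int: "integrable (lborel \<Otimes>\<^sub>M lborel) K"
  proof (rule lborel_pair.Fubini_integrable[OF Km])
    show "AE x in lborel. integrable lborel (\<lambda>r. K (x, r))"
      unfolding K_def by (auto intro!: smooth_supp_psi_integrable(2)[OF s g])
    show "integrable lborel (\<lambda>x. \<integral>r. norm (K (x, r)) \<partial>lborel)"
    proof (rule Bochner_Integration.integrable_bound)
      show "integrable lborel (\<lambda>x. (M * (q2 powr s / s)) * (indicator {1/N<..} x *\<^sub>R x powr (- 1 - 2 * s)))"
        using powr_tail_integral(1)[OF s N] unfolding set_integrable_def by (rule integrable_mult_right)
      show "(\<lambda>x. \<integral>r. norm (K (x, r)) \<partial>lborel) \<in> borel_measurable lborel"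
        using Km by (intro lborel.borel_measurable_lebesgue_integral) (simp add: case_prod_unfold)
      show "AE x in lborel. norm (\<integral>r. norm (K (x, r)) \<partial>lborel) \<le>
          norm ((M * (q2 powr s / s)) * (indicator {1/N<..} x *\<^sub>R x powr (- 1 - 2 * s)))"
      proof (rule AE_I2)
        fix x
        have "psi s (\<lambda>r. \<bar>g r\<bar>) (a + 2 * \<beta> * x + \<gamma> * x\<^sup>2) \<le> M * (q2 powr s / s)"
          by (rule psi_abs_bound[OF s M z]) (use nonneg q2 in auto)
        then show "norm (\<integral>r. norm (K (x, r)) \<partial>lborel) \<le>
          norm ((M * (q2 powr s / s)) * (indicator {1/N<..} x *\<^sub>R x powr (- 1 - 2 * s)))"
        proof -
          have gen: "norm ((i * w) * p) \<le> norm (K * (i *\<^sub>R w))" if "0 \<le> p" "p \<le> K" for i w p K :: real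
            using mult_right_mono[of p K "\<bar>i * w\<bar>"] that by (simp add: abs_mult mult.commute mult.left_commute)
          assume "psi s (\<lambda>r. \<bar>g r\<bar>) (a + 2 * \<beta> * x + \<gamma> * x\<^sup>2) \<le> M * (q2 powr s / s)"
          with psi_nn show ?thesis unfolding in_rn by (rule gen)
        qed
      qed
    qed
  qed
  have int': "integrable (lborel \<Otimes>\<^sub>M lborel) (case_prod (\<lambda>x r. K (x, r)))" using int by (simp add: case_prod_unfold)
  show "set_integrable lborel {1/N<..} (\<lambda>x. psi s g (a + 2 * \<beta> * x + \<gamma> * x\<^sup>2) * x powr (- 1 - 2 * s))"
    unfolding set_integrable_def in_r[symmetric] by (rule lborel_pair.integrable_fst'[OF int])
  show "integrable lborel (\<lambda>r. g r * line_tail s N (r - a) \<beta> \<gamma>)"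
    unfolding in_x[symmetric] by (rule lborel_pair.integrable_snd[OF int'])
  show "(LINT x:{1/N<..}|lborel. psi s g (a + 2 * \<beta> * x + \<gamma> * x\<^sup>2) * x powr (- 1 - 2 * s))
      = (\<integral>r. g r * line_tail s N (r - a) \<beta> \<gamma> \<partial>lborel)"
    unfolding set_lebesgue_integral_def in_r[symmetric] in_x[symmetric]
    by (rule lborel_pair.Fubini_integral[OF int', symmetric])
qed

text \<open>On the support of g, \<open>a < q1\<close> keeps \<alpha> = r - a above a positive
  \<alpha>0. The bound of \<open>line_tail_pair\<close> decreases in \<alpha>, so its value at
  \<alpha>0 holds for all r and tends to 0 like N^(2s-2).\<close>

lemma psi_line_limit:
  fixes a \<beta> \<gamma> :: real
  assumes s: "0 < s" "s < 1" and g: "smooth_supp q1 q2 g" and a: "0 \<le> a" "a < q1" "q1 \<le> q2" and \<gamma>: "0 < \<gamma>"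
    and nonneg: "\<And>x. 0 \<le> a + 2 * \<beta> * x + \<gamma> * x\<^sup>2"
  shows "((\<lambda>N. LINT x:{1/N<..}|lborel. (2 * psi s g a - psi s g (a + 2 * \<beta> * x + \<gamma> * x\<^sup>2)
      - psi s g (a - 2 * \<beta> * x + \<gamma> * x\<^sup>2)) * x powr (- 1 - 2 * s)) \<longlongrightarrow> 0) at_top"
proof -
  define \<alpha>0 where "\<alpha>0 = q1 - a"
  have \<alpha>0: "\<alpha>0 > 0" using a by (simp add: \<alpha>0_def)
  define K where "K = (\<alpha>0 / 2) powr (s - 1) * ((16 * \<beta>\<^sup>2 / \<alpha>0 + 2 * \<gamma>) / (2 * s * \<alpha>0) + 2 * \<beta>\<^sup>2 / \<alpha>0\<^sup>2)"
  define I where "I = (\<integral>r. \<bar>g r\<bar> \<partial>lborel)"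
  let ?S = "\<lambda>N. LINT x:{1/N<..}|lborel. (2 * psi s g a - psi s g (a + 2 * \<beta> * x + \<gamma> * x\<^sup>2)
      - psi s g (a - 2 * \<beta> * x + \<gamma> * x\<^sup>2)) * x powr (- 1 - 2 * s)"
  have q2: "q2 \<ge> 0" using a by linarith
  have nonneg': "0 \<le> a + 2 * (- \<beta>) * x + \<gamma> * x\<^sup>2" for x using nonneg[of "- x"] by simp
  have bound: "\<bar>?S N\<bar> \<le> K * I * N powr (2 * s - 2)"
    if N: "N > 0" and large: "2 * \<bar>\<beta>\<bar> * N + \<gamma> \<le> \<alpha>0 * N\<^sup>2 / 2" for N
  proof -
    note F1 = psi_line_Fubini[OF s(1) g N nonneg q2]
    note F2 = psi_line_Fubini[OF s(1) g N nonneg' q2, simplified]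
    note T = powr_tail_integral[OF s(1) N]
    have Ti: "set_integrable lborel {1/N<..} (\<lambda>x. 2 * psi s g a * x powr (- 1 - 2 * s))"
      using T(1) by (rule set_integrable_mult_right)
    have "?S N = (LINT x:{1/N<..}|lborel. 2 * psi s g a * x powr (- 1 - 2 * s)
       - psi s g (a + 2 * \<beta> * x + \<gamma> * x\<^sup>2) * x powr (- 1 - 2 * s)
       - psi s g (a - 2 * \<beta> * x + \<gamma> * x\<^sup>2) * x powr (- 1 - 2 * s))"
      by (simp add: algebra_simps)
    also have "\<dots> = 2 * psi s g a * (N powr (2 * s) / (2 * s))
       - (\<integral>r. g r * line_tail s N (r - a) \<beta> \<gamma> \<partial>lborel) - (\<integral>r. g r * line_tail s N (r - a) (- \<beta>) \<gamma> \<partial>lborel)"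
      using T Ti F1 F2 by (simp add: set_integral_diff)
    also have "2 * psi s g a * (N powr (2 * s) / (2 * s)) =
        (\<integral>r. g r * max 0 (r - a) powr (s - 1) * (N powr (2 * s) / s) \<partial>lborel)"
      by (simp add: psi_def)
    also have "\<dots> - (\<integral>r. g r * line_tail s N (r - a) \<beta> \<gamma> \<partial>lborel) - (\<integral>r. g r * line_tail s N (r - a) (- \<beta>) \<gamma> \<partial>lborel)
       = (\<integral>r. g r * max 0 (r - a) powr (s - 1) * (N powr (2 * s) / s)
            - g r * line_tail s N (r - a) \<beta> \<gamma> - g r * line_tail s N (r - a) (- \<beta>) \<gamma> \<partial>lborel)"
      using F1(2) F2(2) smooth_supp_psi_integrable(2)[OF s(1) g, of a] by simp
    finally have S: "?S N = \<dots>" .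
    have "norm (?S N) \<le> (\<integral>r. (K * N powr (2 * s - 2)) * \<bar>g r\<bar> \<partial>lborel)"
      unfolding S
    proof (rule Bochner_Integration.integral_norm_bound_integral)
      show "integrable lborel (\<lambda>r. g r * max 0 (r - a) powr (s - 1) * (N powr (2 * s) / s)
            - g r * line_tail s N (r - a) \<beta> \<gamma> - g r * line_tail s N (r - a) (- \<beta>) \<gamma>)"
        using F1(2) F2(2) smooth_supp_psi_integrable(2)[OF s(1) g, of a] by simp
      show "integrable lborel (\<lambda>r. (K * N powr (2 * s - 2)) * \<bar>g r\<bar>)" using smooth_supp_integrable[OF g] by simp
      fix r
      show "norm (g r * max 0 (r - a) powr (s - 1) * (N powr (2 * s) / s)
            - g r * line_tail s N (r - a) \<beta> \<gamma> - g r * line_tail s N (r - a) (- \<beta>) \<gamma>)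
         \<le> (K * N powr (2 * s - 2)) * \<bar>g r\<bar>"
      proof (cases "g r = 0")
        case False
        then have "q1 \<le> r" using g by (auto simp: smooth_supp_def)
        then have r: "\<alpha>0 \<le> r - a" by (simp add: \<alpha>0_def)
        then have r0: "r - a > 0" using \<alpha>0 by linarith
        have "\<alpha>0 * N\<^sup>2 / 2 \<le> (r - a) * N\<^sup>2 / 2" using r by (simp add: mult_right_mono)
        with large have large': "2 * \<bar>\<beta>\<bar> * N + \<gamma> \<le> (r - a) * N\<^sup>2 / 2" by linarith
        let ?D = "(r - a) powr (s - 1) * N powr (2 * s) / s
            - line_tail s N (r - a) \<beta> \<gamma> - line_tail s N (r - a) (- \<beta>) \<gamma>"
        have "\<bar>?D\<bar> \<le> ((r - a) / 2) powr (s - 1) * N powr (2 * s - 2) *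
            ((16 * \<beta>\<^sup>2 / (r - a) + 2 * \<gamma>) / (2 * s * (r - a)) + 2 * \<beta>\<^sup>2 / (r - a)\<^sup>2)"
          by (rule line_tail_pair(2)[OF s r0 \<gamma> N large'])
        also have "\<dots> \<le> (\<alpha>0 / 2) powr (s - 1) * N powr (2 * s - 2) *
            ((16 * \<beta>\<^sup>2 / \<alpha>0 + 2 * \<gamma>) / (2 * s * \<alpha>0) + 2 * \<beta>\<^sup>2 / \<alpha>0\<^sup>2)"
        proof -
          have h1: "((r - a) / 2) powr (s - 1) \<le> (\<alpha>0 / 2) powr (s - 1)"
            using r \<alpha>0 s by (intro powr_mono2') auto
          have h2: "16 * \<beta>\<^sup>2 / (r - a) \<le> 16 * \<beta>\<^sup>2 / \<alpha>0"
            using r \<alpha>0 by (intro frac_le) auto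
          have h3: "(16 * \<beta>\<^sup>2 / (r - a) + 2 * \<gamma>) / (2 * s * (r - a)) \<le> (16 * \<beta>\<^sup>2 / \<alpha>0 + 2 * \<gamma>) / (2 * s * \<alpha>0)"
            using r r0 \<alpha>0 s \<gamma> h2 by (intro frac_le) auto
          have "\<alpha>0\<^sup>2 \<le> (r - a)\<^sup>2" using r \<alpha>0 by (intro power_mono) auto
          then have h4: "2 * \<beta>\<^sup>2 / (r - a)\<^sup>2 \<le> 2 * \<beta>\<^sup>2 / \<alpha>0\<^sup>2"
            using \<alpha>0 by (intro frac_le) auto
          show ?thesis using h1 h3 h4 r0 s \<gamma> by (intro mult_mono add_mono) auto
        qed
        also have "\<dots> = K * N powr (2 * s - 2)" by (simp add: K_def algebra_simps)
        finally have D: "\<bar>?D\<bar> \<le> K * N powr (2 * s - 2)" .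
        have "g r * max 0 (r - a) powr (s - 1) * (N powr (2 * s) / s)
            - g r * line_tail s N (r - a) \<beta> \<gamma> - g r * line_tail s N (r - a) (- \<beta>) \<gamma> = g r * ?D"
          using r0 by (simp add: algebra_simps)
        then have "norm (g r * max 0 (r - a) powr (s - 1) * (N powr (2 * s) / s)
            - g r * line_tail s N (r - a) \<beta> \<gamma> - g r * line_tail s N (r - a) (- \<beta>) \<gamma>) = \<bar>?D\<bar> * \<bar>g r\<bar>"
          by (simp add: abs_mult)
        then show ?thesis using mult_right_mono[OF D, of "\<bar>g r\<bar>"] by simp
      qed simp
    qed
    then show ?thesis by (simp add: I_def algebra_simps)
  qed
  have "((\<lambda>N. K * I * N powr (2 * s - 2)) \<longlongrightarrow> K * I * 0) at_top"
    using s by (intro tendsto_intros tendsto_neg_powr filterlim_ident) auto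
  then have lim: "((\<lambda>N. K * I * N powr (2 * s - 2)) \<longlongrightarrow> 0) at_top" by simp
  show ?thesis
  proof (rule Lim_null_comparison[OF _ lim])
    show "\<forall>\<^sub>F N in at_top. norm (?S N) \<le> K * I * N powr (2 * s - 2)"
      \<comment> \<open>The fraction makes (4 |\<beta>| + 2 \<gamma>) N <= \<alpha>0 N^2; the
        summand 1 gives N >= 1 and hence \<gamma> <= \<gamma> N. Together these yield the hypothesis
        of \<open>bound\<close>.\<close>
      using eventually_ge_at_top[of "1 + (4 * \<bar>\<beta>\<bar> + 2 * \<gamma>) / \<alpha>0"]
    proof eventually_elim
      case (elim N)
      have N1: "N \<ge> 1" using elim \<alpha>0 \<gamma> by (smt (verit) divide_nonneg_pos mult_nonneg_nonneg abs_ge_zero)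
      have "(4 * \<bar>\<beta>\<bar> + 2 * \<gamma>) / \<alpha>0 \<le> N" using elim by simp
      then have "4 * \<bar>\<beta>\<bar> + 2 * \<gamma> \<le> \<alpha>0 * N" using \<alpha>0 by (simp add: field_simps)
      then have "(4 * \<bar>\<beta>\<bar> + 2 * \<gamma>) * N \<le> \<alpha>0 * N * N" using N1 by (intro mult_right_mono) auto
      moreover have "2 * \<gamma> \<le> 2 * \<gamma> * N" using N1 \<gamma> by simp
      ultimately have "2 * \<bar>\<beta>\<bar> * N + \<gamma> \<le> \<alpha>0 * N\<^sup>2 / 2" by (simp add: power2_eq_square algebra_simps)
      then show ?case using bound[of N] N1 by simp
    qed
  qed
qed

text \<open>A second difference of order min(1, x^2) makes the integral converge absolutely, so it
  equals the limit of its truncations, which \<open>psi_line_limit\<close> has computed.\<close>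

lemma psi_line_zero:
  fixes a \<beta> \<gamma> :: real
  assumes s: "0 < s" "s < 1" and g: "smooth_supp q1 q2 g" and a: "0 \<le> a" "a < q1" "q1 \<le> q2" and \<gamma>: "0 < \<gamma>"
    and nonneg: "\<And>x. 0 \<le> a + 2 * \<beta> * x + \<gamma> * x\<^sup>2"
    and bd: "\<And>x. \<bar>2 * psi s g a - psi s g (a + 2 * \<beta> * x + \<gamma> * x\<^sup>2) - psi s g (a - 2 * \<beta> * x + \<gamma> * x\<^sup>2)\<bar>
        \<le> C * min 1 (x\<^sup>2)"
  shows "set_integrable lborel {0<..} (\<lambda>x. (2 * psi s g a - psi s g (a + 2 * \<beta> * x + \<gamma> * x\<^sup>2)
      - psi s g (a - 2 * \<beta> * x + \<gamma> * x\<^sup>2)) * x powr (- 1 - 2 * s))" (is "set_integrable _ _ ?f")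
    and "(LINT x:{0<..}|lborel. (2 * psi s g a - psi s g (a + 2 * \<beta> * x + \<gamma> * x\<^sup>2)
      - psi s g (a - 2 * \<beta> * x + \<gamma> * x\<^sup>2)) * x powr (- 1 - 2 * s)) = 0"
proof -
  have [measurable]: "psi s g \<in> borel_measurable borel" by (rule smooth_real_borel[OF smooth_real_psi[OF s(1) g]])
  let ?w = "\<lambda>x. C * (indicator {0<..} x * (min 1 (x\<^sup>2) * x powr (- 1 - 2 * s)))"
  have w: "integrable lborel ?w" by (intro integrable_mult_right min_weight_integrable s)
  have b: "\<bar>?f x\<bar> \<le> C * (min 1 (x\<^sup>2) * x powr (- 1 - 2 * s))" for x
    unfolding abs_mult using mult_right_mono[OF bd[of x], of "x powr (- 1 - 2 * s)"] by simp
  show 1: "set_integrable lborel {0<..} ?f"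
    unfolding set_integrable_def
  proof (rule Bochner_Integration.integrable_bound[OF w])
    show "AE x in lborel. norm (indicator {0<..} x *\<^sub>R ?f x) \<le> norm (?w x)"
      using b by (intro AE_I2) (auto simp: indicator_def intro: order_trans[OF _ abs_ge_self])
  qed measurable
  have "(\<lambda>N. LINT x:{1/real N<..}|lborel. ?f x) \<longlonglongrightarrow> (LINT x:{0<..}|lborel. ?f x)"
    unfolding set_lebesgue_integral_def
  proof (rule integral_dominated_convergence[OF _ _ w])
    show "AE x in lborel. norm (indicator {1/real N<..} x *\<^sub>R ?f x) \<le> ?w x" for N
    proof (rule AE_I2)
      fix x
      \<comment> \<open>This includes N = 0, where 1 / 0 = 0.\<close>
      have "1 / real N < x \<Longrightarrow> 0 < x" by (rule le_less_trans[rotated]) auto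
      then show "norm (indicator {1/real N<..} x *\<^sub>R ?f x) \<le> ?w x"
        using b[of x] order_trans[OF abs_ge_zero b[of x]] by (auto simp: indicator_def)
    qed
    show "AE x in lborel. (\<lambda>N. indicator {1/real N<..} x *\<^sub>R ?f x) \<longlonglongrightarrow> indicator {0<..} x *\<^sub>R ?f x"
    proof (rule AE_I2)
      fix x :: real
      have "\<forall>\<^sub>F N in sequentially. (indicator {1/real N<..} x :: real) = indicator {0<..} x"
      proof (cases "x > 0")
        case True
        have "\<forall>\<^sub>F N in sequentially. 1 / real N < x"
          using order_tendstoD(2)[OF lim_1_over_n True] by (simp add: divide_inverse)
        then show ?thesis by (rule eventually_mono) (use True in \<open>auto simp: indicator_def\<close>)
      next
        case False
        have "\<not> 1 / real N < x" for N using False by (smt (verit) of_nat_0_le_iff divide_nonneg_nonneg)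
        then show ?thesis using False by (auto simp: indicator_def)
      qed
      then show "(\<lambda>N. indicator {1/real N<..} x *\<^sub>R ?f x) \<longlonglongrightarrow> indicator {0<..} x *\<^sub>R ?f x"
        by (intro tendsto_eventually) (auto elim: eventually_mono)
    qed
  qed measurable
  moreover have "(\<lambda>N. LINT x:{1/real N<..}|lborel. ?f x) \<longlonglongrightarrow> 0"
    by (rule filterlim_compose[OF psi_line_limit[OF s g a \<gamma> nonneg] filterlim_real_sequentially])
  ultimately show "(LINT x:{0<..}|lborel. ?f x) = 0" by (rule LIMSEQ_unique)
qed

subsection \<open>Reduction to rays\<close>

definition shell :: "(real^'n::finite) set" where "shell = {z. 1 \<le> norm z \<and> norm z \<le> 2}"

lemma nn_integral_lborel_scale:
  fixes f :: "'a::euclidean_space \<Rightarrow> ennreal"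
  assumes [measurable]: "f \<in> borel_measurable borel" and c: "0 < c"
  shows "(\<integral>\<^sup>+y. f y \<partial>lborel) = ennreal (c ^ DIM('a)) * (\<integral>\<^sup>+z. f (c *\<^sub>R z) \<partial>lborel)"
  using c by (subst lborel_affine[of c 0]) (simp_all add: nn_integral_density nn_integral_distr nn_integral_cmult ennreal_power)

lemma nn_integral_inverse_Icc:
  assumes "0 < a"
  shows "(\<integral>\<^sup>+x. ennreal (1 / x) * indicator {a/2..a} x \<partial>lborel) = ennreal (ln 2)"
proof -
  have "(\<integral>\<^sup>+x. ennreal (1 / x) * indicator {a/2..a} x \<partial>lborel) = ennreal (ln a - ln (a / 2))"
    using assms by (intro nn_integral_FTC_Icc) (auto intro!: derivative_eq_intros)
  then show ?thesis using assms by (simp add: ln_div)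
qed

text \<open>Integration in polar coordinates, with the unit sphere replaced by a shell; this avoids
  surface measures. The constant \<open>ln 2\<close> is the logarithmic thickness of the shell.\<close>

lemma nn_integral_shell:
  fixes F :: "real^'n::finite \<Rightarrow> ennreal" and s :: real
  defines "m \<equiv> real CARD('n) + 2 * s"
  assumes [measurable]: "F \<in> borel_measurable borel"
  shows "(\<integral>\<^sup>+y. F y * ennreal (norm y powr (- m)) \<partial>lborel) * ennreal (ln 2) =
    (\<integral>\<^sup>+z. indicator shell z * ennreal (norm z powr (- m)) *
       (\<integral>\<^sup>+x. F (x *\<^sub>R z) * (indicator {0<..} x * ennreal (x powr (- 1 - 2 * s))) \<partial>lborel) \<partial>lborel)"
proof -
  \<comment> \<open>For y nonzero, y / x lies in the shell iff x lies in [|y|/2, |y|], and dx / x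
    over that interval gives ln 2 for every y. Inserting this factor, exchanging the integrals and
    substituting y = x z separates radius and direction.\<close>
  define G where "G = (\<lambda>(x::real) (y::real^'n).
     indicator {0<..} x * ennreal (1 / x) * (F y * ennreal (norm y powr (- m)) * indicator shell (y /\<^sub>R x)))"
  have [measurable]: "case_prod G \<in> borel_measurable (lborel \<Otimes>\<^sub>M lborel)"
    unfolding G_def shell_def by measurable
  have inx: "(\<integral>\<^sup>+x. G x y \<partial>lborel) = F y * ennreal (norm y powr (- m)) * ennreal (ln 2)" if "y \<noteq> 0" for y
  proof -
    have "G x y = F y * ennreal (norm y powr (- m)) * (ennreal (1 / x) * indicator {norm y / 2..norm y} x)" for x
    proof (cases "x > 0")
      case True
      then have "y /\<^sub>R x \<in> shell \<longleftrightarrow> x \<in> {norm y / 2..norm y}"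
        by (auto simp: shell_def field_simps)
      then show ?thesis using True by (simp add: G_def indicator_def mult.commute)
    next
      case False
      then show ?thesis using that by (auto simp: G_def indicator_def)
    qed
    then show ?thesis using that
      by (simp add: nn_integral_cmult nn_integral_inverse_Icc)
  qed
  have iny: "(\<integral>\<^sup>+y. G x y \<partial>lborel) =
     (\<integral>\<^sup>+z. indicator shell z * ennreal (norm z powr (- m)) *
       (F (x *\<^sub>R z) * (indicator {0<..} x * ennreal (x powr (- 1 - 2 * s)))) \<partial>lborel)" for x
  proof (cases "x > 0")
    case True
    have "(\<integral>\<^sup>+y. G x y \<partial>lborel) = ennreal (x ^ CARD('n)) * (\<integral>\<^sup>+z. G x (x *\<^sub>R z) \<partial>lborel)"
      using True by (subst nn_integral_lborel_scale[where c = x]) (simp_all add: G_def shell_def)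
    also have "\<dots> = (\<integral>\<^sup>+z. ennreal (x ^ CARD('n)) * G x (x *\<^sub>R z) \<partial>lborel)"
      by (rule nn_integral_cmult[symmetric]) (simp add: G_def shell_def)
    also have "\<dots> = (\<integral>\<^sup>+z. indicator shell z * ennreal (norm z powr (- m)) *
       (F (x *\<^sub>R z) * (indicator {0<..} x * ennreal (x powr (- 1 - 2 * s)))) \<partial>lborel)"
    proof (rule nn_integral_cong)
      fix z :: "real^'n"
      \<comment> \<open>The Jacobian contributes n, dx / x contributes - 1 and the kernel - n - 2 s.
        The sum - 1 - 2 s is independent of the dimension.\<close>
      have "x ^ CARD('n) * (1 / x * norm (x *\<^sub>R z) powr (- m)) = norm z powr (- m) * x powr (- 1 - 2 * s)"
      proof -
        have "x ^ CARD('n) * (1 / x * norm (x *\<^sub>R z) powr (- m))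
          = (x powr real CARD('n) * x powr (- 1) * x powr (- m)) * norm z powr (- m)"
          using True by (simp add: powr_realpow powr_mult powr_minus_divide)
        also have "x powr real CARD('n) * x powr (- 1) * x powr (- m) = x powr (- 1 - 2 * s)"
          unfolding powr_add[symmetric] by (rule arg_cong[of _ _ "(powr) x"]) (simp add: m_def)
        finally show ?thesis by simp
      qed
      then have "ennreal (x ^ CARD('n)) * (ennreal (1 / x) * ennreal (norm (x *\<^sub>R z) powr (- m)))
          = ennreal (norm z powr (- m)) * ennreal (x powr (- 1 - 2 * s))"
        using True by (simp flip: ennreal_mult)
      moreover have "x *\<^sub>R z /\<^sub>R x = z" using True by simp
      ultimately show "ennreal (x ^ CARD('n)) * G x (x *\<^sub>R z) = indicator shell z * ennreal (norm z powr (- m)) *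
       (F (x *\<^sub>R z) * (indicator {0<..} x * ennreal (x powr (- 1 - 2 * s))))"
      proof -
        have ac: "a * (b * (f * c)) = d * (f * e)" if "a * (b * c) = d * e" for a b c d e f :: ennreal
        proof -
          have "a * (b * (f * c)) = f * (a * (b * c))" by (simp only: mult.left_commute)
          then show ?thesis unfolding that by (simp only: mult.left_commute)
        qed
        assume eq: "ennreal (x ^ CARD('n)) * (ennreal (1 / x) * ennreal (norm (x *\<^sub>R z) powr (- m)))
          = ennreal (norm z powr (- m)) * ennreal (x powr (- 1 - 2 * s))" and "x *\<^sub>R z /\<^sub>R x = z"
        then show ?thesis
          using True ac[OF eq, of "F (x *\<^sub>R z)"] by (cases "z \<in> shell") (simp_all only: simp_thms G_def prod.case indicator_simps mult_1 mult_1_right mult_zero_right mult_zero_left greaterThan_iff)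
      qed
    qed
    finally show ?thesis .
  qed (simp add: G_def)
  have "(\<integral>\<^sup>+y. F y * ennreal (norm y powr (- m)) \<partial>lborel) * ennreal (ln 2)
     = (\<integral>\<^sup>+y. F y * ennreal (norm y powr (- m)) * ennreal (ln 2) \<partial>lborel)"
    by (rule nn_integral_multc[symmetric]) simp
  also have "\<dots> = (\<integral>\<^sup>+y. \<integral>\<^sup>+x. G x y \<partial>lborel \<partial>lborel)"
    by (intro nn_integral_cong_AE, use AE_lborel_singleton[of 0] in eventually_elim) (simp add: inx)
  also have "\<dots> = (\<integral>\<^sup>+x. \<integral>\<^sup>+y. G x y \<partial>lborel \<partial>lborel)"
    by (rule lborel_pair.Fubini') measurable
  also have "\<dots> = (\<integral>\<^sup>+x. \<integral>\<^sup>+z. indicator shell z * ennreal (norm z powr (- m)) *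
       (F (x *\<^sub>R z) * (indicator {0<..} x * ennreal (x powr (- 1 - 2 * s)))) \<partial>lborel \<partial>lborel)"
    by (simp add: iny)
  also have "\<dots> = (\<integral>\<^sup>+z. \<integral>\<^sup>+x. indicator shell z * ennreal (norm z powr (- m)) *
       (F (x *\<^sub>R z) * (indicator {0<..} x * ennreal (x powr (- 1 - 2 * s)))) \<partial>lborel \<partial>lborel)"
    by (rule lborel_pair.Fubini'[symmetric]) (simp add: shell_def)
  also have "\<dots> = (\<integral>\<^sup>+z. indicator shell z * ennreal (norm z powr (- m)) *
       (\<integral>\<^sup>+x. F (x *\<^sub>R z) * (indicator {0<..} x * ennreal (x powr (- 1 - 2 * s))) \<partial>lborel) \<partial>lborel)"
    by (intro nn_integral_cong nn_integral_cmult) measurable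
  finally show ?thesis .
qed

lemma nn_integral_pos_neg_eq:
  fixes f :: "'a \<Rightarrow> real"
  assumes "integrable M f" "integral\<^sup>L M f = 0"
  shows "(\<integral>\<^sup>+x. ennreal (f x) \<partial>M) = (\<integral>\<^sup>+x. ennreal (- f x) \<partial>M)"
proof -
  have "(\<integral>\<^sup>+x. ennreal (f x) \<partial>M) \<noteq> \<infinity>" "(\<integral>\<^sup>+x. ennreal (- f x) \<partial>M) \<noteq> \<infinity>"
    using assms(1) by (auto simp: real_integrable_def)
  moreover have "enn2real (\<integral>\<^sup>+x. ennreal (f x) \<partial>M) = enn2real (\<integral>\<^sup>+x. ennreal (- f x) \<partial>M)"
    using assms real_lebesgue_integral_def[OF assms(1)] by simp
  ultimately show ?thesis by (metis ennreal_enn2real infinity_ennreal_def top.not_eq_extremum)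
qed

text \<open>The shell formula is about nonnegative integrands. A vanishing ray integral says that
  positive and negative part agree along that ray; by the shell formula they agree over the whole
  space, after cancelling the finite nonzero factor ln 2.\<close>

lemma integral_zero_by_rays:
  fixes F :: "real^'n::finite \<Rightarrow> real" and s :: real
  defines "m \<equiv> real CARD('n) + 2 * s"
  assumes [measurable]: "F \<in> borel_measurable borel"
    and int: "integrable lborel (\<lambda>y. F y * norm y powr (- m))"
    and ray: "\<And>z. z \<noteq> 0 \<Longrightarrow> set_integrable lborel {0<..} (\<lambda>x. F (x *\<^sub>R z) * x powr (- 1 - 2 * s))"
      "\<And>z. z \<noteq> 0 \<Longrightarrow> (LINT x:{0<..}|lborel. F (x *\<^sub>R z) * x powr (- 1 - 2 * s)) = 0"
  shows "(\<integral>y. F y * norm y powr (- m) \<partial>lborel) = 0"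
proof -
  define P where "P = (\<lambda>G :: real^'n \<Rightarrow> real. \<integral>\<^sup>+y. ennreal (G y * norm y powr (- m)) \<partial>lborel)"
  define R where "R = (\<lambda>G :: real^'n \<Rightarrow> real. \<integral>\<^sup>+z. indicator shell z * ennreal (norm z powr (- m)) *
       (\<integral>\<^sup>+x. ennreal (indicator {0<..} x *\<^sub>R (G (x *\<^sub>R z) * x powr (- 1 - 2 * s))) \<partial>lborel) \<partial>lborel)"
  have ind: "ennreal (indicator {0<..} x *\<^sub>R (G * w)) = ennreal G * (indicator {0<..} x * ennreal w)"
    if "w \<ge> 0" for x G w :: real
    using that by (auto simp: indicator_def ennreal_mult'')
  have PR: "P G * ennreal (ln 2) = R G" if "G \<in> borel_measurable borel" for G
    unfolding P_def R_def m_def using nn_integral_shell[of "\<lambda>y. ennreal (G y)" s] that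
    by (simp add: ennreal_mult'' ind del: real_scaleR_def)
  have "R F = R (\<lambda>y. - F y)"
    unfolding R_def
  proof (rule nn_integral_cong)
    fix z :: "real^'n"
    show "indicator shell z * ennreal (norm z powr (- m)) *
       (\<integral>\<^sup>+x. ennreal (indicator {0<..} x *\<^sub>R (F (x *\<^sub>R z) * x powr (- 1 - 2 * s))) \<partial>lborel) =
      indicator shell z * ennreal (norm z powr (- m)) *
       (\<integral>\<^sup>+x. ennreal (indicator {0<..} x *\<^sub>R (- F (x *\<^sub>R z) * x powr (- 1 - 2 * s))) \<partial>lborel)"
    proof (cases "z \<in> shell")
      case True
      then have "z \<noteq> 0" by (auto simp: shell_def)
      from ray[OF this] show ?thesis
        unfolding set_integrable_def set_lebesgue_integral_def
        using nn_integral_pos_neg_eq[of lborel "\<lambda>x. indicator {0<..} x *\<^sub>R (F (x *\<^sub>R z) * x powr (- 1 - 2 * s))"]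
        by simp
    qed simp
  qed
  then have "P F * ennreal (ln 2) = P (\<lambda>y. - F y) * ennreal (ln 2)" by (simp add: PR)
  then have "P F = P (\<lambda>y. - F y)"
    by (simp add: mult.commute[of _ "ennreal (ln 2)"] ennreal_mult_cancel_left)
  then show ?thesis using real_lebesgue_integral_def[OF int] by (simp add: P_def)
qed

text \<open>The shell formula reduces this to \<open>min_weight_integrable\<close>: on the shell the
  power of |z| is at most 1, and |x z|^2 <= 4 x^2 accounts for the factor 4.\<close>

lemma kernel_weight_integrable:
  fixes s :: real
  assumes s: "0 < s" "s < 1"
  shows "integrable lborel (\<lambda>y::real^'n::finite. min 1 ((norm y)\<^sup>2) * norm y powr (- (real CARD('n) + 2 * s)))"
proof (rule integrableI_nonneg)
  let ?m = "real CARD('n) + 2 * s"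
  let ?w = "\<lambda>x::real. indicat_real {0<..} x * (min 1 (x\<^sup>2) * x powr (- 1 - 2 * s))"
  define K where "K = (\<integral>\<^sup>+x. ennreal (?w x) \<partial>lborel)"
  have K: "K < \<infinity>"
    using min_weight_integrable[OF s] unfolding K_def real_integrable_def by (simp add: top.not_eq_extremum)
  have "(\<integral>\<^sup>+(y::real^'n). ennreal (min 1 ((norm y)\<^sup>2)) * ennreal (norm y powr (- ?m)) \<partial>lborel) * ennreal (ln 2)
     = (\<integral>\<^sup>+(z::real^'n). indicator shell z * ennreal (norm z powr (- ?m)) *
       (\<integral>\<^sup>+x. ennreal (min 1 ((norm (x *\<^sub>R z))\<^sup>2)) * (indicator {0<..} x * ennreal (x powr (- 1 - 2 * s))) \<partial>lborel) \<partial>lborel)"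
    by (rule nn_integral_shell) simp
  also have "\<dots> \<le> (\<integral>\<^sup>+(z::real^'n). indicator (cball 0 2) z * (ennreal 4 * K) \<partial>lborel)"
  proof (rule nn_integral_mono)
    fix z :: "real^'n"
    show "indicator shell z * ennreal (norm z powr (- ?m)) *
       (\<integral>\<^sup>+x. ennreal (min 1 ((norm (x *\<^sub>R z))\<^sup>2)) * (indicator {0<..} x * ennreal (x powr (- 1 - 2 * s))) \<partial>lborel)
       \<le> indicator (cball 0 2) z * (ennreal 4 * K)"
    proof (cases "z \<in> shell")
      case True
      then have z: "1 \<le> norm z" "norm z \<le> 2" by (auto simp: shell_def)
      have "norm z powr (- ?m) \<le> norm z powr 0" using z s by (intro powr_mono) auto
      then have 1: "norm z powr (- ?m) \<le> 1" using z by (simp split: if_splits)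
      have "(\<integral>\<^sup>+x. ennreal (min 1 ((norm (x *\<^sub>R z))\<^sup>2)) * (indicator {0<..} x * ennreal (x powr (- 1 - 2 * s))) \<partial>lborel)
         \<le> (\<integral>\<^sup>+x. ennreal 4 * ennreal (?w x) \<partial>lborel)"
      proof (rule nn_integral_mono)
        fix x :: real
        have "(norm z)\<^sup>2 \<le> 2\<^sup>2" using z by (intro power_mono) auto
        then have "x\<^sup>2 * (norm z)\<^sup>2 \<le> x\<^sup>2 * 4" by (intro mult_left_mono) auto
        then have "min 1 ((norm (x *\<^sub>R z))\<^sup>2) \<le> 4 * min 1 (x\<^sup>2)"
          by (simp add: power_mult_distrib min_def)
        then have "min 1 ((norm (x *\<^sub>R z))\<^sup>2) * x powr (- 1 - 2 * s) \<le> (4 * min 1 (x\<^sup>2)) * x powr (- 1 - 2 * s)"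
          by (rule mult_right_mono) simp
        then show "ennreal (min 1 ((norm (x *\<^sub>R z))\<^sup>2)) * (indicator {0<..} x * ennreal (x powr (- 1 - 2 * s)))
           \<le> ennreal 4 * ennreal (?w x)"
        proof -
          assume le: "min 1 ((norm (x *\<^sub>R z))\<^sup>2) * x powr (- 1 - 2 * s) \<le> (4 * min 1 (x\<^sup>2)) * x powr (- 1 - 2 * s)"
          have "ennreal (min 1 ((norm (x *\<^sub>R z))\<^sup>2)) * ennreal (x powr (- 1 - 2 * s))
              = ennreal (min 1 ((norm (x *\<^sub>R z))\<^sup>2) * x powr (- 1 - 2 * s))"
            by (rule ennreal_mult[symmetric]) auto
          also have "\<dots> \<le> ennreal (4 * (min 1 (x\<^sup>2) * x powr (- 1 - 2 * s)))"
            using le by (intro ennreal_leI) (simp only: mult.assoc)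
          also have "\<dots> = ennreal 4 * ennreal (min 1 (x\<^sup>2) * x powr (- 1 - 2 * s))"
            by (rule ennreal_mult) auto
          finally show ?thesis by (cases "x > 0") (simp_all only: indicator_simps greaterThan_iff mult_1 mult_zero_left mult_zero_right simp_thms zero_le)
        qed
      qed
      also have "\<dots> = ennreal 4 * K" unfolding K_def by (rule nn_integral_cmult) measurable
      finally have 2: "(\<integral>\<^sup>+x. ennreal (min 1 ((norm (x *\<^sub>R z))\<^sup>2)) * (indicator {0<..} x * ennreal (x powr (- 1 - 2 * s))) \<partial>lborel)
        \<le> ennreal 4 * K" .
      have "ennreal (norm z powr (- ?m)) \<le> 1" using 1 by (simp add: ennreal_le_1)
      from mult_mono[OF this 2] show ?thesis using True z by (simp add: indicator_def)
    qed simp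
  qed
  also have "\<dots> = emeasure lborel (cball 0 2 :: (real^'n) set) * (ennreal 4 * K)"
  proof -
    have [measurable]: "cball 0 2 \<in> sets (borel :: (real^'n) measure)" by (intro borel_closed closed_cball)
    show ?thesis by (subst nn_integral_multc) simp_all
  qed
  also have "\<dots> < \<infinity>"
    using K emeasure_compact_finite[of "cball 0 2 :: (real^'n) set"] by (auto simp: ennreal_mult_less_top top.not_eq_extremum)
  finally have "(\<integral>\<^sup>+(y::real^'n). ennreal (min 1 ((norm y)\<^sup>2)) * ennreal (norm y powr (- ?m)) \<partial>lborel) < \<infinity>"
    by (auto simp: ennreal_mult_less_top)
  then show "(\<integral>\<^sup>+(y::real^'n). ennreal (min 1 ((norm y)\<^sup>2) * norm y powr (- ?m)) \<partial>lborel) < \<infinity>"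
    by (simp add: ennreal_mult)
qed auto

section \<open>Sign changes of coordinates and the symmetrised principal value\<close>

lemma lborel_distr_signs:
  fixes c :: "'a::euclidean_space \<Rightarrow> real"
  assumes "\<And>j. j \<in> Basis \<Longrightarrow> \<bar>c j\<bar> = 1"
  shows "distr lborel borel (\<lambda>x::'a. \<Sum>j\<in>Basis. (c j * (x \<bullet> j)) *\<^sub>R j) = lborel"
proof -
  have nz: "c j \<noteq> 0" if "j \<in> Basis" for j using assms[OF that] by auto
  have "lborel = density (distr lborel borel (\<lambda>x. 0 + (\<Sum>j\<in>Basis. (c j * (x \<bullet> j)) *\<^sub>R j))) (\<lambda>_. \<Prod>j\<in>Basis. \<bar>c j\<bar>)"
    by (rule lborel_affine_euclidean[OF nz])
  then show ?thesis using assms by (simp add: density_1)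
qed

lemma lborel_distr_uminus_euclidean: "distr lborel borel (uminus :: 'a::euclidean_space \<Rightarrow> 'a) = lborel"
proof -
  have "(\<lambda>x::'a. \<Sum>j\<in>Basis. (- 1 * (x \<bullet> j)) *\<^sub>R j) = uminus"
    by (auto simp: sum_negf euclidean_representation)
  then show ?thesis using lborel_distr_signs[of "\<lambda>_::'a. - 1"] by simp
qed

text \<open>The truncated domain is symmetric about x, so averaging over y and - y replaces u x - u
  (x + y) by half a second difference. Its integral converges absolutely up to the singularity, and
  dominated convergence identifies it with the principal value.\<close>

lemma has_frac_laplacian_zeroI:
  fixes u :: "real^'n::finite \<Rightarrow> real"
  assumes s: "0 < s" "s < 1" and [measurable]: "u \<in> borel_measurable borel"
    and bd: "\<And>y. \<bar>u y\<bar> \<le> C"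
    and sd: "\<And>y. \<bar>2 * u x - u (x + y) - u (x - y)\<bar> \<le> C' * min 1 ((norm y)\<^sup>2)"
    and zero: "(\<integral>y. (2 * u x - u (x + y) - u (x - y)) * norm y powr (- (real CARD('n) + 2 * s)) \<partial>lborel) = 0"
  shows "has_frac_laplacian s u x 0"
proof -
  let ?m = "real CARD('n) + 2 * s"
  let ?W = "\<lambda>y::real^'n. min 1 ((norm y)\<^sup>2) * norm y powr (- ?m)"
  define T where "T = (\<lambda>e y. indicator (- ball 0 e) y * ((u x - u (x + y)) * norm y powr (- ?m)))"
  have C: "C \<ge> 0" by (rule order_trans[OF abs_ge_zero bd])
  have W0: "?W y \<ge> 0" for y by simp
  have Tm: "T e \<in> borel_measurable borel" for e unfolding T_def by measurable
  have Tint: "integrable lborel (T e)" if e: "e > 0" for e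
  proof (rule Bochner_Integration.integrable_bound[OF integrable_mult_right[OF kernel_weight_integrable[OF s]]])
    show "T e \<in> borel_measurable lborel" using Tm by simp
    \<comment> \<open>Outside the ball min(1, |y|^2) is at least min(1, e^2), so the difference,
      bounded by 2 C, is at most 2 C / min(1, e^2) times the weight.\<close>
    show "AE y in lborel. norm (T e y) \<le> norm ((2 * C / min 1 (e\<^sup>2)) * ?W y)"
    proof (rule AE_I2)
      fix y
      show "norm (T e y) \<le> norm ((2 * C / min 1 (e\<^sup>2)) * ?W y)"
      proof (cases "norm y < e")
        case False
        then have "e\<^sup>2 \<le> (norm y)\<^sup>2" using e by (intro power_mono) auto
        then have "min 1 (e\<^sup>2) \<le> min 1 ((norm y)\<^sup>2)" by auto
        moreover have p: "min 1 (e\<^sup>2) > 0" using e by auto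
        ultimately have "1 \<le> min 1 ((norm y)\<^sup>2) / min 1 (e\<^sup>2)" by (simp only: le_divide_eq_1_pos)
        then have 1: "2 * C * 1 \<le> 2 * C * (min 1 ((norm y)\<^sup>2) / min 1 (e\<^sup>2))" using C by (intro mult_left_mono) auto
        have "\<bar>u x - u (x + y)\<bar> \<le> 2 * C" using bd[of x] bd[of "x + y"] by linarith
        then have "\<bar>u x - u (x + y)\<bar> \<le> 2 * C * (min 1 ((norm y)\<^sup>2) / min 1 (e\<^sup>2))" using 1 by linarith
        then have "\<bar>u x - u (x + y)\<bar> * norm y powr (- ?m)
           \<le> 2 * C * (min 1 ((norm y)\<^sup>2) / min 1 (e\<^sup>2)) * norm y powr (- ?m)"
          by (rule mult_right_mono) simp
        also have "\<dots> = (2 * C / min 1 (e\<^sup>2)) * ?W y" by simp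
        finally show ?thesis using False
          by (simp add: T_def abs_mult C)
      qed (simp add: T_def)
    qed
  qed
  have frac: "indicator (- ball x e) (x + w) * frac_kernel s u x (x + w) = T e w" for e w
  proof -
    have "c / norm w powr ?m = c * norm w powr (- ?m)" for c by (simp only: powr_minus_divide) simp
    then show ?thesis
      unfolding T_def frac_kernel_def by (simp add: indicator_def dist_norm del: minus_add_distrib)
  qed
  have fm: "(\<lambda>y. indicator (- ball x e) y * frac_kernel s u x y) \<in> borel_measurable borel" for e
    unfolding frac_kernel_def by measurable
  have I1: "set_integrable lborel (- ball x e) (frac_kernel s u x)" if "e > 0" for e
    unfolding set_integrable_def real_scaleR_def
    by (subst lborel_distr_plus[of x, symmetric], subst integrable_distr_eq)
      (use fm Tint[OF that] in \<open>simp_all add: frac\<close>)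
  have I2: "set_lebesgue_integral lborel (- ball x e) (frac_kernel s u x) = (\<integral>w. T e w \<partial>lborel)" for e
    unfolding set_lebesgue_integral_def real_scaleR_def
    by (subst lborel_distr_plus[of x, symmetric], subst integral_distr) (use fm in \<open>simp_all add: frac\<close>)
  have I3: "(\<integral>w. T e (- w) \<partial>lborel) = (\<integral>w. T e w \<partial>lborel)" for e
    using integral_distr[of uminus "lborel :: (real^'n) measure" borel "T e"] Tm[of e]
    by (simp add: lborel_distr_uminus_euclidean)
  have I3': "integrable lborel (\<lambda>w. T e (- w))" if "e > 0" for e
    using integrable_distr_eq[of uminus "lborel :: (real^'n) measure" borel "T e"] Tm[of e] Tint[OF that]
    by (simp add: lborel_distr_uminus_euclidean)
  let ?D = "\<lambda>y. (2 * u x - u (x + y) - u (x - y)) * norm y powr (- ?m)"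
  have I4: "2 * (\<integral>w. T e w \<partial>lborel) = (\<integral>y. indicator (- ball 0 e) y * ?D y \<partial>lborel)" if e: "e > 0" for e
  proof -
    have "2 * (\<integral>w. T e w \<partial>lborel) = (\<integral>w. T e w \<partial>lborel) + (\<integral>w. T e (- w) \<partial>lborel)" by (simp add: I3)
    also have "\<dots> = (\<integral>w. T e w + T e (- w) \<partial>lborel)" using Tint[OF e] I3'[OF e] by simp
    also have "\<dots> = (\<integral>y. indicator (- ball 0 e) y * ?D y \<partial>lborel)"
      by (rule Bochner_Integration.integral_cong) (auto simp: T_def indicator_def algebra_simps)
    finally show ?thesis .
  qed
  have lim: "((\<lambda>e. \<integral>y. indicator (- ball 0 e) y * ?D y \<partial>lborel) \<longlongrightarrow> (\<integral>y. ?D y \<partial>lborel)) (at_right 0)"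
  proof (subst tendsto_at_iff_sequentially, intro allI impI)
    fix X :: "nat \<Rightarrow> real" assume X: "\<forall>i. X i \<in> {0<..} - {0}" "X \<longlonglongrightarrow> 0"
    have "(\<lambda>n. \<integral>y. indicator (- ball 0 (X n)) y * ?D y \<partial>lborel) \<longlonglongrightarrow> (\<integral>y. ?D y \<partial>lborel)"
    proof (rule integral_dominated_convergence[where w = "\<lambda>y. C' * ?W y"])
      show "integrable lborel (\<lambda>y. C' * ?W y)" by (intro integrable_mult_right kernel_weight_integrable s)
      have D: "\<bar>?D y\<bar> \<le> C' * ?W y" for y
        unfolding abs_mult using mult_right_mono[OF sd[of y], of "norm y powr (- ?m)"] by simp
      then show "AE y in lborel. norm (indicator (- ball 0 (X n)) y * ?D y) \<le> C' * ?W y" for n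
        using order_trans[OF abs_ge_zero D] by (intro AE_I2) (auto simp: indicator_def)
      show "AE y in lborel. (\<lambda>n. indicator (- ball 0 (X n)) y * ?D y) \<longlonglongrightarrow> ?D y"
        using AE_lborel_singleton[of 0]
      proof eventually_elim
        fix y :: "real^'n" assume "y \<noteq> 0"
        then have "\<forall>\<^sub>F n in sequentially. X n < norm y" using X(2) by (intro order_tendstoD) auto
        then have "\<forall>\<^sub>F n in sequentially. indicator (- ball 0 (X n)) y * ?D y = ?D y"
          by (rule eventually_mono) (auto simp: indicator_def)
        then show "(\<lambda>n. indicator (- ball 0 (X n)) y * ?D y) \<longlonglongrightarrow> ?D y" by (rule tendsto_eventually)
      qed
    qed measurable
    then show "((\<lambda>e. \<integral>y. indicator (- ball 0 e) y * ?D y \<partial>lborel) \<circ> X) \<longlonglongrightarrow> (\<integral>y. ?D y \<partial>lborel)"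
      by (simp add: comp_def)
  qed
  have "((\<lambda>e. frac_const CARD('n) s * ((\<integral>y. indicator (- ball 0 e) y * ?D y \<partial>lborel) / 2)) \<longlongrightarrow>
      frac_const CARD('n) s * (0 / 2)) (at_right 0)"
    using lim unfolding zero by (intro tendsto_intros) auto
  moreover have "\<forall>\<^sub>F e in at_right 0. frac_const CARD('n) s * ((\<integral>y. indicator (- ball 0 e) y * ?D y \<partial>lborel) / 2)
     = frac_const CARD('n) s * set_lebesgue_integral lborel (- ball x e) (frac_kernel s u x)"
    using eventually_at_right_less[of 0]
  proof eventually_elim
    case (elim e)
    show ?case unfolding I2 I4[OF elim, symmetric] by simp
  qed
  ultimately have "((\<lambda>e. frac_const CARD('n) s * set_lebesgue_integral lborel (- ball x e) (frac_kernel s u x)) \<longlongrightarrow> 0) (at_right 0)"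
    using Lim_transform_eventually by fastforce
  then show ?thesis unfolding has_frac_laplacian_def using I1 by blast
qed

subsection \<open>Radial kernels\<close>

text \<open>The profile is a function of |z|^2 rather than of |z|: smooth profiles then give smooth
  functions also at the origin, and along lines the argument is a quadratic polynomial.\<close>

definition radial :: "(real \<Rightarrow> real) \<Rightarrow> real^'n::finite \<Rightarrow> real" where
  "radial h z = h (z \<bullet> z)"

lemma radial_continuous: "smooth_real h \<Longrightarrow> continuous_on S (radial h)"
  unfolding radial_def
  by (rule continuous_on_compose2[of UNIV h]) (auto intro: smooth_real_continuous_on continuous_intros)

lemma radial_borel: "smooth_real h \<Longrightarrow> radial h \<in> borel_measurable borel"
  by (intro borel_measurable_continuous_onI radial_continuous)

lemma psi_bounded_nonneg:
  assumes s: "0 < s" and g: "smooth_supp q1 q2 g"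
  obtains A where "0 \<le> A" "\<And>q. 0 \<le> q \<Longrightarrow> \<bar>psi s g q\<bar> \<le> A"
proof -
  have "bounded (psi s g ` {0..q2})"
    by (intro compact_imp_bounded compact_continuous_image smooth_real_continuous_on smooth_real_psi[OF s g]) auto
  then obtain A where A: "A > 0" "\<forall>q\<in>{0..q2}. \<bar>psi s g q\<bar> \<le> A" unfolding bounded_pos by auto
  have "\<bar>psi s g q\<bar> \<le> A" if "0 \<le> q" for q
    using A that psi_eq_0[OF g, of q s] by (cases "q \<le> q2") auto
  then show ?thesis by (rule that[OF less_imp_le[OF A(1)]])
qed

text \<open>The constant has to be uniform in x, since the kernel will be convolved. Along w = x + t
  y the term psi'' (2 w . y)^2 seems to grow with |w|, but psi'' vanishes for |w|^2 > q2; elsewhere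
  Cauchy-Schwarz bounds the square by 4 q2 |y|^2.\<close>

lemma radial_psi_second_difference:
  assumes s: "0 < s" and g: "smooth_supp q1 q2 g" and q: "0 \<le> q2"
  obtains C where "0 \<le> C" "\<And>x y :: real^'n::finite.
    \<bar>2 * radial (psi s g) x - radial (psi s g) (x + y) - radial (psi s g) (x - y)\<bar> \<le> C * min 1 ((norm y)\<^sup>2)"
proof -
  note g1 = smooth_supp_deriv[OF g] and g2 = smooth_supp_deriv[OF smooth_supp_deriv[OF g]]
  obtain A0 where A0: "0 \<le> A0" "\<And>q. 0 \<le> q \<Longrightarrow> \<bar>psi s g q\<bar> \<le> A0" using psi_bounded_nonneg[OF s g] by blast
  obtain A1 where A1: "0 \<le> A1" "\<And>q. 0 \<le> q \<Longrightarrow> \<bar>psi s (deriv g) q\<bar> \<le> A1" using psi_bounded_nonneg[OF s g1] by blast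
  obtain A2 where A2: "0 \<le> A2" "\<And>q. 0 \<le> q \<Longrightarrow> \<bar>psi s (deriv (deriv g)) q\<bar> \<le> A2" using psi_bounded_nonneg[OF s g2] by blast
  \<comment> \<open>The first summand is the trivial bound, used for large y; the second bounds the
    second derivative along the line, doubled by \<open>second_difference_bound\<close>.\<close>
  define C where "C = 4 * A0 + 2 * (4 * A2 * q2 + 2 * A1)"
  have C: "0 \<le> C" using A0 A1 A2 q by (simp add: C_def)
  have main: "\<bar>2 * radial (psi s g) x - radial (psi s g) (x + y) - radial (psi s g) (x - y)\<bar>
     \<le> C * min 1 ((norm y)\<^sup>2)" for x y :: "real^'n"
  proof -
    let ?w = "\<lambda>t. x + t *\<^sub>R y"
    let ?q = "\<lambda>t. x \<bullet> x + 2 * (x \<bullet> y) * t + (y \<bullet> y) * t\<^sup>2"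
    have qw: "?q t = ?w t \<bullet> ?w t" for t
      by (simp add: inner_add_left inner_add_right inner_commute power2_eq_square algebra_simps)
    have dq: "(?q has_real_derivative 2 * (?w t \<bullet> y)) (at t)" for t
      by (auto intro!: derivative_eq_intros simp: inner_add_left algebra_simps)
    have dl: "((\<lambda>t. 2 * (?w t \<bullet> y)) has_real_derivative 2 * (y \<bullet> y)) (at t)" for t
      unfolding inner_add_left by (auto intro!: derivative_eq_intros)
    let ?f = "\<lambda>t. psi s g (?q t)"
    let ?f1 = "\<lambda>t. psi s (deriv g) (?q t) * (2 * (?w t \<bullet> y))"
    let ?f2 = "\<lambda>t. psi s (deriv (deriv g)) (?q t) * (2 * (?w t \<bullet> y)) * (2 * (?w t \<bullet> y))
        + 2 * (y \<bullet> y) * psi s (deriv g) (?q t)"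
    have "\<bar>2 * ?f 0 - ?f (0 + 1) - ?f (0 - 1)\<bar> \<le> 2 * ((4 * A2 * q2 + 2 * A1) * (norm y)\<^sup>2) * 1\<^sup>2"
    proof (rule second_difference_bound[where f = ?f and f' = ?f1 and f'' = ?f2])
      fix t :: real
      show "(?f has_real_derivative ?f1 t) (at t)"
        by (rule DERIV_chain2[OF psi_DERIV[OF s g] dq])
      show "(?f1 has_real_derivative ?f2 t) (at t)"
        by (rule DERIV_mult[OF DERIV_chain2[OF psi_DERIV[OF s g1] dq] dl])
      have q0: "0 \<le> ?q t" unfolding qw by simp
      have 1: "\<bar>2 * (y \<bullet> y) * psi s (deriv g) (?q t)\<bar> \<le> 2 * A1 * (norm y)\<^sup>2"
        using mult_left_mono[OF A1(2)[OF q0], of "2 * (norm y)\<^sup>2"]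
        by (simp add: abs_mult power2_norm_eq_inner mult.commute mult.left_commute)
      have 2: "\<bar>psi s (deriv (deriv g)) (?q t) * (2 * (?w t \<bullet> y)) * (2 * (?w t \<bullet> y))\<bar> \<le> 4 * A2 * q2 * (norm y)\<^sup>2"
      proof (cases "?q t \<le> q2")
        case True
        have "\<bar>?w t \<bullet> y\<bar>\<^sup>2 \<le> (norm (?w t) * norm y)\<^sup>2"
          by (intro power_mono Cauchy_Schwarz_ineq2) auto
        also have "\<dots> = ?q t * (norm y)\<^sup>2" by (simp add: qw power_mult_distrib power2_norm_eq_inner)
        also have "\<dots> \<le> q2 * (norm y)\<^sup>2" using True by (intro mult_right_mono) auto
        finally have "\<bar>?w t \<bullet> y\<bar>\<^sup>2 \<le> q2 * (norm y)\<^sup>2" .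
        then have "\<bar>psi s (deriv (deriv g)) (?q t)\<bar> * (4 * \<bar>?w t \<bullet> y\<bar>\<^sup>2) \<le> A2 * (4 * (q2 * (norm y)\<^sup>2))"
          using A2(2)[OF q0] A2(1) by (intro mult_mono) auto
        moreover have "\<bar>psi s (deriv (deriv g)) (?q t) * (2 * (?w t \<bullet> y)) * (2 * (?w t \<bullet> y))\<bar>
            = \<bar>psi s (deriv (deriv g)) (?q t)\<bar> * (4 * \<bar>?w t \<bullet> y\<bar>\<^sup>2)"
          unfolding abs_mult by (simp add: power2_eq_square)
        ultimately show ?thesis by (simp add: mult.assoc mult.left_commute)
      next
        case False
        then have "psi s (deriv (deriv g)) (?q t) = 0" by (intro psi_eq_0[OF g2]) simp
        then show ?thesis using A2 q by simp
      qed
      show "\<bar>?f2 t\<bar> \<le> (4 * A2 * q2 + 2 * A1) * (norm y)\<^sup>2"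
        using order_trans[OF abs_triangle_ineq add_mono[OF 2 1]] by (simp add: distrib_right)
    qed
    moreover have "?f 0 = radial (psi s g) x" by (simp add: radial_def)
    moreover have "?f (0 + 1) = radial (psi s g) (x + y)" unfolding qw radial_def by simp
    moreover have "?f (0 - 1) = radial (psi s g) (x - y)" unfolding qw radial_def by simp
    ultimately have b1: "\<bar>2 * radial (psi s g) x - radial (psi s g) (x + y) - radial (psi s g) (x - y)\<bar>
       \<le> 2 * ((4 * A2 * q2 + 2 * A1) * (norm y)\<^sup>2)" by simp
    also have "\<dots> = (2 * (4 * A2 * q2 + 2 * A1)) * (norm y)\<^sup>2" by (simp only: mult.assoc)
    also have "\<dots> \<le> C * (norm y)\<^sup>2" using A0 by (intro mult_right_mono) (auto simp: C_def)
    finally have b2: "\<bar>2 * radial (psi s g) x - radial (psi s g) (x + y) - radial (psi s g) (x - y)\<bar> \<le> C * (norm y)\<^sup>2" .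
    have "\<bar>radial (psi s g) v\<bar> \<le> A0" for v :: "real^'n" unfolding radial_def by (rule A0(2)) simp
    from this[of x] this[of "x + y"] this[of "x - y"]
    have "\<bar>2 * radial (psi s g) x - radial (psi s g) (x + y) - radial (psi s g) (x - y)\<bar> \<le> 4 * A0" by linarith
    also have "\<dots> \<le> C" using A1 A2 q by (simp add: C_def)
    finally show ?thesis using b2 by (auto simp: min_def)
  qed
  show ?thesis using that[OF C main] .
qed

text \<open>On each ray |x + t z|^2 and |x - t z|^2 are quadratic in t with constant term below q1,
  so \<open>psi_line_zero\<close> applies ray by ray and \<open>integral_zero_by_rays\<close>
  assembles the space integral.\<close>

lemma radial_psi_harmonic:
  fixes x :: "real^'n::finite"
  assumes s: "0 < s" "s < 1" and g: "smooth_supp q1 q2 g" and q: "q1 \<le> q2" and x: "x \<bullet> x < q1"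
  shows "(\<integral>y. (2 * radial (psi s g) x - radial (psi s g) (x + y) - radial (psi s g) (x - y))
     * norm y powr (- (real CARD('n) + 2 * s)) \<partial>lborel) = 0"
proof -
  have q2: "0 \<le> q2" using q x inner_ge_zero[of x] by linarith
  obtain C where C: "0 \<le> C" "\<And>x y :: real^'n.
    \<bar>2 * radial (psi s g) x - radial (psi s g) (x + y) - radial (psi s g) (x - y)\<bar> \<le> C * min 1 ((norm y)\<^sup>2)"
    using radial_psi_second_difference[OF s(1) g q2] by blast
  let ?F = "\<lambda>y. 2 * radial (psi s g) x - radial (psi s g) (x + y) - radial (psi s g) (x - y)"
  have [measurable]: "radial (psi s g) \<in> borel_measurable borel" by (rule radial_borel[OF smooth_real_psi[OF s(1) g]])
  have Fm: "?F \<in> borel_measurable borel" by measurable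
  have int: "integrable lborel (\<lambda>y. ?F y * norm y powr (- (real CARD('n) + 2 * s)))"
  proof (rule Bochner_Integration.integrable_bound[OF integrable_mult_right[OF kernel_weight_integrable[OF s]]])
    show "AE y in lborel. norm (?F y * norm y powr (- (real CARD('n) + 2 * s)))
       \<le> norm (C * (min 1 ((norm y)\<^sup>2) * norm y powr (- (real CARD('n) + 2 * s))))"
    proof (rule AE_I2)
      fix y :: "real^'n"
      show "norm (?F y * norm y powr (- (real CARD('n) + 2 * s)))
       \<le> norm (C * (min 1 ((norm y)\<^sup>2) * norm y powr (- (real CARD('n) + 2 * s))))"
        using mult_right_mono[OF C(2)[of x y], of "norm y powr (- (real CARD('n) + 2 * s))"] C(1)
        by (simp add: abs_mult)
    qed
  qed measurable
  have ray: "set_integrable lborel {0<..} (\<lambda>t. ?F (t *\<^sub>R z) * t powr (- 1 - 2 * s)) \<and>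
     (LINT t:{0<..}|lborel. ?F (t *\<^sub>R z) * t powr (- 1 - 2 * s)) = 0" if z: "z \<noteq> 0" for z
  proof -
    let ?a = "x \<bullet> x" and ?b = "x \<bullet> z" and ?c = "z \<bullet> z"
    have qp: "?a + 2 * ?b * t + ?c * t\<^sup>2 = (x + t *\<^sub>R z) \<bullet> (x + t *\<^sub>R z)" for t
      by (simp add: inner_add_left inner_add_right inner_commute power2_eq_square algebra_simps)
    have qm: "?a - 2 * ?b * t + ?c * t\<^sup>2 = (x - t *\<^sub>R z) \<bullet> (x - t *\<^sub>R z)" for t
      by (simp add: inner_diff_left inner_diff_right inner_commute power2_eq_square algebra_simps)
    have F: "?F (t *\<^sub>R z) = 2 * psi s g ?a - psi s g (?a + 2 * ?b * t + ?c * t\<^sup>2) - psi s g (?a - 2 * ?b * t + ?c * t\<^sup>2)" for t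
      unfolding qp qm radial_def ..
    have bd: "\<bar>2 * psi s g ?a - psi s g (?a + 2 * ?b * t + ?c * t\<^sup>2) - psi s g (?a - 2 * ?b * t + ?c * t\<^sup>2)\<bar>
       \<le> (C * max 1 ?c) * min 1 (t\<^sup>2)" for t
    proof -
      have "min 1 ((norm (t *\<^sub>R z))\<^sup>2) \<le> max 1 ?c * min 1 (t\<^sup>2)"
      proof -
        have "(norm (t *\<^sub>R z))\<^sup>2 = ?c * t\<^sup>2" by (simp add: power_mult_distrib power2_norm_eq_inner mult.commute)
        also have "\<dots> \<le> max 1 ?c * t\<^sup>2" by (intro mult_right_mono) auto
        finally show ?thesis by (auto simp: min_def max_def)
      qed
      then have "C * min 1 ((norm (t *\<^sub>R z))\<^sup>2) \<le> C * (max 1 ?c * min 1 (t\<^sup>2))" using C(1) by (rule mult_left_mono)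
      then show ?thesis using C(2)[of x "t *\<^sub>R z"] unfolding F by (simp only: mult.assoc)
    qed
    have nn: "0 \<le> ?a + 2 * ?b * t + ?c * t\<^sup>2" for t unfolding qp by simp
    show ?thesis unfolding F
      using psi_line_zero[OF s g _ x q _ nn bd] z by simp
  qed
  show ?thesis
    by (rule integral_zero_by_rays[OF Fm int]) (use ray in auto)
qed

text \<open>Fubini moves the second difference of the convolution onto the kernel, where each p with
  F p nonzero contributes 0 by \<open>radial_psi_harmonic\<close> at x - p. The uniform constant C
  supplies the absolute integrability.\<close>

lemma convolution_harmonic:
  fixes F :: "real^'n::finite \<Rightarrow> real"
  assumes s: "0 < s" "s < 1" and g: "smooth_supp q1 q2 g" and q: "q1 \<le> q2" "0 \<le> q1"
    and F: "integrable lborel F" and near: "\<And>p. F p \<noteq> 0 \<Longrightarrow> (x - p) \<bullet> (x - p) < q1"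
  shows "has_frac_laplacian s (\<lambda>x. \<integral>p. F p * radial (psi s g) (x - p) \<partial>lborel) x 0"
proof -
  let ?k = "radial (psi s g) :: real^'n \<Rightarrow> real"
  let ?U = "\<lambda>x. \<integral>p. F p * ?k (x - p) \<partial>lborel"
  have q2: "0 \<le> q2" using q by simp
  obtain C where C: "0 \<le> C" "\<And>x y :: real^'n. \<bar>2 * ?k x - ?k (x + y) - ?k (x - y)\<bar> \<le> C * min 1 ((norm y)\<^sup>2)"
    using radial_psi_second_difference[OF s(1) g q2] by blast
  obtain A where A: "0 \<le> A" "\<And>q. 0 \<le> q \<Longrightarrow> \<bar>psi s g q\<bar> \<le> A" using psi_bounded_nonneg[OF s(1) g] by blast
  have kA: "\<bar>?k v\<bar> \<le> A" for v unfolding radial_def by (rule A(2)) simp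
  have [measurable]: "?k \<in> borel_measurable borel" by (rule radial_borel[OF smooth_real_psi[OF s(1) g]])
  have [measurable]: "F \<in> borel_measurable borel" using borel_measurable_integrable[OF F] by simp
  define I where "I = (\<integral>p. \<bar>F p\<bar> \<partial>lborel)"
  have I: "0 \<le> I" unfolding I_def by (intro integral_nonneg_AE) auto
  have Fk: "integrable lborel (\<lambda>p. F p * ?k (v - p))" for v
  proof (rule Bochner_Integration.integrable_bound[OF integrable_mult_right[OF F, of A]])
    show "AE p in lborel. norm (F p * ?k (v - p)) \<le> norm (A * F p)"
      using mult_right_mono[OF kA abs_ge_zero] A(1) by (intro AE_I2) (simp add: abs_mult mult.commute)
  qed measurable
  let ?D = "\<lambda>y p. 2 * ?k (x - p) - ?k (x - p + y) - ?k (x - p - y)"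
  have DU: "2 * ?U x - ?U (x + y) - ?U (x - y) = (\<integral>p. F p * ?D y p \<partial>lborel)" for y
  proof -
    have "2 * ?U x - ?U (x + y) - ?U (x - y)
      = (\<integral>p. 2 * (F p * ?k (x - p)) - F p * ?k (x + y - p) - F p * ?k (x - y - p) \<partial>lborel)"
      using Fk by simp
    also have "\<dots> = (\<integral>p. F p * ?D y p \<partial>lborel)"
      by (rule Bochner_Integration.integral_cong) (auto simp: algebra_simps)
    finally show ?thesis .
  qed
  have FD: "integrable lborel (\<lambda>p. F p * ?D y p)" for y
  proof -
    have "integrable lborel (\<lambda>p. 2 * (F p * ?k (x - p)) - F p * ?k (x + y - p) - F p * ?k (x - y - p))"
      using Fk by simp
    then show ?thesis by (rule Bochner_Integration.integrable_cong[THEN iffD1, rotated -1]) (auto simp: algebra_simps)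
  qed
  have FDb: "(\<integral>p. \<bar>F p * ?D y p\<bar> \<partial>lborel) \<le> C * I * min 1 ((norm y)\<^sup>2)" for y
  proof -
    have "(\<integral>p. \<bar>F p * ?D y p\<bar> \<partial>lborel) \<le> (\<integral>p. (C * min 1 ((norm y)\<^sup>2)) * \<bar>F p\<bar> \<partial>lborel)"
    proof (rule integral_mono)
      fix p
      show "\<bar>F p * ?D y p\<bar> \<le> (C * min 1 ((norm y)\<^sup>2)) * \<bar>F p\<bar>"
        using mult_right_mono[OF C(2)[of "x - p" y], of "\<bar>F p\<bar>"] by (simp add: abs_mult mult.commute)
    qed (use FD F in auto)
    then show ?thesis by (simp add: I_def mult.commute mult.left_commute)
  qed
  let ?w = "\<lambda>y::real^'n. norm y powr (- (real CARD('n) + 2 * s))"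
  define K where "K = (\<lambda>(y, p). F p * ?D y p * ?w y)"
  have Km [measurable]: "K \<in> borel_measurable (lborel \<Otimes>\<^sub>M lborel)" unfolding K_def by measurable
  have Ky: "(\<integral>p. K (y, p) \<partial>lborel) = (2 * ?U x - ?U (x + y) - ?U (x - y)) * ?w y" for y
    unfolding DU K_def by simp
  have Kn: "(\<integral>p. norm (K (y, p)) \<partial>lborel) = (\<integral>p. \<bar>F p * ?D y p\<bar> \<partial>lborel) * ?w y" for y
  proof -
    have "(\<integral>p. norm (K (y, p)) \<partial>lborel) = (\<integral>p. \<bar>F p * ?D y p\<bar> * ?w y \<partial>lborel)"
      by (rule Bochner_Integration.integral_cong) (simp_all add: K_def abs_mult)
    then show ?thesis by simp
  qed
  have Kp: "(\<integral>y. K (y, p) \<partial>lborel) = 0" for p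
  proof (cases "F p = 0")
    case False
    have "(\<integral>y. K (y, p) \<partial>lborel) = (\<integral>y. F p * (?D y p * ?w y) \<partial>lborel)"
      by (rule Bochner_Integration.integral_cong) (simp_all add: K_def mult.assoc)
    also have "\<dots> = F p * (\<integral>y. ?D y p * ?w y \<partial>lborel)" by (rule integral_mult_right_zero)
    also have "\<dots> = 0" using radial_psi_harmonic[OF s g q(1) near[OF False]] by simp
    finally show ?thesis .
  qed (simp add: K_def)
  have Ki: "integrable (lborel \<Otimes>\<^sub>M lborel) K"
  proof (rule lborel_pair.Fubini_integrable[OF Km])
    show "AE y in lborel. integrable lborel (\<lambda>p. K (y, p))"
      unfolding K_def using FD by (intro AE_I2) simp
    show "integrable lborel (\<lambda>y. \<integral>p. norm (K (y, p)) \<partial>lborel)"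
    proof (rule Bochner_Integration.integrable_bound[OF integrable_mult_right[OF kernel_weight_integrable[OF s]]])
      show "AE y in lborel. norm (\<integral>p. norm (K (y, p)) \<partial>lborel) \<le> norm (C * I * (min 1 ((norm y)\<^sup>2) * ?w y))"
      proof (rule AE_I2)
        fix y
        have "(\<integral>p. \<bar>F p * ?D y p\<bar> \<partial>lborel) * ?w y \<le> C * I * min 1 ((norm y)\<^sup>2) * ?w y"
          using FDb by (rule mult_right_mono) simp
        moreover have "0 \<le> (\<integral>p. \<bar>F p * ?D y p\<bar> \<partial>lborel) * ?w y"
          by (intro mult_nonneg_nonneg integral_nonneg_AE) auto
        ultimately show "norm (\<integral>p. norm (K (y, p)) \<partial>lborel) \<le> norm (C * I * (min 1 ((norm y)\<^sup>2) * ?w y))"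
          unfolding Kn by (simp only: real_norm_def mult.assoc)
      qed
      show "(\<lambda>y. \<integral>p. norm (K (y, p)) \<partial>lborel) \<in> borel_measurable lborel"
        using Km by (intro lborel.borel_measurable_lebesgue_integral) (simp add: case_prod_unfold)
    qed
  qed
  have Ki': "integrable (lborel \<Otimes>\<^sub>M lborel) (case_prod (\<lambda>y p. K (y, p)))" using Ki by (simp add: case_prod_unfold)
  have zero: "(\<integral>y. (2 * ?U x - ?U (x + y) - ?U (x - y)) * ?w y \<partial>lborel) = 0"
    unfolding Ky[symmetric] lborel_pair.Fubini_integral[OF Ki', symmetric] Kp by simp
  show ?thesis
  proof (rule has_frac_laplacian_zeroI[OF s])
    show "?U \<in> borel_measurable borel"
      using lborel.borel_measurable_lebesgue_integral[of "\<lambda>v p. F p * ?k (v - p)" borel] by simp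
    show "\<bar>?U v\<bar> \<le> A * I" for v
    proof -
      have "norm (?U v) \<le> (\<integral>p. A * \<bar>F p\<bar> \<partial>lborel)"
        using mult_right_mono[OF kA abs_ge_zero] F
        by (intro Bochner_Integration.integral_norm_bound_integral Fk) (simp_all add: abs_mult mult.commute)
      then show ?thesis by (simp add: I_def)
    qed
    show "\<bar>2 * ?U x - ?U (x + y) - ?U (x - y)\<bar> \<le> C * I * min 1 ((norm y)\<^sup>2)" for y
      unfolding DU using order_trans[OF integral_abs_bound FDb] by simp
  qed (rule zero)
qed

subsection \<open>Calculus of partial derivatives\<close>

lemma partial_DERIV:
  "has_partial i f x \<Longrightarrow> ((\<lambda>t. f (x + t *\<^sub>R axis i 1)) has_real_derivative partial i f x) (at 0)"
  unfolding has_partial_def partial_def by (simp add: DERIV_deriv_iff_real_differentiable)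

lemma partialI:
  assumes "((\<lambda>t. f (x + t *\<^sub>R axis i 1)) has_real_derivative d) (at 0)"
  shows "has_partial i f x" and "partial i f x = d"
  using assms by (auto simp: has_partial_def partial_def real_differentiable_def intro: DERIV_imp_deriv)

lemma partial_DERIV_line:
  assumes "has_partial i f (x + t *\<^sub>R axis i 1)"
  shows "((\<lambda>t. f (x + t *\<^sub>R axis i 1)) has_real_derivative partial i f (x + t *\<^sub>R axis i 1)) (at t)"
proof -
  have "((\<lambda>u. f (x + (u + t) *\<^sub>R axis i 1)) has_real_derivative partial i f (x + t *\<^sub>R axis i 1)) (at 0)"
    using partial_DERIV[OF assms] by (simp add: scaleR_add_left add.assoc add.commute[of "t *\<^sub>R _"])
  then show ?thesis using DERIV_shift[of "\<lambda>u. f (x + u *\<^sub>R axis i 1)" _ 0 t] by simp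
qed

lemma eventually_line_in_open:
  fixes x :: "real^'n::finite"
  assumes "open U" "x \<in> U"
  shows "\<forall>\<^sub>F t in nhds 0. x + t *\<^sub>R axis i 1 \<in> U"
proof -
  have "((\<lambda>t::real. x + t *\<^sub>R axis i 1) \<longlongrightarrow> x + 0 *\<^sub>R axis i 1) (nhds 0)"
    by (intro tendsto_intros filterlim_ident)
  from topological_tendstoD[OF this assms(1)] show ?thesis using assms(2) by simp
qed

lemma partial_cong_open:
  assumes U: "open U" "x \<in> U" and eq: "\<And>y. y \<in> U \<Longrightarrow> f y = g y"
  shows "has_partial i f x \<longleftrightarrow> has_partial i g x" and "partial i f x = partial i g x"
proof -
  have ev: "\<forall>\<^sub>F t in nhds 0. f (x + t *\<^sub>R axis i 1) = g (x + t *\<^sub>R axis i 1)"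
    using eventually_line_in_open[OF U] by eventually_elim (rule eq)
  have D: "((\<lambda>t. f (x + t *\<^sub>R axis i 1)) has_real_derivative d) (at 0)
     \<longleftrightarrow> ((\<lambda>t. g (x + t *\<^sub>R axis i 1)) has_real_derivative d) (at 0)" for d
    by (rule DERIV_cong_ev[OF refl ev refl])
  then show "has_partial i f x \<longleftrightarrow> has_partial i g x"
    by (simp add: has_partial_def real_differentiable_def)
  show "partial i f x = partial i g x"
    unfolding partial_def by (rule deriv_cong_ev[OF ev refl])
qed

lemma iter_partial_cong_open:
  assumes U: "open U" and eq: "\<And>y. y \<in> U \<Longrightarrow> f y = g y"
  shows "x \<in> U \<Longrightarrow> iter_partial js f x = iter_partial js g x"
proof (induction js arbitrary: x)
  case (Cons i js)
  show ?case using partial_cong_open(2)[OF U Cons.prems, of "iter_partial js f" "iter_partial js g"] Cons.IH by simp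
qed (use eq in simp)

lemma Ck_on_cong_open:
  assumes U: "open U" and eq: "\<And>y. y \<in> U \<Longrightarrow> f y = g y" and f: "Ck_on k U f"
  shows "Ck_on k U g"
proof -
  have it: "\<And>js x. x \<in> U \<Longrightarrow> iter_partial js f x = iter_partial js g x"
    by (rule iter_partial_cong_open[OF U eq])
  show ?thesis unfolding Ck_on_def
  proof (intro conjI allI impI ballI)
    fix js :: "'a list" and j x assume "length js < k" and x: "x \<in> U"
    then have "has_partial j (iter_partial js f) x" using f by (simp add: Ck_on_def)
    then show "has_partial j (iter_partial js g) x"
      using partial_cong_open(1)[OF U x, of "iter_partial js f" "iter_partial js g"] it by simp
  next
    fix js :: "'a list" assume "length js \<le> k"
    then have "continuous_on U (iter_partial js f)" using f by (simp add: Ck_on_def)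
    then show "continuous_on U (iter_partial js g)" using it by (rule continuous_on_eq)
  qed
qed

text \<open>The head of the list is the outermost derivative. Splitting off the last entry exposes
  the innermost one, so that inductions can pass from f to \<open>partial i f\<close>;
  \<open>Ck_on_Suc\<close> and \<open>iter_partial_radial_bound\<close> rest on this.\<close>

lemma iter_partial_snoc: "iter_partial (js @ [i]) f = iter_partial js (partial i f)"
  by (induction js) auto

lemma Ck_on_0: "Ck_on 0 U f \<longleftrightarrow> continuous_on U f"
  by (auto simp: Ck_on_def)

lemma Ck_on_Suc:
  "Ck_on (Suc k) U f \<longleftrightarrow> continuous_on U f \<and> (\<forall>i. \<forall>x\<in>U. has_partial i f x) \<and> (\<forall>i. Ck_on k U (partial i f))"
proof (intro iffI conjI allI ballI)
  assume f: "Ck_on (Suc k) U f"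
  have f1: "has_partial j (iter_partial js f) x" if "length js < Suc k" "x \<in> U" for js j x
    using f that by (simp add: Ck_on_def)
  have f2: "continuous_on U (iter_partial js f)" if "length js \<le> Suc k" for js
    using f that by (simp add: Ck_on_def)
  show "continuous_on U f" using f2[of "[]"] by simp
  show "has_partial i f x" if "x \<in> U" for i x
    using f1[of "[]" x i] that by simp
  show "Ck_on k U (partial i f)" for i
    unfolding Ck_on_def
  proof (intro conjI allI impI ballI)
    fix js :: "'a list" and j x assume "length js < k" "x \<in> U"
    then have "has_partial j (iter_partial (js @ [i]) f) x" by (intro f1) simp_all
    then show "has_partial j (iter_partial js (partial i f)) x" by (simp only: iter_partial_snoc)
  next
    fix js :: "'a list" assume "length js \<le> k"
    then have "continuous_on U (iter_partial (js @ [i]) f)"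
      by (intro f2) simp
    then show "continuous_on U (iter_partial js (partial i f))" by (simp only: iter_partial_snoc)
  qed
next
  assume f: "continuous_on U f \<and> (\<forall>i. \<forall>x\<in>U. has_partial i f x) \<and> (\<forall>i. Ck_on k U (partial i f))"
  show "Ck_on (Suc k) U f"
    unfolding Ck_on_def
  proof (intro conjI allI impI ballI)
    fix js :: "'a list" and j x assume "length js < Suc k" "x \<in> U"
    then show "has_partial j (iter_partial js f) x"
      using f by (cases js rule: rev_cases) (auto simp: iter_partial_snoc Ck_on_def)
  next
    fix js :: "'a list" assume "length js \<le> Suc k"
    then show "continuous_on U (iter_partial js f)"
      using f by (cases js rule: rev_cases) (auto simp: iter_partial_snoc Ck_on_def)
  qed
qed

lemma Ck_on_mono: "Ck_on k U f \<Longrightarrow> m \<le> k \<Longrightarrow> Ck_on m U f"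
  by (auto simp: Ck_on_def)

lemma partial_lin:
  assumes "has_partial i f x" "has_partial i g x"
  shows "has_partial i (\<lambda>x. f x + c * g x) x" "partial i (\<lambda>x. f x + c * g x) x = partial i f x + c * partial i g x"
  using partialI[OF DERIV_add[OF partial_DERIV[OF assms(1)] DERIV_cmult[OF partial_DERIV[OF assms(2)]]]]
  by simp_all

lemma partial_mult:
  assumes "has_partial i f x" "has_partial i g x"
  shows "has_partial i (\<lambda>x. f x * g x) x" "partial i (\<lambda>x. f x * g x) x = partial i f x * g x + partial i g x * f x"
  using partialI[OF DERIV_mult[OF partial_DERIV[OF assms(1)] partial_DERIV[OF assms(2)]]] by simp_all

lemma Ck_on_lin:
  assumes U: "open U"
  shows "Ck_on k U f \<Longrightarrow> Ck_on k U g \<Longrightarrow> Ck_on k U (\<lambda>x. f x + c * g x)"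
proof (induction k arbitrary: f g)
  case 0
  then show ?case by (auto simp: Ck_on_0 intro!: continuous_intros)
next
  case (Suc k)
  have "Ck_on k U (partial i (\<lambda>x. f x + c * g x))" for i
    by (rule Ck_on_cong_open[OF U _ Suc.IH[of "partial i f" "partial i g"]])
      (use Suc.prems in \<open>auto simp: Ck_on_Suc partial_lin\<close>)
  then show ?case using Suc.prems by (auto simp: Ck_on_Suc intro!: partial_lin(1) continuous_intros)
qed

lemma Ck_on_mult:
  assumes U: "open U"
  shows "Ck_on k U f \<Longrightarrow> Ck_on k U g \<Longrightarrow> Ck_on k U (\<lambda>x. f x * g x)"
proof (induction k arbitrary: f g)
  case 0
  then show ?case by (auto simp: Ck_on_0 intro!: continuous_intros)
next
  case (Suc k)
  have "Ck_on k U (partial i (\<lambda>x. f x * g x))" for i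
  proof (rule Ck_on_cong_open[OF U, of "\<lambda>x. partial i f x * g x + 1 * (partial i g x * f x)"])
    show "Ck_on k U (\<lambda>x. partial i f x * g x + 1 * (partial i g x * f x))"
      using Suc.prems Ck_on_mono[of "Suc k" U _ k]
      by (intro Ck_on_lin[OF U] Suc.IH) (auto simp: Ck_on_Suc[of k])
  qed (use Suc.prems in \<open>auto simp: Ck_on_Suc partial_mult\<close>)
  then show ?case using Suc.prems by (auto simp: Ck_on_Suc intro!: partial_mult(1) continuous_intros)
qed

lemma partial_const: "partial i (\<lambda>x. c) = (\<lambda>x. 0)" and has_partial_const: "has_partial i (\<lambda>x. c) x"
  using partialI[of "\<lambda>x. c", OF DERIV_const] by (auto simp: fun_eq_iff)

lemma Ck_on_const: "Ck_on k U (\<lambda>x. c)"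
  by (induction k arbitrary: c) (auto simp: Ck_on_0 Ck_on_Suc partial_const has_partial_const)

lemma partial_nth:
  "has_partial i (\<lambda>x. x $ j) x" "partial i (\<lambda>x. x $ j) x = (if i = j then 1 else 0)"
proof -
  have "((\<lambda>t. (x + t *\<^sub>R axis i 1) $ j) has_real_derivative (if i = j then 1 else 0)) (at 0)"
    by (auto simp: axis_def intro!: derivative_eq_intros)
  from partialI[of "\<lambda>x. x $ j", OF this] show "has_partial i (\<lambda>x. x $ j) x" "partial i (\<lambda>x. x $ j) x = (if i = j then 1 else 0)" .
qed

lemma Ck_on_nth: "Ck_on k U (\<lambda>x. x $ j)"
proof (cases k)
  case (Suc m)
  have "partial i (\<lambda>x. x $ j) = (\<lambda>x. if i = j then 1 else 0)" for i by (rule ext) (rule partial_nth(2))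
  then show ?thesis unfolding Suc Ck_on_Suc by (auto intro: Ck_on_const partial_nth(1) continuous_intros)
qed (auto simp: Ck_on_0 intro!: continuous_intros)

lemma partial_radial:
  assumes h: "smooth_real h"
  shows "has_partial i (radial h) x" "partial i (radial h) x = radial (deriv h) x * (2 * x $ i)"
proof -
  have "((\<lambda>t. (x + t *\<^sub>R axis i 1) \<bullet> (x + t *\<^sub>R axis i 1)) has_real_derivative 2 * x $ i) (at 0)"
    by (auto intro!: derivative_eq_intros simp: inner_add_left inner_add_right inner_axis inner_axis' inner_commute)
  then have "((\<lambda>t. radial h (x + t *\<^sub>R axis i 1)) has_real_derivative radial (deriv h) x * (2 * x $ i)) (at 0)"
    unfolding radial_def using DERIV_chain2[OF smooth_real_DERIV[OF h]] by fastforce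
  from partialI[OF this] show "has_partial i (radial h) x" "partial i (radial h) x = radial (deriv h) x * (2 * x $ i)" .
qed

lemma Ck_on_radial: "smooth_real h \<Longrightarrow> Ck_on k (UNIV :: (real^'n::finite) set) (radial h)"
proof (induction k arbitrary: h)
  case 0
  then show ?case by (simp add: Ck_on_0 radial_continuous)
next
  case (Suc k)
  have "partial i (radial h) = (\<lambda>x. radial (deriv h) x * (2 * x $ i))" for i :: 'n
    using partial_radial(2)[OF Suc.prems] by blast
  moreover have "Ck_on k UNIV (\<lambda>x. radial (deriv h) x * (2 * x $ i))" for i :: 'n
    by (intro Ck_on_mult open_UNIV Suc.IH smooth_real_deriv Suc.prems Ck_on_const Ck_on_nth)
  ultimately show ?case
    by (simp add: Ck_on_Suc partial_radial(1)[OF Suc.prems] radial_continuous[OF Suc.prems])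
qed

lemma iter_partial_lin:
  assumes U: "open U"
  shows "Ck_on (length js) U f \<Longrightarrow> Ck_on (length js) U g \<Longrightarrow> x \<in> U \<Longrightarrow>
    iter_partial js (\<lambda>x. f x + c * g x) x = iter_partial js f x + c * iter_partial js g x"
proof (induction js arbitrary: x)
  case (Cons i js)
  have "iter_partial (i # js) (\<lambda>x. f x + c * g x) x = partial i (\<lambda>x. iter_partial js f x + c * iter_partial js g x) x"
    unfolding iter_partial.simps
  proof (rule partial_cong_open(2)[OF U Cons.prems(3)], rule Cons.IH)
    show "Ck_on (length js) U f" "Ck_on (length js) U g"
      using Cons.prems by (auto elim: Ck_on_mono)
  qed
  also have "\<dots> = iter_partial (i # js) f x + c * iter_partial (i # js) g x"
    unfolding iter_partial.simps using Cons.prems by (intro partial_lin(2)) (auto simp: Ck_on_def)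
  finally show ?case .
qed simp

text \<open>Each derivative of \<open>radial h\<close> produces a factor 2 z_i, so the induction has
  to carry a smooth multiplier M; differentiating the product gives the two multipliers 2 z_i M and
  \<open>partial i M\<close>. The constant is independent of h, so smallness of the profile in C^k
  passes to all partial derivatives.\<close>

lemma iter_partial_radial_bound:
  fixes M :: "real^'n::finite \<Rightarrow> real" and r :: real
  assumes "\<And>k. Ck_on k UNIV M"
  shows "\<exists>C\<ge>0. \<forall>h e. smooth_real h \<longrightarrow> (\<forall>j\<le>length js. \<forall>q\<in>{0..r\<^sup>2}. \<bar>(deriv ^^ j) h q\<bar> \<le> e) \<longrightarrow>
    (\<forall>z. norm z \<le> r \<longrightarrow> \<bar>iter_partial js (\<lambda>z. radial h z * M z) z\<bar> \<le> C * e)"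
  using assms
proof (induction js arbitrary: M rule: rev_induct)
  case Nil
  have "continuous_on (cball 0 r) M"
    using Nil[of 0] continuous_on_subset by (auto simp: Ck_on_0)
  then have "bounded (M ` cball 0 r)"
    by (intro compact_imp_bounded compact_continuous_image) auto
  then obtain C where C: "C > 0" "\<forall>z\<in>cball 0 r. \<bar>M z\<bar> \<le> C" unfolding bounded_pos by auto
  have "\<bar>radial h z * M z\<bar> \<le> C * e" if "\<forall>q\<in>{0..r\<^sup>2}. \<bar>h q\<bar> \<le> e" "norm z \<le> r" for h z e
  proof -
    have "(norm z)\<^sup>2 \<le> r\<^sup>2" using that(2) by (intro power_mono) auto
    then have "z \<bullet> z \<in> {0..r\<^sup>2}" by (simp add: power2_norm_eq_inner)
    then have 1: "\<bar>radial h z\<bar> \<le> e" using that(1) by (simp add: radial_def)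
    have "\<bar>M z\<bar> * \<bar>radial h z\<bar> \<le> C * e" using 1 C that(2) by (intro mult_mono) auto
    then show ?thesis by (simp add: abs_mult mult.commute)
  qed
  then show ?case using C(1) by (intro exI[of _ C]) auto
next
  case (snoc i js)
  let ?M1 = "\<lambda>z. 2 * z $ i * M z"
  have M1: "Ck_on k UNIV ?M1" for k
    by (intro Ck_on_mult open_UNIV Ck_on_const Ck_on_nth snoc.prems)
  have M2: "Ck_on k UNIV (partial i M)" for k
    using snoc.prems[of "Suc k"] by (simp add: Ck_on_Suc)
  obtain C1 where C1: "C1 \<ge> 0" "\<And>h e z. smooth_real h \<Longrightarrow> (\<forall>j\<le>length js. \<forall>q\<in>{0..r\<^sup>2}. \<bar>(deriv ^^ j) h q\<bar> \<le> e) \<Longrightarrow>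
    norm z \<le> r \<Longrightarrow> \<bar>iter_partial js (\<lambda>z. radial h z * ?M1 z) z\<bar> \<le> C1 * e"
    using snoc.IH[of ?M1] M1 by meson
  obtain C2 where C2: "C2 \<ge> 0" "\<And>h e z. smooth_real h \<Longrightarrow> (\<forall>j\<le>length js. \<forall>q\<in>{0..r\<^sup>2}. \<bar>(deriv ^^ j) h q\<bar> \<le> e) \<Longrightarrow>
    norm z \<le> r \<Longrightarrow> \<bar>iter_partial js (\<lambda>z. radial h z * partial i M z) z\<bar> \<le> C2 * e"
    using snoc.IH[of "partial i M"] M2 by meson
  have "\<bar>iter_partial (js @ [i]) (\<lambda>z. radial h z * M z) z\<bar> \<le> (C1 + C2) * e"
    if h: "smooth_real h" and e: "\<forall>j\<le>length (js @ [i]). \<forall>q\<in>{0..r\<^sup>2}. \<bar>(deriv ^^ j) h q\<bar> \<le> e" and z: "norm z \<le> r" for h e z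
  proof -
    have hp: "has_partial i M x" for x using snoc.prems[of 1] by (simp add: Ck_on_Suc)
    have "partial i (\<lambda>z. radial h z * M z) = (\<lambda>z. radial (deriv h) z * ?M1 z + 1 * (radial h z * partial i M z))"
      by (rule ext) (simp add: partial_mult(2)[OF partial_radial(1)[OF h] hp] partial_radial(2)[OF h])
    then have "iter_partial (js @ [i]) (\<lambda>z. radial h z * M z) z
      = iter_partial js (\<lambda>z. radial (deriv h) z * ?M1 z + 1 * (radial h z * partial i M z)) z"
      by (simp add: iter_partial_snoc)
    also have "\<dots> = iter_partial js (\<lambda>z. radial (deriv h) z * ?M1 z) z + 1 * iter_partial js (\<lambda>z. radial h z * partial i M z) z"
      by (rule iter_partial_lin[OF open_UNIV])
        (auto intro!: Ck_on_mult M1 M2 Ck_on_radial h smooth_real_deriv simp del: mult.assoc)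
    finally have eq: "iter_partial (js @ [i]) (\<lambda>z. radial h z * M z) z
      = iter_partial js (\<lambda>z. radial (deriv h) z * ?M1 z) z + iter_partial js (\<lambda>z. radial h z * partial i M z) z" by simp
    have "\<forall>j\<le>length js. \<forall>q\<in>{0..r\<^sup>2}. \<bar>(deriv ^^ j) (deriv h) q\<bar> \<le> e"
    proof (intro allI impI ballI)
      fix j q assume "j \<le> length js" "q \<in> {0..r\<^sup>2}"
      then have "\<bar>(deriv ^^ Suc j) h q\<bar> \<le> e" using e[rule_format, of "Suc j" q] by simp
      then show "\<bar>(deriv ^^ j) (deriv h) q\<bar> \<le> e" by (simp only: funpow_Suc_right comp_def)
    qed
    from C1(2)[OF smooth_real_deriv[OF h] this z] C2(2)[OF h _ z, of e] e
    show ?thesis unfolding eq by (simp add: distrib_right)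
  qed
  then show ?case using C1(1) C2(1) by (intro exI[of _ "C1 + C2"]) auto
qed

lemma iter_partial_zero: "iter_partial js (\<lambda>x. 0) = (\<lambda>x. 0)"
  by (induction js) (auto simp: partial_const)

lemma iter_partial_radial_support:
  fixes z :: "real^'n::finite"
  assumes z: "\<And>q. q \<ge> b \<Longrightarrow> h q = 0" and zb: "z \<bullet> z > b"
  shows "iter_partial js (radial h) z = 0"
proof -
  have "open {z::real^'n. b < z \<bullet> z}" by (intro open_Collect_less continuous_intros)
  then have "iter_partial js (radial h) z = iter_partial js (\<lambda>x. 0) z"
    by (rule iter_partial_cong_open) (use z zb in \<open>auto simp: radial_def\<close>)
  then show ?thesis by (simp add: iter_partial_zero)
qed

lemma iter_partial_radial_bounded:
  assumes h: "smooth_real h" and z: "\<And>q. q \<ge> b \<Longrightarrow> h q = 0"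
  shows "\<exists>C. \<forall>z::real^'n::finite. \<bar>iter_partial js (radial h) z\<bar> \<le> C"
proof -
  define K where "K = {z::real^'n. z \<bullet> z \<le> max b 0}"
  have "K = cball 0 (sqrt (max b 0))"
    by (auto simp: K_def norm_eq_sqrt_inner)
  then have "compact K" by simp
  moreover have "continuous_on K (iter_partial js (radial h))"
    using Ck_on_radial[OF h, of "length js"] unfolding Ck_on_def by (meson continuous_on_subset order_refl subset_UNIV)
  ultimately have "bounded (iter_partial js (radial h) ` K)" by (intro compact_imp_bounded compact_continuous_image)
  then obtain C where C: "C > 0" "\<forall>z\<in>K. \<bar>iter_partial js (radial h) z\<bar> \<le> C" unfolding bounded_pos by auto
  have "\<bar>iter_partial js (radial h) z\<bar> \<le> C" for z :: "real^'n"
  proof (cases "z \<in> K")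
    case False
    then have "z \<bullet> z > b" by (auto simp: K_def)
    then have "iter_partial js (radial h) z = 0" by (rule iter_partial_radial_support[rotated]) (rule z)
    then show ?thesis using C(1) by simp
  qed (use C in auto)
  then show ?thesis by blast
qed

subsection \<open>Convolution and mollification\<close>

definition conv :: "(real^'n::finite \<Rightarrow> real) \<Rightarrow> (real^'n \<Rightarrow> real) \<Rightarrow> real^'n \<Rightarrow> real" where
  "conv F k x = (\<integral>p. F p * k (x - p) \<partial>lborel)"

lemma conv_integrable:
  fixes F k :: "real^'n::finite \<Rightarrow> real"
  assumes F: "integrable lborel F" and k: "continuous_on UNIV k" and A: "\<And>z. \<bar>k z\<bar> \<le> A"
  shows "integrable lborel (\<lambda>p. F p * k (x - p))"
proof (rule Bochner_Integration.integrable_bound[OF integrable_mult_right[OF F, of A]])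
  have [measurable]: "k \<in> borel_measurable borel" using k by (rule borel_measurable_continuous_onI)
  have [measurable]: "F \<in> borel_measurable borel" using borel_measurable_integrable[OF F] by simp
  show "(\<lambda>p. F p * k (x - p)) \<in> borel_measurable lborel" by measurable
  show "AE p in lborel. norm (F p * k (x - p)) \<le> norm (A * F p)"
    using mult_right_mono[OF A abs_ge_zero] order_trans[OF abs_ge_zero A]
    by (intro AE_I2) (simp add: abs_mult mult.commute)
qed

lemma conv_continuous:
  assumes F: "integrable lborel F" and k: "continuous_on UNIV k" and A: "\<And>z. \<bar>k z\<bar> \<le> A"
  shows "continuous_on UNIV (conv F k)"
  unfolding continuous_on_sequentially
proof (intro ballI allI impI)
  fix x and X :: "nat \<Rightarrow> real^'a" assume X: "(\<forall>n. X n \<in> UNIV) \<and> X \<longlonglongrightarrow> x"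
  have "(\<lambda>n. conv F k (X n)) \<longlonglongrightarrow> conv F k x"
    unfolding conv_def
  proof (rule integral_dominated_convergence[where w = "\<lambda>p. A * \<bar>F p\<bar>"])
    show "integrable lborel (\<lambda>p. A * \<bar>F p\<bar>)" using F by simp
    show "AE p in lborel. (\<lambda>n. F p * k (X n - p)) \<longlonglongrightarrow> F p * k (x - p)"
    proof (rule AE_I2)
      fix p
      have "(\<lambda>n. X n - p) \<longlonglongrightarrow> x - p" using X by (intro tendsto_intros) auto
      then have "(\<lambda>n. k (X n - p)) \<longlonglongrightarrow> k (x - p)"
        using k by (intro continuous_on_tendsto_compose[OF k]) auto
      then show "(\<lambda>n. F p * k (X n - p)) \<longlonglongrightarrow> F p * k (x - p)" by (intro tendsto_intros)
    qed
    show "AE p in lborel. norm (F p * k (X n - p)) \<le> A * \<bar>F p\<bar>" for n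
      using mult_right_mono[OF A abs_ge_zero] by (intro AE_I2) (simp add: abs_mult mult.commute)
  qed (use conv_integrable[OF F k A] in \<open>auto intro: borel_measurable_integrable\<close>)
  then show "(conv F k \<circ> X) \<longlonglongrightarrow> conv F k x" by (simp add: comp_def)
qed

lemma conv_partial:
  assumes F: "integrable lborel F" and k: "continuous_on UNIV k" and A: "\<And>z. \<bar>k z\<bar> \<le> A"
    and p: "\<And>z. has_partial i k z" and k': "continuous_on UNIV (partial i k)" and A': "\<And>z. \<bar>partial i k z\<bar> \<le> A'"
  shows "has_partial i (conv F k) x" "partial i (conv F k) x = conv F (partial i k) x"
proof -
  have "((\<lambda>t. \<integral>p. F p * k (x + t *\<^sub>R axis i 1 - p) \<partial>lborel) has_real_derivative
     (\<integral>p. F p * partial i k (x + 0 *\<^sub>R axis i 1 - p) \<partial>lborel)) (at 0)"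
  proof (rule has_real_derivative_integral[where r = 1 and w = "\<lambda>p. A' * \<bar>F p\<bar>"
        and f' = "\<lambda>t p. F p * partial i k (x + t *\<^sub>R axis i 1 - p)"])
    show "((\<lambda>t. F z * k (x + t *\<^sub>R axis i 1 - z)) has_real_derivative F z * partial i k (x + t *\<^sub>R axis i 1 - z)) (at t)" for t z
    proof (rule DERIV_cmult)
      have "((\<lambda>t. k ((x - z) + t *\<^sub>R axis i 1)) has_real_derivative partial i k ((x - z) + t *\<^sub>R axis i 1)) (at t)"
        by (rule partial_DERIV_line[OF p])
      then show "((\<lambda>t. k (x + t *\<^sub>R axis i 1 - z)) has_real_derivative partial i k (x + t *\<^sub>R axis i 1 - z)) (at t)"
        by (simp add: algebra_simps)
    qed
    show "\<bar>F z * partial i k (x + t *\<^sub>R axis i 1 - z)\<bar> \<le> A' * \<bar>F z\<bar>" for t z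
      using mult_right_mono[OF A' abs_ge_zero] by (simp add: abs_mult mult.commute)
    show "integrable lborel (\<lambda>p. A' * \<bar>F p\<bar>)" using F by simp
  qed (use conv_integrable[OF F k A] conv_integrable[OF F k' A'] in \<open>auto intro: borel_measurable_integrable\<close>)
  then have "((\<lambda>t. conv F k (x + t *\<^sub>R axis i 1)) has_real_derivative conv F (partial i k) x) (at 0)"
    by (simp add: conv_def)
  from partialI[OF this] show "has_partial i (conv F k) x" "partial i (conv F k) x = conv F (partial i k) x" .
qed

text \<open>All derivatives fall on the kernel. The F used in the end is cut off by an indicator and
  may jump, so it cannot be differentiated itself.\<close>

lemma
  assumes F: "integrable lborel F" and k: "\<And>n. Ck_on n UNIV k"
    and bd: "\<And>js. \<exists>C. \<forall>z. \<bar>iter_partial js k z\<bar> \<le> C"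
  shows iter_partial_conv: "iter_partial js (conv F k) = conv F (iter_partial js k)"
    and smooth_conv: "smooth (conv F k)"
proof -
  have c: "continuous_on UNIV (iter_partial js k)" for js
    using k[of "length js"] by (simp add: Ck_on_def)
  have p: "has_partial i (iter_partial js k) z" for i js z
    using k[of "Suc (length js)"] by (simp add: Ck_on_def)
  have step: "has_partial i (conv F (iter_partial js k)) x"
    "partial i (conv F (iter_partial js k)) x = conv F (iter_partial (i # js) k) x" for i js x
  proof -
    obtain A where A: "\<And>z. \<bar>iter_partial js k z\<bar> \<le> A" using bd[of js] by blast
    obtain A' where A': "\<And>z. \<bar>partial i (iter_partial js k) z\<bar> \<le> A'" using bd[of "i # js"] by auto
    show "has_partial i (conv F (iter_partial js k)) x"
      "partial i (conv F (iter_partial js k)) x = conv F (iter_partial (i # js) k) x"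
      using conv_partial[OF F c A p _ A'] c[of "i # js"] by simp_all
  qed
  have it: "iter_partial js (conv F k) = conv F (iter_partial js k)" for js
  proof (induction js)
    case (Cons i js)
    show ?case unfolding iter_partial.simps(2)[of i js "conv F k"] Cons by (rule ext) (rule step(2))
  qed simp
  show "iter_partial js (conv F k) = conv F (iter_partial js k)" by (rule it)
  have "continuous_on UNIV (conv F (iter_partial js k))" for js
  proof -
    obtain A where A: "\<And>z. \<bar>iter_partial js k z\<bar> \<le> A" using bd[of js] by blast
    show ?thesis by (rule conv_continuous[OF F c A])
  qed
  then show "smooth (conv F k)" unfolding smooth_def Ck_on_def it using step(1) by blast
qed

text \<open>The kernel confines z to |z| < \<delta>, and r (1 + \<delta>) <= 1 then keeps the
  argument of A in the unit ball. Nothing is known about A elsewhere, so measurability comes from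
  continuity on the ball of radius \<delta> and vanishing of the product outside.\<close>

lemma mollify_integrable:
  fixes A :: "real^'n::finite \<Rightarrow> real"
  assumes kp: "integrable lborel kp" "continuous_on UNIV kp" and supp: "\<And>z. \<delta> \<le> norm z \<Longrightarrow> kp z = 0"
    and r: "0 < r" "r * (1 + \<delta>) \<le> 1" and A: "continuous_on (ball 0 1) A" "\<And>x. x \<in> ball 0 1 \<Longrightarrow> \<bar>A x\<bar> \<le> B"
    and x: "norm x < 1"
  shows "integrable lborel (\<lambda>z. kp z * (c * A (r *\<^sub>R (x - z))))"
    and "\<And>z. kp z \<noteq> 0 \<Longrightarrow> r *\<^sub>R (x - z) \<in> ball 0 1"
proof -
  have inb: "r *\<^sub>R (x - z) \<in> ball 0 1" if "norm z < \<delta>" for z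
  proof -
    have "norm (x - z) < 1 + \<delta>" using norm_triangle_ineq4[of x z] x that by linarith
    then have "r * norm (x - z) < r * (1 + \<delta>)" using r by (intro mult_strict_left_mono)
    also note r(2)
    finally show ?thesis using r by simp
  qed
  then show inb': "r *\<^sub>R (x - z) \<in> ball 0 1" if "kp z \<noteq> 0" for z using supp[of z] that by force
  have B: "0 \<le> B" using A(2)[of 0] by simp
  have "continuous_on (ball 0 \<delta>) (\<lambda>z. kp z * (c * A (r *\<^sub>R (x - z))))"
    using inb by (intro continuous_intros continuous_on_subset[OF kp(2)] continuous_on_compose2[OF A(1)]) auto
  then have m: "(\<lambda>z. indicator (ball 0 \<delta>) z *\<^sub>R (kp z * (c * A (r *\<^sub>R (x - z))))) \<in> borel_measurable borel"
    by (intro borel_measurable_continuous_on_indicator) auto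
  have "(\<lambda>z. indicator (ball 0 \<delta>) z *\<^sub>R (kp z * (c * A (r *\<^sub>R (x - z))))) = (\<lambda>z. kp z * (c * A (r *\<^sub>R (x - z))))"
    using supp by (auto simp: indicator_def fun_eq_iff)
  with m have m': "(\<lambda>z. kp z * (c * A (r *\<^sub>R (x - z)))) \<in> borel_measurable lborel" by simp
  show "integrable lborel (\<lambda>z. kp z * (c * A (r *\<^sub>R (x - z))))"
  proof (rule Bochner_Integration.integrable_bound[OF integrable_mult_right[OF kp(1), of "c * B"] m'])
    show "AE z in lborel. norm (kp z * (c * A (r *\<^sub>R (x - z)))) \<le> norm (c * B * kp z)"
    proof (rule AE_I2)
      fix z
      have "\<bar>kp z\<bar> * \<bar>A (r *\<^sub>R (x - z))\<bar> \<le> \<bar>kp z\<bar> * B"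
        using A(2)[OF inb'[of z]] by (cases "kp z = 0") (auto intro: mult_left_mono)
      from mult_left_mono[OF this abs_ge_zero[of c]]
      show "norm (kp z * (c * A (r *\<^sub>R (x - z)))) \<le> norm (c * B * kp z)"
        using B by (simp add: abs_mult mult.commute mult.left_commute)
    qed
  qed
qed

text \<open>Counterpart of \<open>iter_partial_conv\<close>: here the derivatives fall on f, each
  contributing a factor r by the chain rule. This is the form in which the mollified derivatives can
  be compared with those of f.\<close>

lemma iter_partial_mollify:
  fixes f :: "real^'n::finite \<Rightarrow> real"
  assumes kp: "integrable lborel kp" "continuous_on UNIV kp" and supp: "\<And>z. \<delta> \<le> norm z \<Longrightarrow> kp z = 0"
    and r: "0 < r" "r * (1 + \<delta>) \<le> 1" and f: "Ck_on k (ball 0 1) f"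
    and bd: "\<And>js. length js \<le> k \<Longrightarrow> \<exists>B. \<forall>x\<in>ball 0 1. \<bar>iter_partial js f x\<bar> \<le> B"
  shows "length js \<le> k \<Longrightarrow> x \<in> ball 0 1 \<Longrightarrow>
    iter_partial js (\<lambda>x. \<integral>z. kp z * f (r *\<^sub>R (x - z)) \<partial>lborel) x
     = (\<integral>z. kp z * (r ^ length js * iter_partial js f (r *\<^sub>R (x - z))) \<partial>lborel)"
proof (induction js arbitrary: x)
  case (Cons i js)
  let ?A = "iter_partial js f" and ?m = "length js"
  let ?G = "\<lambda>x. \<integral>z. kp z * (r ^ ?m * ?A (r *\<^sub>R (x - z))) \<partial>lborel"
  have len: "length js < k" using Cons.prems by simp
  obtain B where B: "\<And>x. x \<in> ball 0 1 \<Longrightarrow> \<bar>?A x\<bar> \<le> B" using bd[OF less_imp_le[OF len]] by blast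
  obtain B' where B': "\<And>x. x \<in> ball 0 1 \<Longrightarrow> \<bar>partial i ?A x\<bar> \<le> B'"
    using bd[OF Cons.prems(1)] unfolding iter_partial.simps by blast
  have cA: "continuous_on (ball 0 1) ?A" using f len by (simp add: Ck_on_def)
  have cA': "continuous_on (ball 0 1) (partial i ?A)"
    using f Cons.prems(1) unfolding Ck_on_def by (metis iter_partial.simps(2))
  have pA: "has_partial i ?A y" if "y \<in> ball 0 1" for y using f len that by (simp add: Ck_on_def)
  \<comment> \<open>Distance of x to the unit sphere: shifts along the axis by less than this stay
    in the ball.\<close>
  define \<rho> where "\<rho> = 1 - norm x"
  have \<rho>: "\<rho> > 0" using Cons.prems(2) by (simp add: \<rho>_def)
  let ?x = "\<lambda>t. x + t *\<^sub>R axis i 1"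
  have xt: "norm (?x t) < 1" if "\<bar>t - 0\<bar> < \<rho>" for t
    using norm_triangle_ineq[of x "t *\<^sub>R axis i 1"] that by (simp add: \<rho>_def)
  have B'0: "0 \<le> B'" using B'[of 0] by simp
  have "((\<lambda>t. \<integral>z. kp z * (r ^ ?m * ?A (r *\<^sub>R (?x t - z))) \<partial>lborel) has_real_derivative
     (\<integral>z. kp z * (r ^ Suc ?m * partial i ?A (r *\<^sub>R (?x 0 - z))) \<partial>lborel)) (at 0)"
  proof (rule has_real_derivative_integral[OF \<rho>, where w = "\<lambda>z. \<bar>kp z\<bar> * (r ^ Suc ?m * B')"
        and f' = "\<lambda>t z. kp z * (r ^ Suc ?m * partial i ?A (r *\<^sub>R (?x t - z)))"])
    fix t assume t: "\<bar>t - 0\<bar> < \<rho>"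
    show "integrable lborel (\<lambda>z. kp z * (r ^ ?m * ?A (r *\<^sub>R (?x t - z))))"
      by (rule mollify_integrable(1)[OF kp supp r cA B xt[OF t]])
    fix z
    have inb: "r *\<^sub>R (?x t - z) \<in> ball 0 1" if "kp z \<noteq> 0"
      by (rule mollify_integrable(2)[OF kp _ r cA _ xt[OF t] that]) (use supp B in auto)
    show "((\<lambda>t. kp z * (r ^ ?m * ?A (r *\<^sub>R (?x t - z)))) has_real_derivative
        kp z * (r ^ Suc ?m * partial i ?A (r *\<^sub>R (?x t - z)))) (at t)"
    proof (cases "kp z = 0")
      case False
      have line: "r *\<^sub>R (?x u - z) = r *\<^sub>R (x - z) + (r * u) *\<^sub>R axis i 1" for u
        by (simp add: algebra_simps)
      have hp: "has_partial i ?A (r *\<^sub>R (x - z) + (r * t) *\<^sub>R axis i 1)"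
        using pA[OF inb[OF False]] by (simp only: line)
      have "((\<lambda>u. ?A (r *\<^sub>R (x - z) + (r * u) *\<^sub>R axis i 1)) has_real_derivative
          partial i ?A (r *\<^sub>R (x - z) + (r * t) *\<^sub>R axis i 1) * r) (at t)"
        by (rule DERIV_chain2[where f = "\<lambda>u. ?A (r *\<^sub>R (x - z) + u *\<^sub>R axis i 1)" and g = "\<lambda>u. r * u",
            OF partial_DERIV_line[OF hp]])
          (auto intro!: derivative_eq_intros)
      note d = DERIV_cmult[OF DERIV_cmult[OF this, of "r ^ ?m"], of "kp z"]
      show ?thesis unfolding line by (rule DERIV_cong[OF d]) (simp add: mult.commute mult.left_commute)
    qed simp
    show "\<bar>kp z * (r ^ Suc ?m * partial i ?A (r *\<^sub>R (?x t - z)))\<bar> \<le> \<bar>kp z\<bar> * (r ^ Suc ?m * B')"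
    proof (cases "kp z = 0")
      case False
      show ?thesis unfolding abs_mult using B'[OF inb[OF False]] r
        by (intro mult_left_mono) (auto simp: abs_mult)
    qed simp
  next
    show "integrable lborel (\<lambda>z. \<bar>kp z\<bar> * (r ^ Suc ?m * B'))" using kp(1) by simp
    show "(\<lambda>z. kp z * (r ^ Suc ?m * partial i ?A (r *\<^sub>R (?x 0 - z)))) \<in> borel_measurable lborel"
      using mollify_integrable(1)[OF kp supp r cA' B' xt[of 0]] \<rho> by (auto intro: borel_measurable_integrable)
  qed
  then have "partial i ?G x = (\<integral>z. kp z * (r ^ Suc ?m * partial i ?A (r *\<^sub>R (x - z))) \<partial>lborel)"
    using partialI(2)[of ?G x i] by simp
  moreover have "iter_partial (i # js) (\<lambda>x. \<integral>z. kp z * f (r *\<^sub>R (x - z)) \<partial>lborel) x = partial i ?G x"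
    unfolding iter_partial.simps
    by (rule partial_cong_open(2)[OF open_ball Cons.prems(2)]) (use Cons.IH len in simp)
  ultimately show ?case by simp
qed simp

text \<open>For |z| < \<delta> the point r (x - z) has distance at most (1 - r) + r \<delta> = 2 (1
  - r) from x, which explains the modulus in \<open>uc\<close>. The factor c stands for the power of
  r produced by differentiation.\<close>

lemma mollify_error:
  fixes A :: "real^'n::finite \<Rightarrow> real"
  assumes kp: "integrable lborel kp" "continuous_on UNIV kp" and supp: "\<And>z. \<delta> \<le> norm z \<Longrightarrow> kp z = 0"
    and kp0: "\<And>z. 0 \<le> kp z" and kp1: "integral\<^sup>L lborel kp = 1"
    and r: "0 < r" "r \<le> 1" "r * (1 + \<delta>) = 1" and A: "continuous_on (ball 0 1) A" "\<And>x. x \<in> ball 0 1 \<Longrightarrow> \<bar>A x\<bar> \<le> B"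
    and uc: "\<And>x y. x \<in> ball 0 1 \<Longrightarrow> y \<in> ball 0 1 \<Longrightarrow> norm (x - y) \<le> 2 * (1 - r) \<Longrightarrow> \<bar>A x - A y\<bar> \<le> e"
    and x: "norm x < 1"
  shows "\<bar>(\<integral>z. kp z * (c * A (r *\<^sub>R (x - z))) \<partial>lborel) - A x\<bar> \<le> \<bar>c - 1\<bar> * B + e"
proof -
  have r': "r * (1 + \<delta>) \<le> 1" using r by simp
  note int = mollify_integrable(1)[OF kp supp r(1) r' A x, of c]
  have "(\<integral>z. kp z * (c * A (r *\<^sub>R (x - z))) \<partial>lborel) - A x
     = (\<integral>z. kp z * (c * A (r *\<^sub>R (x - z))) - kp z * A x \<partial>lborel)"
    using int kp(1) kp1 by simp
  also have "norm \<dots> \<le> (\<integral>z. kp z * (\<bar>c - 1\<bar> * B + e) \<partial>lborel)"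
  proof (rule Bochner_Integration.integral_norm_bound_integral)
    fix z
    show "norm (kp z * (c * A (r *\<^sub>R (x - z))) - kp z * A x) \<le> kp z * (\<bar>c - 1\<bar> * B + e)"
    proof (cases "kp z = 0")
      case False
      let ?y = "r *\<^sub>R (x - z)"
      have y: "?y \<in> ball 0 1" by (rule mollify_integrable(2)[OF kp _ r(1) r' A(1) _ x False]) (use supp A(2) in auto)
      have "norm z < \<delta>" using supp[of z] False by force
      then have rz: "r * norm z \<le> r * \<delta>" using r by simp
      have "?y - x = (r - 1) *\<^sub>R x - r *\<^sub>R z" by (simp add: algebra_simps)
      then have "norm (?y - x) \<le> (1 - r) * norm x + r * norm z"
        using norm_triangle_ineq4[of "(r - 1) *\<^sub>R x" "r *\<^sub>R z"] r by simp
      also have "\<dots> \<le> (1 - r) * 1 + r * \<delta>" using rz x r by (intro add_mono mult_left_mono) auto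
      also have "\<dots> = 2 * (1 - r)" using r(3) by (simp add: algebra_simps)
      finally have "\<bar>A ?y - A x\<bar> \<le> e" using y x by (intro uc) auto
      moreover have "\<bar>(c - 1) * A ?y\<bar> \<le> \<bar>c - 1\<bar> * B"
        using A(2)[OF y] by (simp add: abs_mult mult_left_mono)
      moreover have "c * A ?y - A x = (c - 1) * A ?y + (A ?y - A x)" by (simp add: algebra_simps)
      ultimately have "\<bar>c * A ?y - A x\<bar> \<le> \<bar>c - 1\<bar> * B + e" by linarith
      then have "kp z * \<bar>c * A ?y - A x\<bar> \<le> kp z * (\<bar>c - 1\<bar> * B + e)" by (rule mult_left_mono) (rule kp0)
      moreover have "norm (kp z * (c * A ?y) - kp z * A x) = kp z * \<bar>c * A ?y - A x\<bar>"
        using kp0[of z] by (simp add: abs_mult flip: right_diff_distrib)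
      ultimately show ?thesis by simp
    qed simp
  qed (use int kp(1) in auto)
  also have "\<dots> = \<bar>c - 1\<bar> * B + e" using kp1 by simp
  finally show ?thesis by simp
qed

lemma Ck_on_closure_bounds:
  assumes f: "Ck_on_closure k U f" and U: "bounded U" and js: "length js \<le> k"
  shows "\<exists>B. \<forall>x\<in>U. \<bar>iter_partial js f x\<bar> \<le> B"
    and "uniformly_continuous_on U (iter_partial js f)"
proof -
  obtain g where g: "continuous_on (closure U) g" "\<And>x. x \<in> U \<Longrightarrow> g x = iter_partial js f x"
    using f js unfolding Ck_on_closure_def by blast
  have c: "compact (closure U)" using U by simp
  have "bounded (g ` closure U)" using g(1) c by (intro compact_imp_bounded compact_continuous_image)
  then obtain B where "\<forall>x\<in>closure U. \<bar>g x\<bar> \<le> B" unfolding bounded_pos by auto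
  then have "\<forall>x\<in>U. \<bar>iter_partial js f x\<bar> \<le> B" using g(2) closure_subset by (metis subsetD)
  then show "\<exists>B. \<forall>x\<in>U. \<bar>iter_partial js f x\<bar> \<le> B" by blast
  have "uniformly_continuous_on (closure U) g" using g(1) c by (rule compact_uniformly_continuous)
  then have "uniformly_continuous_on U g" unfolding uniformly_continuous_on_def using closure_subset by (meson subsetD)
  then show "uniformly_continuous_on U (iter_partial js f)"
    using g(2) unfolding uniformly_continuous_on_def by simp
qed

subsection \<open>Approximation of antisymmetric functions\<close>

lemma reflect_inner: "reflect i x \<bullet> reflect i y = x \<bullet> y"
  unfolding inner_vec_def reflect_def by (intro sum.cong) auto

lemma reflect_diff: "reflect i (x - y) = reflect i x - reflect i y"
  and reflect_scale: "reflect i (c *\<^sub>R x) = c *\<^sub>R reflect i x"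
  by (auto simp: reflect_def vec_eq_iff)

lemma norm_reflect: "norm (reflect i x) = norm x"
  by (simp add: norm_eq_sqrt_inner reflect_inner)

lemma lborel_distr_reflect: "distr lborel borel (reflect i) = lborel"
proof -
  let ?c = "\<lambda>j. if j = axis i 1 then - 1 else 1 :: real"
  have eq: "(\<lambda>x::real^'a. \<Sum>j\<in>Basis. (?c j * (x \<bullet> j)) *\<^sub>R j) = reflect i"
  proof
    fix x :: "real^'a"
    show "(\<Sum>j\<in>Basis. (?c j * (x \<bullet> j)) *\<^sub>R j) = reflect i x"
    proof (rule euclidean_eqI)
      fix b :: "real^'a" assume b: "b \<in> Basis"
      then obtain l where l: "b = axis l 1" by (auto simp: Basis_vec_def)
      have "(\<Sum>j\<in>Basis. (?c j * (x \<bullet> j)) *\<^sub>R j) \<bullet> b = ?c b * (x \<bullet> b)"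
        using b by (simp add: inner_sum_left_Basis)
      also have "\<dots> = reflect i x \<bullet> b"
        by (simp add: l inner_axis reflect_def axis_eq_axis)
      finally show "(\<Sum>j\<in>Basis. (?c j * (x \<bullet> j)) *\<^sub>R j) \<bullet> b = reflect i x \<bullet> b" .
    qed
  qed
  show ?thesis unfolding eq[symmetric] by (rule lborel_distr_signs) simp
qed

lemma conv_radial_antisymmetric:
  assumes F: "integrable lborel F" and odd: "\<And>p. F (reflect i p) = - F p" and h: "smooth_real h"
  shows "conv F (radial h) (reflect i x) = - conv F (radial h) x"
proof -
  have [measurable]: "F \<in> borel_measurable borel" using borel_measurable_integrable[OF F] by simp
  have [measurable]: "radial h \<in> borel_measurable borel" by (rule radial_borel[OF h])
  have [measurable]: "reflect i \<in> borel_measurable borel"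
  proof (rule borel_measurable_continuous_onI)
    have "continuous_on UNIV (\<lambda>x::real^'a. if j = i then - (x $ j) else x $ j)" for j
      by (cases "j = i") (auto intro!: continuous_intros)
    then show "continuous_on UNIV (reflect i)"
      unfolding reflect_def by (intro continuous_on_vec_lambda)
  qed
  have "conv F (radial h) (reflect i x) = (\<integral>p. F p * radial h (reflect i x - p) \<partial>distr lborel borel (reflect i))"
    by (simp add: conv_def lborel_distr_reflect)
  also have "\<dots> = (\<integral>p. F (reflect i p) * radial h (reflect i x - reflect i p) \<partial>lborel)"
    by (rule integral_distr) measurable
  also have "\<dots> = (\<integral>p. - (F p * radial h (x - p)) \<partial>lborel)"
    by (simp add: odd radial_def reflect_inner flip: reflect_diff)
  also have "\<dots> = - conv F (radial h) x" by (simp add: conv_def)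
  finally show ?thesis .
qed

text \<open>The mollifier is built from a smooth profile in |z|^2, because
  \<open>psi_approx_smooth\<close> will be applied to that profile.\<close>

lemma radial_flat_mollifier:
  assumes \<delta>: "0 < \<delta>"
  obtains h where "smooth_real h" "\<And>q. \<delta>\<^sup>2 \<le> q \<Longrightarrow> h q = 0" "\<And>z::real^'n::finite. 0 \<le> radial h z"
    "integrable lborel (radial h :: real^'n \<Rightarrow> real)" "integral\<^sup>L lborel (radial h :: real^'n \<Rightarrow> real) = 1"
proof -
  let ?b = "\<lambda>q. flat 1 ((- 1) * q + \<delta>\<^sup>2)"
  let ?k = "radial ?b :: real^'n \<Rightarrow> real"
  have b: "smooth_real ?b" by (rule smooth_real_affine[OF smooth_real_flat])
  have b0: "\<delta>\<^sup>2 \<le> q \<Longrightarrow> ?b q = 0" for q by (simp add: flat_def)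
  have pos: "0 \<le> ?k z" for z by (simp add: radial_def flat_def)
  have small: "z \<bullet> z < \<delta>\<^sup>2 \<longleftrightarrow> z \<in> ball 0 \<delta>" for z :: "real^'n"
    using \<delta> by (simp add: flip: power2_norm_eq_inner) (metis abs_norm_cancel abs_of_pos power2_less_imp_less power_strict_mono norm_ge_zero zero_less_numeral less_imp_le)
  have int: "integrable lborel ?k"
  proof -
    have "set_integrable lborel (cball 0 \<delta>) ?k"
      unfolding set_integrable_def
      by (rule borel_integrable_compact[OF compact_cball radial_continuous[OF b]])
    moreover have "(\<lambda>z. indicator (cball 0 \<delta>) z *\<^sub>R ?k z) = ?k"
    proof
      fix z
      show "indicator (cball 0 \<delta>) z *\<^sub>R ?k z = ?k z"
        using small[of z] b0[of "z \<bullet> z"] by (cases "z \<in> ball 0 \<delta>") (auto simp: radial_def indicator_def)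
    qed
    ultimately show ?thesis by (simp add: set_integrable_def)
  qed
  have nz: "integral\<^sup>L lborel ?k \<noteq> 0"
  proof
    assume "integral\<^sup>L lborel ?k = 0"
    then have "AE z in lborel. ?k z = 0"
      by (subst (asm) integral_nonneg_eq_0_iff_AE[OF int]) (use pos in \<open>simp_all only: AE_I2\<close>)
    then have "AE z in lborel. z \<notin> (ball 0 \<delta> :: (real^'n) set)"
    proof (rule eventually_mono)
      fix z :: "real^'n" assume "?k z = 0"
      then have "\<not> z \<bullet> z < \<delta>\<^sup>2" by (auto simp: radial_def flat_def split: if_splits)
      then show "z \<notin> ball 0 \<delta>" using small by blast
    qed
    then have "emeasure lborel (ball 0 \<delta> :: (real^'n) set) = 0"
      by (subst (asm) AE_iff_measurable[where N = "ball 0 \<delta>"]) auto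
    then show False using content_ball_pos[OF \<delta>, of "0 :: real^'n"] by (simp add: measure_def)
  qed
  moreover have "0 \<le> integral\<^sup>L lborel ?k" by (rule integral_nonneg_AE) (intro AE_I2 pos)
  ultimately have I: "0 < integral\<^sup>L lborel ?k" by simp
  define h where "h = (\<lambda>q. (1 / integral\<^sup>L lborel ?k) * ?b q)"
  have rh: "radial h z = (1 / integral\<^sup>L lborel ?k) * ?k z" for z :: "real^'n" by (simp add: h_def radial_def)
  show ?thesis
  proof (rule that[of h])
    show "smooth_real h" unfolding h_def by (intro smooth_real_mult smooth_real_const b)
    show "\<delta>\<^sup>2 \<le> q \<Longrightarrow> h q = 0" for q using b0 by (simp add: h_def)
    show "0 \<le> radial h z" for z :: "real^'n" unfolding rh using I pos by simp
    show "integrable lborel (radial h :: real^'n \<Rightarrow> real)" unfolding rh using int by simp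
    show "integral\<^sup>L lborel (radial h :: real^'n \<Rightarrow> real) = 1" unfolding rh using nz by simp
  qed
qed

text \<open>For x in the unit ball and |z| < \<delta>, |x - z| < 1 + \<delta> = 1/r, so the cut-off
  in the convolution is invisible.\<close>

lemma conv_eq_mollify:
  fixes f kp :: "real^'n::finite \<Rightarrow> real"
  assumes f: "continuous_on (cball 0 1) f" and kp: "continuous_on UNIV kp" and supp: "\<And>z. \<delta> \<le> norm z \<Longrightarrow> kp z = 0"
    and r: "0 < r" "r * (1 + \<delta>) = 1" and x: "x \<in> ball 0 1"
  shows "conv (\<lambda>p. indicator (ball 0 (1/r)) p * f (r *\<^sub>R p)) kp x = (\<integral>z. kp z * f (r *\<^sub>R (x - z)) \<partial>lborel)"
proof -
  let ?F = "\<lambda>p. indicator (ball 0 (1/r)) p * f (r *\<^sub>R p)"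
  have "continuous_on (ball 0 (1/r)) (\<lambda>p. f (r *\<^sub>R p))"
    using r by (intro continuous_on_compose2[OF f] continuous_intros) (auto simp: field_simps)
  then have "(\<lambda>p. indicator (ball 0 (1/r)) p *\<^sub>R f (r *\<^sub>R p)) \<in> borel_measurable borel"
    by (intro borel_measurable_continuous_on_indicator) auto
  then have [measurable]: "?F \<in> borel_measurable borel" by simp
  have [measurable]: "kp \<in> borel_measurable borel" using kp by (rule borel_measurable_continuous_onI)
  have "conv ?F kp x = (\<integral>p. ?F p * kp (x - p) \<partial>distr lborel borel ((+) x))"
    by (simp add: conv_def lborel_distr_plus)
  also have "\<dots> = (\<integral>z. ?F (x + z) * kp (- z) \<partial>lborel)"
    by (subst integral_distr) auto
  also have "\<dots> = (\<integral>z. ?F (x + z) * kp (- z) \<partial>distr lborel borel uminus)"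
    by (simp add: lborel_distr_uminus_euclidean)
  also have "\<dots> = (\<integral>z. ?F (x - z) * kp z \<partial>lborel)"
    by (subst integral_distr) auto
  also have "\<dots> = (\<integral>z. kp z * f (r *\<^sub>R (x - z)) \<partial>lborel)"
  proof (rule Bochner_Integration.integral_cong[OF refl])
    fix z
    show "?F (x - z) * kp z = kp z * f (r *\<^sub>R (x - z))"
    proof (cases "kp z = 0")
      case False
      then have "norm z < \<delta>" using supp[of z] by force
      then have "norm (x - z) < 1 + \<delta>" using norm_triangle_ineq4[of x z] x by simp
      also have "1 + \<delta> = 1 / r" using r by (simp add: field_simps)
      finally show ?thesis by (simp add: indicator_def)
    qed simp
  qed
  finally show ?thesis .
qed

theorem theorem1p1:
  fixes s :: real and k :: nat and f :: "real^'n::finite \<Rightarrow> real" and i :: 'n and \<epsilon> :: real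
  assumes "0 < s" and "s < 1"
    and "Ck_on_closure k (ball 0 1) f"
    and "antisymmetric_on i (cball 0 1) f"
    and "\<epsilon> > 0"
  shows "\<exists>(u :: real^'n \<Rightarrow> real) (R :: real).
           smooth u \<and> antisymmetric_on i UNIV u \<and> R > 1 \<and>
           s_harmonic_on s (ball 0 1) u \<and>
           (\<forall>x. x \<notin> ball 0 R \<longrightarrow> u x = 0) \<and>
           Ck_norm k (ball 0 1) (\<lambda>x. u x - f x) < ereal \<epsilon>"
proof -
  note s = assms(1,2) and f = assms(3) and anti = assms(4) and \<epsilon> = assms(5)
  define J where "J = {js :: 'n list. length js \<le> k}"
  have J: "finite J" unfolding J_def using finite_lists_length_le[of "UNIV :: 'n set" k] by simp
  have fC: "Ck_on k (ball 0 1) f" and fcont: "continuous_on (cball 0 1) f"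
    using f by (auto simp: Ck_on_closure_def)
  have bd: "\<exists>B. \<forall>x\<in>ball 0 1. \<bar>iter_partial js f x\<bar> \<le> B"
    and uc: "uniformly_continuous_on (ball 0 1) (iter_partial js f)" if "length js \<le> k" for js
    using Ck_on_closure_bounds[OF f bounded_ball that] by auto
  define B where "B = (\<lambda>js. SOME B. \<forall>x\<in>ball 0 1. \<bar>iter_partial js f x\<bar> \<le> B)"
  have B: "\<bar>iter_partial js f x\<bar> \<le> B js" if "length js \<le> k" "x \<in> ball 0 1" for js x
    using someI_ex[OF bd[OF that(1)]] that(2) by (auto simp: B_def)

  \<comment> \<open>Two conditions on r, for the finitely many derivatives at once: the factors r^m
    are close to 1, and each derivative of f varies little over the distance 2 (1 - r) of
    \<open>mollify_error\<close>.\<close>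
  have "\<forall>\<^sub>F r in at_left 1. \<forall>js\<in>J. \<bar>r ^ length js - 1\<bar> * B js < \<epsilon> / 6 \<and>
     (\<forall>x\<in>ball 0 1. \<forall>y\<in>ball 0 1. norm (x - y) \<le> 2 * (1 - r) \<longrightarrow> \<bar>iter_partial js f x - iter_partial js f y\<bar> \<le> \<epsilon> / 6)"
  proof (rule eventually_ball_finite[OF J], rule ballI, rule eventually_conj)
    fix js assume "js \<in> J"
    then have js: "length js \<le> k" by (simp add: J_def)
    have "((\<lambda>r. \<bar>r ^ length js - 1\<bar> * B js) \<longlongrightarrow> \<bar>1 ^ length js - 1\<bar> * B js) (at_left 1)"
      by (intro tendsto_intros)
    then show "\<forall>\<^sub>F r in at_left 1. \<bar>r ^ length js - 1\<bar> * B js < \<epsilon> / 6"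
      using \<epsilon> by (intro order_tendstoD) auto
    obtain d where d: "d > 0" "\<And>x y. x \<in> ball 0 1 \<Longrightarrow> y \<in> ball 0 1 \<Longrightarrow> dist y x < d \<Longrightarrow>
        dist (iter_partial js f y) (iter_partial js f x) < \<epsilon> / 6"
      using uc[OF js] \<epsilon> unfolding uniformly_continuous_on_def by (metis zero_less_divide_iff zero_less_numeral)
    have "\<forall>\<^sub>F r in at_left 1. r \<in> {1 - d / 2<..<1}"
      by (rule eventually_at_leftI[of "1 - d / 2"]) (use d(1) in auto)
    then show "\<forall>\<^sub>F r in at_left 1. \<forall>x\<in>ball 0 1. \<forall>y\<in>ball 0 1. norm (x - y) \<le> 2 * (1 - r) \<longrightarrow>
       \<bar>iter_partial js f x - iter_partial js f y\<bar> \<le> \<epsilon> / 6"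
    proof eventually_elim
      case (elim r)
      show ?case
      proof (intro ballI impI)
        fix x y :: "real^'n" assume xy: "x \<in> ball 0 1" "y \<in> ball 0 1" "norm (x - y) \<le> 2 * (1 - r)"
        then have "dist x y < d" using elim by (simp add: dist_norm)
        from d(2)[OF xy(2,1) this] show "\<bar>iter_partial js f x - iter_partial js f y\<bar> \<le> \<epsilon> / 6"
          by (simp add: dist_real_def)
      qed
    qed
  qed
  \<comment> \<open>r > 1/2 gives 1/r < 2, hence |x - p| < 3 for x in the unit ball and p in the
    support of F.\<close>
  moreover have "\<forall>\<^sub>F r in at_left 1. r \<in> {1/2<..<1::real}"
    by (rule eventually_at_leftI[of "1/2"]) auto
  ultimately obtain r where r: "1/2 < r" "r < 1"
    and r1: "\<And>js. js \<in> J \<Longrightarrow> \<bar>r ^ length js - 1\<bar> * B js < \<epsilon> / 6"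
    and r2: "\<And>js x y. js \<in> J \<Longrightarrow> x \<in> ball 0 1 \<Longrightarrow> y \<in> ball 0 1 \<Longrightarrow> norm (x - y) \<le> 2 * (1 - r) \<Longrightarrow>
       \<bar>iter_partial js f x - iter_partial js f y\<bar> \<le> \<epsilon> / 6"
    using eventually_happens'[OF trivial_limit_at_left_real eventually_conj] by (metis (mono_tags, lifting) greaterThanLessThan_iff)

  \<comment> \<open>The width gained by dilation: p -> f(r p) is defined up to radius 1/r = 1 +
    \<delta>.\<close>
  define \<delta> where "\<delta> = 1 / r - 1"
  have \<delta>: "\<delta> > 0" and r\<delta>: "r * (1 + \<delta>) = 1" using r by (auto simp: \<delta>_def field_simps)
  obtain h where h: "smooth_real h" "\<And>q. \<delta>\<^sup>2 \<le> q \<Longrightarrow> h q = 0" "\<And>z::real^'n. 0 \<le> radial h z"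
    "integrable lborel (radial h :: real^'n \<Rightarrow> real)" "integral\<^sup>L lborel (radial h :: real^'n \<Rightarrow> real) = 1"
    using radial_flat_mollifier[OF \<delta>] by metis
  have hs: "radial h z = 0" if "\<delta> \<le> norm z" for z :: "real^'n"
  proof -
    have "\<delta>\<^sup>2 \<le> (norm z)\<^sup>2" using that \<delta> by (intro power_mono) auto
    then show ?thesis by (simp add: radial_def h(2) power2_norm_eq_inner)
  qed
  have hc: "continuous_on UNIV (radial h :: real^'n \<Rightarrow> real)" by (rule radial_continuous[OF h(1)])

  define F where "F = (\<lambda>p::real^'n. indicator (ball 0 (1/r)) p * f (r *\<^sub>R p))"
  have Fcont: "continuous_on (cball 0 (1/r)) (\<lambda>p. f (r *\<^sub>R p))"
    using r by (intro continuous_on_compose2[OF fcont] continuous_intros) (auto simp: field_simps)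
  have Fint: "integrable lborel F"
  proof -
    have 1: "integrable lborel (\<lambda>p. indicator (cball 0 (1/r)) p *\<^sub>R f (r *\<^sub>R p))"
      by (rule borel_integrable_compact[OF compact_cball Fcont])
    have "integrable lborel (\<lambda>p. indicator (ball 0 (1/r)) p *\<^sub>R (indicator (cball 0 (1/r)) p *\<^sub>R f (r *\<^sub>R p)))"
      by (rule integrable_mult_indicator[OF _ 1]) simp
    then show ?thesis
      unfolding F_def by (rule Bochner_Integration.integrable_cong[THEN iffD1, rotated -1]) (auto simp: indicator_def)
  qed
  define I where "I = (\<integral>p. \<bar>F p\<bar> \<partial>lborel)"
  have I: "0 \<le> I" unfolding I_def by (intro integral_nonneg_AE) auto

  \<comment> \<open>The radius 3 covers every difference x - p that occurs; the multiplier of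
    \<open>iter_partial_radial_bound\<close> is the constant 1.\<close>
  have "\<forall>js. \<exists>C\<ge>0. \<forall>h e. smooth_real h \<longrightarrow> (\<forall>j\<le>length js. \<forall>q\<in>{0..3\<^sup>2}. \<bar>(deriv ^^ j) h q\<bar> \<le> e) \<longrightarrow>
    (\<forall>z::real^'n. norm z \<le> 3 \<longrightarrow> \<bar>iter_partial js (\<lambda>z. radial h z * 1) z\<bar> \<le> C * e)"
    by (intro allI iter_partial_radial_bound Ck_on_const)
  then obtain C where C: "\<And>js. 0 \<le> C js" "\<And>js h e z. smooth_real h \<Longrightarrow>
      (\<forall>j\<le>length js. \<forall>q\<in>{0..3\<^sup>2}. \<bar>(deriv ^^ j) h q\<bar> \<le> e) \<Longrightarrow>
      norm (z::real^'n) \<le> 3 \<Longrightarrow> \<bar>iter_partial js (\<lambda>z. radial h z * 1) z\<bar> \<le> C js * e"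
    by metis
  define C0 where "C0 = (\<Sum>js\<in>J. C js)"
  have C0: "C js \<le> C0" if "js \<in> J" for js
    unfolding C0_def using J that C(1) by (intro member_le_sum) auto
  have C00: "0 \<le> C0" unfolding C0_def by (intro sum_nonneg C(1))
  \<comment> \<open>A profile error e costs C0 e in the derivatives of the kernel, and convolution
    with F multiplies this by its L^1 norm I; the summand 1 keeps the denominator positive.\<close>
  define e where "e = \<epsilon> / (6 * (C0 * I + 1))"
  have e: "e > 0" using \<epsilon> C00 I by (simp add: e_def add_nonneg_pos)
  have eI: "I * (C0 * e) \<le> \<epsilon> / 6"
  proof -
    define T where "T = C0 * I + 1"
    have "T > 0" using C00 I by (simp add: T_def add_nonneg_pos)
    then have "e * T = \<epsilon> / 6" unfolding e_def T_def[symmetric] by simp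
    then have "e * (C0 * I + 1) = \<epsilon> / 6" by (simp only: T_def)
    then show ?thesis using e by (simp add: algebra_simps)
  qed

  \<comment> \<open>9 = 3^2 is the square of the largest |x - p|: the profile is approximated on
    [0, 9], and 9 < q1 makes the kernel harmonic at all these points.\<close>
  obtain g q1 q2 where g: "9 < q1" "q1 \<le> q2" "smooth_supp q1 q2 g"
    "\<And>j q. j \<le> k \<Longrightarrow> q \<in> {0..9} \<Longrightarrow> \<bar>psi s ((deriv ^^ j) g) q - (deriv ^^ j) h q\<bar> < e"
    using psi_approx_smooth[OF s, of 9 h k] h(1) e unfolding psi_approx_def by (metis zero_less_numeral)
  let ?P = "psi s g"
  have P: "smooth_real ?P" by (rule smooth_real_psi[OF s(1) g(3)])
  define D where "D = (\<lambda>q. ?P q + (- 1) * h q)"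
  have D: "smooth_real D" unfolding D_def by (intro smooth_real_add smooth_real_mult smooth_real_const P h(1))
  have Dj: "\<bar>(deriv ^^ j) D q\<bar> \<le> e" if "j \<le> k" "q \<in> {0..3\<^sup>2}" for j q
    unfolding D_def funpow_deriv_lin[OF P h(1)] funpow_deriv_psi[OF s(1) g(3)] using g(4)[of j q] that by simp

  let ?K = "radial ?P :: real^'n \<Rightarrow> real" and ?k = "radial h :: real^'n \<Rightarrow> real"
  have KC: "Ck_on n UNIV ?K" and kC: "Ck_on n UNIV ?k" for n by (rule Ck_on_radial[OF P] Ck_on_radial[OF h(1)])+
  have Kb: "\<exists>C. \<forall>z. \<bar>iter_partial js ?K z\<bar> \<le> C" for js
    by (rule iter_partial_radial_bounded[OF P]) (rule psi_eq_0[OF g(3)])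
  have kb: "\<exists>C. \<forall>z. \<bar>iter_partial js ?k z\<bar> \<le> C" for js
    by (rule iter_partial_radial_bounded[OF h(1)]) (rule h(2))
  have Kk: "\<bar>iter_partial js ?K z - iter_partial js ?k z\<bar> \<le> C0 * e" if js: "js \<in> J" and z: "norm z \<le> 3" for js z
  proof -
    have "iter_partial js ?K z - iter_partial js ?k z = iter_partial js (\<lambda>z. ?K z + (- 1) * ?k z) z"
      by (subst iter_partial_lin[OF open_UNIV KC kC]) auto
    also have "(\<lambda>z. ?K z + (- 1) * ?k z) = (\<lambda>z. radial D z * 1)" by (auto simp: radial_def D_def)
    finally have "\<bar>iter_partial js ?K z - iter_partial js ?k z\<bar> \<le> C js * e"
      using C(2)[OF D _ z, of js e] Dj js by (simp add: J_def)
    also have "\<dots> \<le> C0 * e" using C0[OF js] e by (intro mult_right_mono) auto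
    finally show ?thesis .
  qed

  define u where "u = conv F ?K"
  \<comment> \<open>F lives in radius 1/r and the kernel in radius sqrt q2; the sum of the two
    bounds the support of the convolution.\<close>
  define R where "R = 1 / r + sqrt q2 + 1"
  have q2: "q2 > 0" using g by simp
  have usm: "smooth u" unfolding u_def by (rule smooth_conv[OF Fint KC Kb])
  have Fodd: "F (reflect i p) = - F p" for p
  proof (cases "p \<in> ball 0 (1/r)")
    case True
    then have "r *\<^sub>R p \<in> cball 0 1" using r by (simp add: field_simps)
    then have "f (reflect i (r *\<^sub>R p)) = - f (r *\<^sub>R p)" using anti by (auto simp: antisymmetric_on_def)
    then show ?thesis using True by (simp add: F_def norm_reflect reflect_scale indicator_def)
  qed (simp add: F_def norm_reflect indicator_def)
  have uanti: "antisymmetric_on i UNIV u"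
    unfolding antisymmetric_on_def u_def using conv_radial_antisymmetric[OF Fint Fodd P] by blast
  have R1: "R > 1" using r q2 by (simp add: R_def add_pos_pos)
  have usupp: "u x = 0" if "x \<notin> ball 0 R" for x
  proof -
    have "F p * ?K (x - p) = 0" for p
    proof (cases "F p = 0")
      case False
      then have "norm p < 1 / r" by (auto simp: F_def indicator_def split: if_splits)
      moreover have "R \<le> norm x" using that by simp
      ultimately have "sqrt q2 \<le> norm (x - p)" using norm_triangle_ineq2[of x p] by (simp add: R_def)
      then have "(sqrt q2)\<^sup>2 \<le> (norm (x - p))\<^sup>2" using q2 by (intro power_mono) auto
      then have "q2 \<le> (x - p) \<bullet> (x - p)" using q2 by (simp add: power2_norm_eq_inner)
      then show ?thesis by (simp add: radial_def psi_eq_0[OF g(3)])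
    qed simp
    then have "(\<lambda>p. F p * ?K (x - p)) = (\<lambda>p. 0)" by blast
    then show ?thesis by (simp only: u_def conv_def integral_zero)
  qed
  have near: "norm (x - p) < 3" if x: "x \<in> ball 0 1" and p: "F p \<noteq> 0" for x p
  proof -
    have "norm p < 1 / r" using p by (auto simp: F_def indicator_def split: if_splits)
    also have "1 / r < 2" using r by (simp add: field_simps)
    finally show ?thesis using norm_triangle_ineq4[of x p] x by simp
  qed
  have uharm: "s_harmonic_on s (ball 0 1) u"
    unfolding s_harmonic_on_def
  proof
    fix x :: "real^'n" assume x: "x \<in> ball 0 1"
    have "(x - p) \<bullet> (x - p) < q1" if "F p \<noteq> 0" for p
    proof -
      have "(norm (x - p))\<^sup>2 < 3\<^sup>2" using near[OF x that] by (intro power_strict_mono) auto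
      then show ?thesis using g(1) by (simp add: power2_norm_eq_inner)
    qed
    then have "has_frac_laplacian s (\<lambda>x. \<integral>p. F p * ?K (x - p) \<partial>lborel) x 0"
      using g by (intro convolution_harmonic[OF s g(3) _ _ Fint]) auto
    then show "has_frac_laplacian s u x 0" by (simp add: u_def conv_def[abs_def])
  qed

  \<comment> \<open>One \<epsilon>/6 for replacing the mollifier by the harmonic kernel, two for
    mollifying and dilating f. The total \<epsilon>/2 leaves room for the strict inequality, as the
    supremum only preserves a weak bound.\<close>
  have err: "\<bar>iter_partial js (\<lambda>x. u x - f x) x\<bar> \<le> \<epsilon> / 2" if js: "js \<in> J" and x: "x \<in> ball 0 1" for js x
  proof -
    have len: "length js \<le> k" using js by (simp add: J_def)
    have "Ck_on (length js) (ball 0 1) u"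
      using usm unfolding smooth_def Ck_on_def by (meson UNIV_I continuous_on_subset subset_UNIV)
    then have split: "iter_partial js (\<lambda>x. u x - f x) x = iter_partial js u x - iter_partial js f x"
      using iter_partial_lin[OF open_ball _ Ck_on_mono[OF fC len] x, of u "- 1"] by simp
    have it: "iter_partial js u x = (\<integral>p. F p * iter_partial js ?K (x - p) \<partial>lborel)"
      "iter_partial js (conv F ?k) x = (\<integral>p. F p * iter_partial js ?k (x - p) \<partial>lborel)"
      unfolding u_def iter_partial_conv[OF Fint KC Kb] iter_partial_conv[OF Fint kC kb] conv_def by simp_all
    have int: "integrable lborel (\<lambda>p. F p * iter_partial js ?K (x - p))"
      "integrable lborel (\<lambda>p. F p * iter_partial js ?k (x - p))"
    proof -
      have "continuous_on UNIV (iter_partial js ?K)" "continuous_on UNIV (iter_partial js ?k)"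
        using KC[of "length js"] kC[of "length js"] by (simp_all add: Ck_on_def)
      then show "integrable lborel (\<lambda>p. F p * iter_partial js ?K (x - p))"
        "integrable lborel (\<lambda>p. F p * iter_partial js ?k (x - p))"
        using Kb[of js] kb[of js] conv_integrable[OF Fint] by blast+
    qed
    have "norm (iter_partial js u x - iter_partial js (conv F ?k) x) \<le> (\<integral>p. \<bar>F p\<bar> * (C0 * e) \<partial>lborel)"
      unfolding it Bochner_Integration.integral_diff[OF int, symmetric]
    proof (rule Bochner_Integration.integral_norm_bound_integral)
      fix p
      show "norm (F p * iter_partial js ?K (x - p) - F p * iter_partial js ?k (x - p)) \<le> \<bar>F p\<bar> * (C0 * e)"
      proof (cases "F p = 0")
        case False
        have "\<bar>F p\<bar> * \<bar>iter_partial js ?K (x - p) - iter_partial js ?k (x - p)\<bar> \<le> \<bar>F p\<bar> * (C0 * e)"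
          using near[OF x False] by (intro mult_left_mono Kk[OF js]) auto
        then show ?thesis by (simp flip: right_diff_distrib add: abs_mult)
      qed simp
    qed (use int Fint in auto)
    also have "\<dots> = I * (C0 * e)" by (simp add: I_def)
    finally have e1: "\<bar>iter_partial js u x - iter_partial js (conv F ?k) x\<bar> \<le> \<epsilon> / 6" using eI by simp
    \<comment> \<open>Both forms of the same convolution are used: above with the derivatives on the
      kernels, from here on with the derivatives on f.\<close>
    have "iter_partial js (conv F ?k) x = iter_partial js (\<lambda>x. \<integral>z. ?k z * f (r *\<^sub>R (x - z)) \<partial>lborel) x"
      unfolding F_def
      by (rule iter_partial_cong_open[OF open_ball _ x]) (use r r\<delta> hs in \<open>auto intro!: conv_eq_mollify[OF fcont hc]\<close>)
    also have "\<dots> = (\<integral>z. ?k z * (r ^ length js * iter_partial js f (r *\<^sub>R (x - z))) \<partial>lborel)"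
      by (rule iter_partial_mollify[OF h(4) hc hs _ _ fC bd len x]) (use r r\<delta> in auto)
    also have "\<bar>\<dots> - iter_partial js f x\<bar> \<le> \<bar>r ^ length js - 1\<bar> * B js + \<epsilon> / 6"
    proof (rule mollify_error[OF h(4) hc hs h(3) h(5)])
      show "continuous_on (ball 0 1) (iter_partial js f)" using fC len by (simp add: Ck_on_def)
    qed (use r r\<delta> B[OF len] r2[OF js] x in auto)
    finally have "\<bar>iter_partial js (conv F ?k) x - iter_partial js f x\<bar> \<le> \<epsilon> / 6 + \<epsilon> / 6"
      using r1[OF js] by linarith
    then show ?thesis unfolding split using e1 by linarith
  qed
  have "Ck_norm k (ball 0 1) (\<lambda>x. u x - f x) \<le> ereal (\<epsilon> / 2)"
    unfolding Ck_norm_def by (intro SUP_least) (use err in \<open>auto simp: J_def\<close>)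
  also have "\<dots> < ereal \<epsilon>" using \<epsilon> by simp
  finally have "Ck_norm k (ball 0 1) (\<lambda>x. u x - f x) < ereal \<epsilon>" .
  then show ?thesis using usm uanti R1 uharm usupp by blast
qed

end
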